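(* Fix $(r,s)\in\mathbb{C}^2\setminus\frac12\mathbb{Z}^2$ and $\tau_0\in\mathbb{H}$. Then $\wp(p_{r,s}(\tau)|\tau)$ has a pole at $\tau_0$ (equivalently $p_{r,s}(\tau_0)\in\Lambda_{\tau_0}$, equivalently $t_0=t(\tau_0)$ is a pole of $\lambda_{r,s}(t)$) if and only if either $r+s\tau_0\in\Lambda_{\tau_0}$, or $r+s\tau_0\notin\Lambda_{\tau_0}$ and $Z^{(2)}_{r,s}(\tau_0)=0$.
   Context: Notation: $\mathbb{H}$ upper half plane; $\Lambda_\tau=\mathbb{Z}+\mathbb{Z}\tau$; $\wp(z|\tau)$, $\zeta(z|\tau)$ Weierstrass functions with periods $1,\tau$; quasi-periods $\eta_1,\eta_2$ with $\zeta(z+1)=\zeta(z)+\eta_1$, $\zeta(z+\tau)=\zeta(z)+\eta_2$; $e_1=\wp(\frac12)$, $e_2=\wp(\frac\tau2)$, $e_3=\wp(\frac{1+\tau}2)$; $\wp'^2=4\wp^3-g_2\wp-g_3$; $t(\tau)=\frac{e_3-e_1}{e_2-e_1}$. For $(r,s)\in\mathbb{C}^2\setminus\frac12\mathbb{Z}^2$: $\alpha=r+s\tau$, $Z_{r,s}(\tau)=\zeta(r+s\tau|\tau)-r\eta_1(\tau)-s\eta_2(\tau)$, $Z^{(2)}_{r,s}(\tau)=Z_{r,s}(\tau)^3-3\wp(r+s\tau|\tau)Z_{r,s}(\tau)-\wp'(r+s\tau|\tau)$, and $\wp(p_{r,s}(\tau)|\tau)=\wp(\alpha)+\frac{3\wp'(\alpha)Z_{r,s}^2+(12\wp(\alpha)^2-g_2)Z_{r,s}+3\wp(\alpha)\wp'(\alpha)}{2Z^{(2)}_{r,s}(\tau)}$,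 a meromorphic function of $\tau\in\mathbb{H}$; $\lambda_{r,s}(t(\tau))=\frac{\wp(p_{r,s}(\tau)|\tau)-e_1}{e_2-e_1}$ is a solution of PVI$(\frac98,-\frac18,\frac18,\frac38)$. *)

theory Defs
  imports "HOL-Analysis.Analysis"
begin

definition lattice :: "complex \<Rightarrow> complex set" where
  "lattice \<tau> = {of_int m + of_int n * \<tau> | m n. True}"

definition wp :: "complex \<Rightarrow> complex \<Rightarrow> complex" where
  "wp z \<tau> = 1 / z\<^sup>2 + infsum (\<lambda>\<omega>. 1 / (z - \<omega>)\<^sup>2 - 1 / \<omega>\<^sup>2) (lattice \<tau> - {0})"

definition wp' :: "complex \<Rightarrow> complex \<Rightarrow> complex" where
  "wp' z \<tau> = - 2 * infsum (\<lambda>\<omega>. 1 / (z - \<omega>) ^ 3) (lattice \<tau>)"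

definition wzeta :: "complex \<Rightarrow> complex \<Rightarrow> complex" where
  "wzeta z \<tau> = 1 / z + infsum (\<lambda>\<omega>. 1 / (z - \<omega>) + 1 / \<omega> + z / \<omega>\<^sup>2) (lattice \<tau> - {0})"

text \<open>Quasi-periods: zeta(z+1) = zeta(z) + eta1, zeta(z+tau) = zeta(z) + eta2
  (Legendre: eta1 = 2 zeta(1/2), eta2 = 2 zeta(tau/2)).\<close>
definition eta1 :: "complex \<Rightarrow> complex" where
  "eta1 \<tau> = 2 * wzeta (1/2) \<tau>"

definition eta2 :: "complex \<Rightarrow> complex" where
  "eta2 \<tau> = 2 * wzeta (\<tau>/2) \<tau>"

text \<open>Invariant g2 (wp'^2 = 4 wp^3 - g2 wp - g3).\<close>
definition g2 :: "complex \<Rightarrow> complex" where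
  "g2 \<tau> = 60 * infsum (\<lambda>\<omega>. 1 / \<omega> ^ 4) (lattice \<tau> - {0})"

definition Zrs :: "complex \<Rightarrow> complex \<Rightarrow> complex \<Rightarrow> complex" where
  "Zrs r s \<tau> = wzeta (r + s * \<tau>) \<tau> - r * eta1 \<tau> - s * eta2 \<tau>"

definition Z2rs :: "complex \<Rightarrow> complex \<Rightarrow> complex \<Rightarrow> complex" where
  "Z2rs r s \<tau> = (let \<alpha> = r + s * \<tau>; Z = Zrs r s \<tau> in
      Z ^ 3 - 3 * wp \<alpha> \<tau> * Z - wp' \<alpha> \<tau>)"

text \<open>The function tau |-> wp(p_{r,s}(tau)|tau), given by the explicit formula.\<close>
definition wp_p :: "complex \<Rightarrow> complex \<Rightarrow> complex \<Rightarrow> complex" where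
  "wp_p r s \<tau> = (let \<alpha> = r + s * \<tau>; Z = Zrs r s \<tau> in
      wp \<alpha> \<tau> + (3 * wp' \<alpha> \<tau> * Z\<^sup>2 + (12 * (wp \<alpha> \<tau>)\<^sup>2 - g2 \<tau>) * Z
                    + 3 * wp \<alpha> \<tau> * wp' \<alpha> \<tau>) / (2 * Z2rs r s \<tau>))"

end

theory Submission
  imports Defs "HOL-Complex_Analysis.Complex_Analysis"
begin

text \<open>
  Near a point where \<open>\<alpha> = r + s \<tau>\<close> lies in the lattice, a shift by integers makes \<open>\<alpha>\<close> vanish at \<open>\<tau>\<^sub>0\<close>.
  Legendre's relation \<open>\<eta>\<^sub>1 \<tau> - \<eta>\<^sub>2 = 2 \<pi> \<i>\<close>, obtained by summing the zeta series by rows into cotangents, gives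
  \<open>Z = 1 / \<alpha> + X\<close> with \<open>X \<rightarrow> 2 \<pi> \<i> s \<noteq> 0\<close>; all higher poles cancel and \<open>\<wp>(p)\<close> behaves like \<open>X / (3 \<alpha>)\<close>.

  Away from the lattice the only candidates are zeros of \<open>Z2rs\<close>. There the numerator equals
  \<open>Z (3 (Z\<^sup>2 - \<wp>)\<^sup>2 - g\<^sub>2)\<close>. If \<open>Z = 0\<close>, then \<open>\<wp>'(\<alpha>) = 0\<close>, so \<open>\<alpha>\<close> is a half period and Legendre's relation
  makes \<open>2 r\<close> and \<open>2 s\<close> integers; if the other factor vanishes, the differential equation of \<open>\<wp>\<close> makes its cubic
  degenerate, and then \<open>\<wp>' / (2 \<wp> - u) + \<zeta>\<close> is entire and quasi-periodic, hence affine, contradicting Legendre.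

  It remains that \<open>Z2rs\<close> does not vanish identically in \<open>\<tau>\<close>. If \<open>(r, s)\<close> is not real, some \<open>\<tau>\<close> puts \<open>\<alpha>\<close> into the
  lattice and the first paragraph applies. If it is real, the inversion \<open>\<tau> \<mapsto> - 1 / \<tau>\<close> and integer shifts reduce to
  \<open>0 < s < 1\<close>, \<open>s \<noteq> 1/2\<close>, where the limit at the cusp \<open>\<tau> \<rightarrow> \<i> \<infinity>\<close> is nonzero.
\<close>


section \<open>Infinite sums and the cotangent\<close>

text \<open>A pole means divergence to infinity along the punctured neighbourhood filter, so default
  values at the point itself, where \<open>x / 0 = 0\<close> enters, do not matter. On a whole
  neighbourhood they would: wherever \<open>Z2rs\<close> vanishes, \<open>wp_p\<close> is just
  \<wp>(\<alpha>), so the zeros of \<open>Z2rs\<close> have to be isolated. What shapes the analysis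
  is that the argument \<alpha> and the period move together with \<tau>. Every series needs a
  majorant valid for all nearby periods at once, so the estimates are made in z and \<omega> alone,
  before a lattice is chosen. Legendre's relation is used in the form Z = \<open>cot_sum\<close> + 2
  \<pi> \<i> s, which contains no quasi-period: invariance under integer shifts of (r, s), the
  constant 2 \<pi> \<i> s at a lattice point and the limit of Z at the cusp are read off from it.
  The facts about elliptic functions (differential equation, zeros of \<wp>', nondegenerate cubic)
  all rest on one Liouville theorem for locally bounded quasi-periodic functions, so zeros and poles
  are never counted.\<close>

lemma summable_on_alter_finite:
  fixes f g :: "'a \<Rightarrow> real"
  assumes "g summable_on UNIV" "finite F" "\<And>k. k \<notin> F \<Longrightarrow> f k = g k"
  shows "f summable_on UNIV"
proof -
  have "f summable_on (- F)"
    using summable_on_subset[OF assms(1), of "- F"] assms(3)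
    by (subst summable_on_cong[of _ f g]) auto
  then have "f summable_on (F \<union> - F)"
    using assms(2) by (intro summable_on_union) auto
  then show ?thesis by simp
qed

lemma summable_on_comparison_complex:
  fixes f :: "'a \<Rightarrow> complex"
  assumes "M summable_on UNIV" "\<And>k. norm (f k) \<le> M k"
  shows "f summable_on UNIV"
  by (rule abs_summable_summable, rule Infinite_Sum.abs_summable_on_comparison_test'[OF assms(1)]) (use assms in auto)

section \<open>Differentiation and passage to the limit under an infinite sum\<close>

text \<open>Weierstrass' theorem on locally uniform limits: a majorant of the terms suffices, none
  is needed for the derivatives. The finitely many terms in \<open>F\<close> escape the majorant,
  but are bounded on a smaller closed disc by compactness.\<close>

lemma has_field_derivative_infsum:
  fixes f f' :: "'a \<Rightarrow> complex \<Rightarrow> complex"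
  assumes e: "e > 0" and F: "finite F" and M: "M summable_on UNIV"
    and deriv: "\<And>k w. w \<in> ball z e \<Longrightarrow> (f k has_field_derivative f' k w) (at w)"
    and bound: "\<And>k w. k \<notin> F \<Longrightarrow> w \<in> ball z e \<Longrightarrow> norm (f k w) \<le> M k"
  shows "((\<lambda>w. \<Sum>\<^sub>\<infinity>k. f k w) has_field_derivative (\<Sum>\<^sub>\<infinity>k. f' k z)) (at z)"
proof -
  have sub: "cball z (e/2) \<subseteq> ball z e" using e by auto
  have cont: "continuous_on (cball z (e/2)) (f k)" for k
    by (rule continuous_on_subset[OF _ sub])
       (meson DERIV_continuous continuous_at_imp_continuous_on deriv)
  have "\<exists>B. \<forall>w\<in>cball z (e/2). norm (f k w) \<le> B" for k
    using compact_imp_bounded[OF compact_continuous_image[OF cont compact_cball]]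
    unfolding bounded_iff by auto
  then obtain B where B: "\<And>k w. w \<in> cball z (e/2) \<Longrightarrow> norm (f k w) \<le> B k" by metis
  define M' where "M' k = (if k \<in> F then B k else M k)" for k
  have "M' summable_on UNIV"
    by (rule summable_on_alter_finite[OF M F]) (simp add: M'_def)
  then have ul: "uniform_limit (cball z (e/2)) (\<lambda>X w. \<Sum>k\<in>X. f k w) (\<lambda>w. \<Sum>\<^sub>\<infinity>k. f k w)
      (finite_subsets_at_top UNIV)"
    by (rule Weierstrass_m_test_general[rotated]) (use B bound sub in \<open>auto simp: M'_def\<close>)
  have ev: "\<forall>\<^sub>F X in finite_subsets_at_top UNIV. continuous_on (cball z (e/2)) (\<lambda>w. \<Sum>k\<in>X. f k w) \<and>
      (\<forall>w\<in>ball z (e/2). ((\<lambda>w. \<Sum>k\<in>X. f k w) has_field_derivative (\<Sum>k\<in>X. f' k w)) (at w))"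
    using cont by (intro always_eventually allI conjI continuous_on_sum ballI DERIV_sum deriv) (use e in auto)
  obtain g' where g': "\<And>w. w \<in> ball z (e/2) \<Longrightarrow>
      ((\<lambda>w. \<Sum>\<^sub>\<infinity>k. f k w) has_field_derivative (g' w)) (at w) \<and>
      ((\<lambda>X. \<Sum>k\<in>X. f' k w) \<longlongrightarrow> g' w) (finite_subsets_at_top UNIV)"
    using has_complex_derivative_uniform_limit[OF ev ul] e by (auto simp: finite_subsets_at_top_neq_bot)
  have "((\<lambda>k. f' k z) has_sum g' z) UNIV"
    using g'[of z] e by (auto simp: has_sum_def)
  then show ?thesis using g'[of z] e by (auto simp: infsumI)
qed

text \<open>Dominated convergence: the majorant makes the partial sums converge uniformly in
  \<open>x\<close>, so the two limits may be exchanged. The bound passes to \<open>g\<close> and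
  makes the limiting series summable.\<close>

lemma tendsto_infsum_dominated:
  fixes f :: "'b \<Rightarrow> 'a \<Rightarrow> complex"
  assumes M: "M summable_on UNIV"
    and lim: "\<And>k. ((\<lambda>x. f x k) \<longlongrightarrow> g k) G"
    and bound: "\<forall>\<^sub>F x in G. \<forall>k. norm (f x k) \<le> M k"
    and nt: "G \<noteq> bot"
  shows "((\<lambda>x. \<Sum>\<^sub>\<infinity>k. f x k) \<longlongrightarrow> (\<Sum>\<^sub>\<infinity>k. g k)) G"
proof (rule swap_uniform_limit')
  let ?S = "{x. \<forall>k. norm (f x k) \<le> M k}"
  have "norm (g k) \<le> M k" for k
    by (rule tendsto_upperbound[OF tendsto_norm[OF lim] _ nt]) (use bound in \<open>auto elim: eventually_mono\<close>)
  then have "g summable_on UNIV" by (rule summable_on_comparison_complex[OF M])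
  then show "(sum g \<longlongrightarrow> (\<Sum>\<^sub>\<infinity>k. g k)) (finite_subsets_at_top UNIV)"
    using has_sum_infsum unfolding has_sum_def by blast
  show "uniform_limit ?S (\<lambda>X x. \<Sum>k\<in>X. f x k) (\<lambda>x. \<Sum>\<^sub>\<infinity>k. f x k) (finite_subsets_at_top UNIV)"
    by (rule Weierstrass_m_test_general[OF _ M]) auto
  show "\<forall>\<^sub>F X in finite_subsets_at_top UNIV. ((\<lambda>x. \<Sum>k\<in>X. f x k) \<longlongrightarrow> sum g X) G"
    by (intro always_eventually allI tendsto_sum lim)
qed (use bound in \<open>auto simp: finite_subsets_at_top_neq_bot\<close>)

section \<open>Symmetric and telescoping sums over the integers\<close>

lemma has_sum_int_symmetric_limit:
  fixes f :: "int \<Rightarrow> complex"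
  assumes "(f has_sum S) UNIV"
  shows "(\<lambda>N. \<Sum>n\<in>{- int N..int N}. f n) \<longlonglongrightarrow> S"
proof -
  have "filterlim (\<lambda>N. {- int N..int N}) (finite_subsets_at_top UNIV) sequentially"
    unfolding filterlim_finite_subsets_at_top
  proof (intro allI impI)
    fix X :: "int set" assume X: "finite X \<and> X \<subseteq> UNIV"
    \<comment> \<open>The sum of the absolute values bounds each of them and, unlike a maximum,
      needs no separate case for the empty set.\<close>
    define N0 where "N0 = nat (\<Sum>x\<in>X. \<bar>x\<bar>)"
    have le: "\<bar>x\<bar> \<le> int N0" if "x \<in> X" for x
      using member_le_sum[of x X "\<lambda>x. \<bar>x\<bar>"] that X unfolding N0_def by auto
    show "\<forall>\<^sub>F N in sequentially. finite {- int N..int N} \<and> X \<subseteq> {- int N..int N} \<and> {- int N..int N} \<subseteq> UNIV"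
      using eventually_ge_at_top[of N0]
      by eventually_elim (use le in \<open>fastforce\<close>)
  qed
  then show ?thesis
    using assms unfolding has_sum_def by (auto intro: filterlim_compose)
qed

lemma sum_int_symmetric_telescope:
  fixes a :: "int \<Rightarrow> complex"
  shows "(\<Sum>n\<in>{- int N..int N}. a (n - 1) - a n) = a (- int N - 1) - a (int N)"
proof (induction N)
  case (Suc N)
  have "{- int (Suc N)..int (Suc N)} = insert (- int N - 1) (insert (int N + 1) {- int N..int N})" by auto
  moreover have "- int (Suc N) - 1 = - int N - 1 - 1" by simp
  ultimately show ?case using Suc by (simp add: add.commute)
qed simp

text \<open>The limits at the two ends may differ. Their difference is what later becomes the 2
  \<pi> \<i> of Legendre's relation.\<close>

lemma infsum_int_telescope:
  fixes a :: "int \<Rightarrow> complex"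
  assumes "(\<lambda>n. a (n - 1) - a n) summable_on UNIV"
    and "(\<lambda>n. a (int n)) \<longlonglongrightarrow> L1" and "(\<lambda>n. a (- int n)) \<longlonglongrightarrow> L2"
  shows "(\<Sum>\<^sub>\<infinity>n. a (n - 1) - a n) = L2 - L1"
proof -
  have "(\<lambda>n. a (- int (Suc n))) \<longlonglongrightarrow> L2" using LIMSEQ_Suc[OF assms(3)] .
  then have "(\<lambda>N. a (- int N - 1) - a (int N)) \<longlonglongrightarrow> L2 - L1"
    by (intro tendsto_diff assms) (simp add: algebra_simps minus_diff_commute)
  moreover have "(\<lambda>N. a (- int N - 1) - a (int N)) \<longlonglongrightarrow> (\<Sum>\<^sub>\<infinity>n. a (n - 1) - a n)"
    using has_sum_int_symmetric_limit[OF has_sum_infsum[OF assms(1)]]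
    by (simp only: sum_int_symmetric_telescope)
  ultimately show ?thesis by (rule LIMSEQ_unique[rotated])
qed

lemma summable_on_int_abs:
  fixes g :: "nat \<Rightarrow> real"
  assumes "summable g" "\<And>n. g n \<ge> 0"
  shows "(\<lambda>n::int. g (nat \<bar>n\<bar>)) summable_on UNIV"
proof -
  have g: "g summable_on UNIV" by (intro summable_nonneg_imp_summable_on assms)
  have "(\<lambda>n::int. g (nat \<bar>n\<bar>)) summable_on (range int)"
    by (subst summable_on_reindex) (auto simp: o_def g)
  moreover have "(\<lambda>n::int. g (nat \<bar>n\<bar>)) summable_on (range (\<lambda>n. - int n))"
    by (subst summable_on_reindex) (auto simp: o_def g inj_on_def)
  ultimately have "(\<lambda>n::int. g (nat \<bar>n\<bar>)) summable_on (range int \<union> range (\<lambda>n. - int n))"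
    by (rule summable_on_union)
  moreover have "range int \<union> range (\<lambda>n. - int n) = UNIV"
    by (metis (no_types, lifting) UNIV_eq_I UnI1 UnI2 int_cases2 rangeI)
  ultimately show ?thesis by simp
qed

lemma summable_on_int_powr:
  "(\<lambda>n::int. (1 + real_of_int \<bar>n\<bar>) powr (-3/2)) summable_on UNIV"
proof -
  have "summable (\<lambda>n. real n powr (-3/2))" by (simp add: summable_real_powr_iff)
  then have "summable (\<lambda>n. real (Suc n) powr (-3/2))" by (subst summable_Suc_iff)
  then have "(\<lambda>n::int. real (Suc (nat \<bar>n\<bar>)) powr (-3/2)) summable_on UNIV"
    by (rule summable_on_int_abs) auto
  then show ?thesis by (simp add: algebra_simps)
qed

section \<open>The cotangent: partial fractions and bounds away from the real axis\<close>

text \<open>Logarithmic derivative of Euler's reflection formula: the product of both Gamma factors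
  and the sine is the constant \<pi> on the open complement of the integers.\<close>

lemma Digamma_reflection_complex:
  fixes z :: complex
  assumes "z \<notin> \<int>"
  shows "Digamma (1 - z) - Digamma z = of_real pi * cot (of_real pi * z)"
proof -
  let ?p = "complex_of_real pi"
  have 1: "z \<notin> \<int>\<^sub>\<le>\<^sub>0" using assms by (auto dest: nonpos_Ints_Int)
  have 2: "1 - z \<notin> \<int>\<^sub>\<le>\<^sub>0"
    using assms by (metis Ints_1 Ints_diff diff_diff_eq2 add_diff_cancel_left' nonpos_Ints_Int)
  have d: "((\<lambda>w. Gamma w * Gamma (1 - w) * sin (?p * w)) has_field_derivative
     (Gamma z * Digamma z) * Gamma (1 - z) * sin (?p * z)
     - Gamma z * (Gamma (1 - z) * Digamma (1 - z)) * sin (?p * z)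
     + Gamma z * Gamma (1 - z) * (?p * cos (?p * z))) (at z)"
    by (rule derivative_eq_intros refl 1 2 | simp add: algebra_simps)+
  have sin_nz: "sin (?p * w) \<noteq> 0" if "w \<notin> \<int>" for w
    using that by (auto simp: sin_eq_0)
  note s = sin_nz[OF assms]
  have "open (- (\<int> :: complex set))" by (intro open_Compl closed_Ints)
  moreover have "Gamma w * Gamma (1 - w) * sin (?p * w) = ?p" if "w \<notin> \<int>" for w
    using sin_nz[OF that] by (subst Gamma_reflection_complex) auto
  ultimately have "((\<lambda>w. Gamma w * Gamma (1 - w) * sin (?p * w)) has_field_derivative 0) (at z)"
    using assms has_field_derivative_transform_within_open[of "\<lambda>_. ?p" 0 z "- \<int>"] by auto
  then have "(Gamma z * Digamma z) * Gamma (1 - z) * sin (?p * z)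
     - Gamma z * (Gamma (1 - z) * Digamma (1 - z)) * sin (?p * z)
     + Gamma z * Gamma (1 - z) * (?p * cos (?p * z)) = 0"
    by (rule DERIV_unique[OF d])
  then have "Gamma z * Gamma (1 - z) * (sin (?p * z) * (Digamma z - Digamma (1 - z)) + ?p * cos (?p * z)) = 0"
    by (simp add: algebra_simps)
  moreover have "Gamma z * Gamma (1 - z) \<noteq> 0" using 1 2 by (auto simp: Gamma_eq_zero_iff)
  ultimately have "sin (?p * z) * (Digamma z - Digamma (1 - z)) + ?p * cos (?p * z) = 0" by simp
  then show ?thesis using s by (simp add: cot_def field_simps)
qed

lemma cot_partial_fractions:
  fixes w :: complex
  assumes w: "w \<notin> \<int>"
  shows "(\<lambda>N. \<Sum>n\<in>{- int N..int N}. 1 / (w - of_int n)) \<longlonglongrightarrow> of_real pi * cot (of_real pi * w)"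
proof -
  have nz: "w \<noteq> 0" "1 - w \<noteq> 0" using w by auto
  have "(\<lambda>m. (of_real (ln (real m)) - (\<Sum>n<m. inverse (1 - w + of_nat n)))
           - (of_real (ln (real m)) - (\<Sum>n<m. inverse (w + of_nat n)))) \<longlonglongrightarrow> Digamma (1 - w) - Digamma w"
    by (intro tendsto_diff Digamma_LIMSEQ nz)
  \<comment> \<open>The two Digamma sums together cover the indices from \<open>1 - m\<close> to
    \<open>m\<close>. The vanishing term at \<open>- m\<close> is added to make the range
    symmetric.\<close>
  moreover have "(\<lambda>m. inverse (w + of_nat m)) \<longlonglongrightarrow> 0"
    by (rule filterlim_compose[OF tendsto_inverse_0 tendsto_add_filterlim_at_infinity[OF tendsto_const tendsto_of_nat]])
  ultimately have "(\<lambda>m. (of_real (ln (real m)) - (\<Sum>n<m. inverse (1 - w + of_nat n)))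
           - (of_real (ln (real m)) - (\<Sum>n<m. inverse (w + of_nat n))) + inverse (w + of_nat m))
           \<longlonglongrightarrow> of_real pi * cot (of_real pi * w) + 0"
    unfolding Digamma_reflection_complex[OF w] by (rule tendsto_add)
  moreover have "(of_real (ln (real m)) - (\<Sum>n<m. inverse (1 - w + of_nat n)))
           - (of_real (ln (real m)) - (\<Sum>n<m. inverse (w + of_nat n))) + inverse (w + of_nat m)
      = (\<Sum>n\<in>{- int m..int m}. 1 / (w - of_int n))" for m
  proof (induction m)
    case (Suc N)
    have e: "{- int (Suc N)..int (Suc N)} = insert (- int (Suc N)) (insert (int (Suc N)) {- int N..int N})" by auto
    have "inverse (1 - w + of_nat N) = - (1 / (w - (1 + of_nat N)))"
      by (metis (no_types, lifting) add.commute add_diff_eq diff_diff_eq2 inverse_eq_divide minus_diff_eq minus_divide_right)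
    then show ?case unfolding e using Suc by (simp add: algebra_simps inverse_eq_divide)
  qed (simp add: inverse_eq_divide)
  ultimately show ?thesis by simp
qed

text \<open>The exact value 2 \<i> / (1 - exp (- 2 \<i> w)) decays exponentially in the imaginary
  part. Quadratic decay is enough, because rows are compared with 1 / n^2.\<close>

lemma norm_cot_plus_i_le:
  assumes "Im w > 0" shows "norm (cot w + \<i>) \<le> 1 / (Im w)\<^sup>2"
proof -
  let ?u = "exp (- 2 * \<i> * w)"
  have n: "norm ?u = exp (2 * Im w)" by simp
  have ge: "exp (2 * Im w) - 1 \<ge> 2 * (Im w)\<^sup>2"
    using exp_lower_Taylor_quadratic[of "2 * Im w"] assms by (simp add: power2_eq_square)
  have pos: "exp (2 * Im w) > 1" using assms by simp
  have ne: "?u \<noteq> 1" using n pos by (metis less_irrefl norm_one)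
  have "cot w + \<i> = 2 * \<i> / (1 - ?u)"
  proof -
    have u: "?u = inverse (exp (\<i> * w)) ^ 2" 
      by (simp add: exp_minus[symmetric] exp_of_nat_mult[symmetric] algebra_simps)
    have nz: "exp (\<i> * w) \<noteq> inverse (exp (\<i> * w))"
    proof
      assume a: "exp (\<i> * w) = inverse (exp (\<i> * w))"
      have "?u = inverse (exp (\<i> * w)) * exp (\<i> * w)" unfolding u power2_eq_square using a by simp
      then show False using ne by simp
    qed
    have [simp]: "exp (\<i> * w) \<noteq> 0" by simp
    define v where "v = exp (\<i> * w)"
    have v: "v \<noteq> 0" "v * v \<noteq> 1" using nz unfolding v_def[symmetric]
      by (auto simp: v_def field_simps)
    show ?thesis unfolding cot_def cos_exp_eq sin_exp_eq u exp_minus v_def[symmetric]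
      using v by (simp add: field_simps power2_eq_square)
  qed
  then have "norm (cot w + \<i>) = 2 / norm (1 - ?u)" by (simp add: norm_divide)
  also have "norm (1 - ?u) \<ge> exp (2 * Im w) - 1"
    using norm_triangle_ineq2[of ?u 1] n by (simp add: norm_minus_commute)
  then have "2 / norm (1 - ?u) \<le> 2 / (2 * (Im w)\<^sup>2)"
    using ge assms by (intro divide_left_mono) (auto intro!: mult_pos_pos)
  finally show ?thesis by simp
qed

lemma norm_cot_minus_i_le:
  assumes "Im w < 0" shows "norm (cot w - \<i>) \<le> 1 / (Im w)\<^sup>2"
proof -
  have "cot w - \<i> = - (cot (- w) + \<i>)" by (simp add: cot_def)
  then show ?thesis using norm_cot_plus_i_le[of "- w"] assms by (simp only: norm_minus_cancel) simp
qed

text \<open>The arguments lie in opposite half planes, so the limiting values \<i> and - \<i>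
  cancel.\<close>

lemma norm_cot_add_cot_le:
  assumes "Im v * Im w < 0"
  shows "norm (cot v + cot w) \<le> 1 / (Im v)\<^sup>2 + 1 / (Im w)\<^sup>2"
proof -
  consider "Im v > 0" "Im w < 0" | "Im v < 0" "Im w > 0"
    using assms by (auto simp: mult_less_0_iff)
  then show ?thesis
  proof cases
    case 1
    then show ?thesis
      using norm_triangle_ineq[of "cot v + \<i>" "cot w - \<i>"] norm_cot_plus_i_le[of v] norm_cot_minus_i_le[of w] by simp
  next
    case 2
    then show ?thesis
      using norm_triangle_ineq[of "cot v - \<i>" "cot w + \<i>"] norm_cot_plus_i_le[of w] norm_cot_minus_i_le[of v] by simp
  qed
qed


section \<open>Lattice sums\<close>

definition lattice_pt :: "complex \<Rightarrow> int \<times> int \<Rightarrow> complex" where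
  "lattice_pt \<tau> k = of_int (fst k) + of_int (snd k) * \<tau>"

lemma lattice_eq_range: "lattice \<tau> = range (lattice_pt \<tau>)"
  by (force simp: lattice_def lattice_pt_def image_iff)

lemma lattice_pt_inj:
  assumes "Im \<tau> > 0" shows "inj (lattice_pt \<tau>)"
proof (rule injI)
  fix k l assume e: "lattice_pt \<tau> k = lattice_pt \<tau> l"
  from arg_cong[OF e, of Im] have "snd k = snd l" using assms by (simp add: lattice_pt_def)
  with e show "k = l" by (simp add: lattice_pt_def prod_eq_iff)
qed

lemma lattice_pt_0 [simp]: "lattice_pt \<tau> (0, 0) = 0" "lattice_pt \<tau> 0 = 0"
  by (simp_all add: lattice_pt_def)

lemma lattice_pt_eq_0_iff:
  assumes "Im \<tau> > 0" shows "lattice_pt \<tau> k = 0 \<longleftrightarrow> k = 0"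
  using inj_eq[OF lattice_pt_inj[OF assms], of k 0] by simp

lemma lattice_pt_in_lattice [simp]: "lattice_pt \<tau> k \<in> lattice \<tau>"
  by (simp add: lattice_eq_range)

lemma lattice_0 [simp]: "0 \<in> lattice \<tau>"
  by (metis lattice_pt_0(2) lattice_pt_in_lattice)

lemma lattice_add [intro]: "a \<in> lattice \<tau> \<Longrightarrow> b \<in> lattice \<tau> \<Longrightarrow> a + b \<in> lattice \<tau>"
  unfolding lattice_def
proof clarify
  fix m n m' n' :: int
  show "\<exists>p q. of_int m + of_int n * \<tau> + (of_int m' + of_int n' * \<tau>) = of_int p + of_int q * \<tau> \<and> True"
    by (rule exI[of _ "m + m'"], rule exI[of _ "n + n'"]) (simp add: algebra_simps)
qed

lemma lattice_minus_iff [simp]: "- a \<in> lattice \<tau> \<longleftrightarrow> a \<in> lattice \<tau>"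
proof -
  have "- a \<in> lattice \<tau>" if "a \<in> lattice \<tau>" for a
  proof -
    from that obtain m n :: int where "a = of_int m + of_int n * \<tau>" by (auto simp: lattice_def)
    then have "- a = of_int (- m) + of_int (- n) * \<tau>" by simp
    then show ?thesis unfolding lattice_def by blast
  qed
  from this[of a] this[of "- a"] show ?thesis by auto
qed

lemma lattice_add_iff:
  assumes "b \<in> lattice \<tau>" shows "a + b \<in> lattice \<tau> \<longleftrightarrow> a \<in> lattice \<tau>"
  using lattice_add[OF _ assms, of a] lattice_add[of "a + b" \<tau> "- b"] assms by auto

lemma lattice_periods [simp]: "1 \<in> lattice \<tau>" "\<tau> \<in> lattice \<tau>"
  using lattice_pt_in_lattice[of \<tau> "(1,0)"] lattice_pt_in_lattice[of \<tau> "(0,1)"] by (simp_all add: lattice_pt_def)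

lemma countable_lattice: "countable (lattice \<tau>)"
  by (simp add: lattice_eq_range)

section \<open>Majorants uniform in the period\<close>

text \<open>The exponent 3 of the decay is shared equally between the two indices: 3/2 still exceeds
  1, so each factor is summable over the integers and the product over pairs.\<close>

definition lattice_weight :: "int \<times> int \<Rightarrow> real" where
  "lattice_weight k = (1 + real_of_int \<bar>fst k\<bar>) powr (-3/2) * (1 + real_of_int \<bar>snd k\<bar>) powr (-3/2)"

lemma summable_lattice_weight: "lattice_weight summable_on UNIV"
proof -
  let ?g = "\<lambda>n::int. (1 + real_of_int \<bar>n\<bar>) powr (-3/2)"
  have "(\<lambda>k. ?g (fst k) * ?g (snd k)) summable_on (Sigma UNIV (\<lambda>_. UNIV))"
  proof (rule summable_on_SigmaI)
    show "((\<lambda>y. ?g (fst (x, y)) * ?g (snd (x, y))) has_sum (?g x * infsum ?g UNIV)) UNIV" for x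
      using has_sum_cmult_right[OF has_sum_infsum[OF summable_on_int_powr], of "?g x"] by simp
    show "(\<lambda>x. ?g x * infsum ?g UNIV) summable_on UNIV"
      by (intro summable_on_cmult_left summable_on_int_powr)
  qed simp
  then show ?thesis by (simp add: lattice_weight_def[abs_def])
qed

text \<open>\<open>spread K \<tau>\<close> makes \<open>K ^ 3 * lattice_weight\<close> a majorant of \<open>1 / |\<omega>| ^ 3\<close>, uniformly in \<open>\<tau>\<close>.\<close>

definition spread :: "real \<Rightarrow> complex \<Rightarrow> bool" where
  "spread K \<tau> \<longleftrightarrow> K > 0 \<and> (\<forall>k. k \<noteq> 0 \<longrightarrow> 1 + real_of_int \<bar>fst k\<bar> \<le> K * norm (lattice_pt \<tau> k) \<and>
      1 + real_of_int \<bar>snd k\<bar> \<le> K * norm (lattice_pt \<tau> k))"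

lemma spreadI:
  assumes y: "y > 0" "Im \<tau> \<ge> y" and R: "norm \<tau> \<le> R"
  shows "spread (2 * (1 + R / y + 1 / y)) \<tau>"
  unfolding spread_def
proof (intro conjI allI impI)
  have R0: "R \<ge> 0" using R norm_ge_zero order_trans by blast
  show "2 * (1 + R / y + 1 / y) > 0" using y R0 by (auto intro!: add_pos_nonneg)
  fix k :: "int \<times> int" assume k: "k \<noteq> 0"
  define m n where "m = fst k" and "n = snd k"
  let ?w = "lattice_pt \<tau> k"
  define W where "W = norm ?w"
  have W0: "W \<ge> 0" by (simp add: W_def)
  have "\<bar>Im ?w\<bar> = \<bar>real_of_int n\<bar> * Im \<tau>" using y by (simp add: lattice_pt_def n_def abs_mult)
  then have n1: "\<bar>real_of_int n\<bar> * Im \<tau> \<le> W" using abs_Im_le_cmod[of ?w] by (simp add: W_def)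
  have "\<bar>real_of_int n\<bar> * y \<le> \<bar>real_of_int n\<bar> * Im \<tau>" using y by (intro mult_left_mono) auto
  with n1 have n: "\<bar>real_of_int n\<bar> \<le> W / y" using y by (simp add: field_simps)
  have "\<bar>real_of_int m\<bar> = norm (?w - of_int n * \<tau>)" by (simp add: lattice_pt_def m_def n_def)
  also have "\<dots> \<le> W + \<bar>real_of_int n\<bar> * norm \<tau>"
    using norm_triangle_ineq4[of ?w "of_int n * \<tau>"] by (simp add: W_def norm_mult)
  also have "\<bar>real_of_int n\<bar> * norm \<tau> \<le> (W / y) * R"
    using n R by (intro mult_mono) auto
  finally have m: "\<bar>real_of_int m\<bar> \<le> W + W / y * R" by simp
  have Wy: "W / y \<ge> 0" "W / y * R \<ge> 0" using W0 y R0 by auto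
  have "m \<noteq> 0 \<or> n \<noteq> 0" using k by (auto simp: m_def n_def prod_eq_iff)
  then have "\<bar>real_of_int m\<bar> \<ge> 1 \<or> \<bar>real_of_int n\<bar> \<ge> 1" by linarith
  \<comment> \<open>One of the indices is at least 1 in modulus, so the common bound of both also
    dominates 1. Absorbing the summand \<open>1 +\<close> in this way costs the factor 2 in the
    constant.\<close>
  then have one: "1 \<le> W + W / y * R + W / y" using m n Wy W0 by linarith
  define B where "B = W / y"
  define A where "A = B * R"
  have "2 * (1 + R / y + 1 / y) * W = 2 * (W + A + B)" by (simp add: A_def B_def field_simps)
  then show "1 + real_of_int \<bar>fst k\<bar> \<le> 2 * (1 + R / y + 1 / y) * norm ?w"
    "1 + real_of_int \<bar>snd k\<bar> \<le> 2 * (1 + R / y + 1 / y) * norm ?w"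
    using one m n Wy W0 unfolding W_def[symmetric] m_def[symmetric] n_def[symmetric]
      B_def[symmetric] A_def[symmetric] by auto
qed

lemma spread_nonzero:
  assumes "spread K \<tau>" "k \<noteq> 0" shows "lattice_pt \<tau> k \<noteq> 0"
proof
  assume "lattice_pt \<tau> k = 0"
  then have "1 + real_of_int \<bar>fst k\<bar> \<le> 0"
    using assms unfolding spread_def by (metis mult_zero_right norm_zero)
  then show False by simp
qed

lemma spread_inverse_cube:
  assumes "spread K \<tau>" "k \<noteq> 0"
  shows "1 / norm (lattice_pt \<tau> k) ^ 3 \<le> K ^ 3 * lattice_weight k"
proof -
  define W where "W = K * norm (lattice_pt \<tau> k)"
  have K: "K > 0" using assms by (simp add: spread_def)
  have a: "1 + real_of_int \<bar>fst k\<bar> \<le> W" "1 + real_of_int \<bar>snd k\<bar> \<le> W"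
    using assms unfolding spread_def W_def by blast+
  have W: "W > 0" using a by linarith
  have "W powr (-3/2) \<le> (1 + real_of_int \<bar>fst k\<bar>) powr (-3/2)"
       "W powr (-3/2) \<le> (1 + real_of_int \<bar>snd k\<bar>) powr (-3/2)"
    using a by (auto intro!: powr_mono2')
  then have "W powr (-3/2) * W powr (-3/2) \<le> lattice_weight k"
    unfolding lattice_weight_def by (intro mult_mono) auto
  also have "W powr (-3/2) * W powr (-3/2) = W powr (- 3)" by (simp flip: powr_add)
  also have "\<dots> = 1 / W ^ 3" using W by (simp add: powr_minus powr_numeral divide_inverse)
  finally have "1 / W ^ 3 \<le> lattice_weight k" .
  then have "K ^ 3 * (1 / W ^ 3) \<le> K ^ 3 * lattice_weight k" using K by (intro mult_left_mono) auto
  then show ?thesis using K by (simp add: W_def power_mult_distrib)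
qed

lemma finite_int_box: "finite {n::int. real_of_int \<bar>n\<bar> \<le> B}"
proof (rule finite_subset)
  show "{n::int. real_of_int \<bar>n\<bar> \<le> B} \<subseteq> {- \<lceil>B\<rceil>..\<lceil>B\<rceil>}"
  proof
    fix n assume "n \<in> {n::int. real_of_int \<bar>n\<bar> \<le> B}"
    then have "\<bar>n\<bar> \<le> \<lceil>B\<rceil>" by (auto simp: le_ceiling_iff)
    then show "n \<in> {- \<lceil>B\<rceil>..\<lceil>B\<rceil>}" by auto
  qed
qed simp

lemma finite_lattice_box: "finite {k :: int \<times> int. real_of_int \<bar>fst k\<bar> \<le> B \<and> real_of_int \<bar>snd k\<bar> \<le> B}"
  by (rule finite_subset[OF _ finite_cartesian_product[OF finite_int_box[of B] finite_int_box[of B]]]) auto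

text \<open>Stated in z and \<omega> without a lattice, so that one estimate per series serves every
  period. For |\<omega>| at least 2 R the point z keeps distance |\<omega>| / 2 from \<omega>, so
  poles do not interfere.\<close>

definition cubic_decay :: "(complex \<Rightarrow> complex \<Rightarrow> complex) \<Rightarrow> bool" where
  "cubic_decay f \<longleftrightarrow> (\<forall>R>0. \<exists>C. \<forall>z \<omega>. norm z \<le> R \<longrightarrow> norm \<omega> \<ge> 2 * R \<longrightarrow> \<omega> \<noteq> 0 \<longrightarrow>
      norm (f z \<omega>) \<le> C / norm \<omega> ^ 3)"

text \<open>The exceptional set is a box of indices depending on \<open>K\<close> and
  \<open>R\<close> only, hence common to all periods with the same \<open>spread\<close>
  constant.\<close>

lemma spread_large:
  assumes "K > 0"
  obtains F where "finite F" "0 \<in> F" "\<And>\<tau> k. spread K \<tau> \<Longrightarrow> k \<notin> F \<Longrightarrow> norm (lattice_pt \<tau> k) \<ge> R"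
proof
  let ?F = "insert 0 {k :: int \<times> int. real_of_int \<bar>fst k\<bar> \<le> K * R \<and> real_of_int \<bar>snd k\<bar> \<le> K * R}"
  show "finite ?F" "0 \<in> ?F" by (simp_all add: finite_lattice_box[simplified])
  fix \<tau> and k :: "int \<times> int" assume s: "spread K \<tau>" and k: "k \<notin> ?F"
  show "norm (lattice_pt \<tau> k) \<ge> R"
  proof (rule ccontr)
    assume "\<not> norm (lattice_pt \<tau> k) \<ge> R"
    then have "K * norm (lattice_pt \<tau> k) \<le> K * R" using assms by (intro mult_left_mono) auto
    moreover have "k \<noteq> 0" using k by auto
    ultimately have "1 + real_of_int \<bar>fst k\<bar> \<le> K * R \<and> 1 + real_of_int \<bar>snd k\<bar> \<le> K * R"
      using s unfolding spread_def by (meson order_trans)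
    then show False using k by auto
  qed
qed

text \<open>The point is the order of the quantifiers: \<open>F\<close> and \<open>M\<close> are
  fixed before z and \<tau>. This permits differentiation in \<tau> and limits along moving
  periods.\<close>

lemma cubic_decay_majorant:
  assumes f: "cubic_decay f" and K: "K > 0"
  obtains F M where "finite F" "0 \<in> F" "M summable_on UNIV"
    "\<And>(z::complex) \<tau> k. norm z \<le> R \<Longrightarrow> spread K \<tau> \<Longrightarrow> k \<notin> F \<Longrightarrow> norm (f z (lattice_pt \<tau> k)) \<le> M k"
proof -
  define R' where "R' = max R 1"
  have R': "R' > 0" "R \<le> R'" by (auto simp: R'_def)
  then obtain C where C: "\<And>z \<omega>. norm z \<le> R' \<Longrightarrow> norm \<omega> \<ge> 2 * R' \<Longrightarrow> \<omega> \<noteq> 0 \<Longrightarrow> norm (f z \<omega>) \<le> C / norm \<omega> ^ 3"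
    using f unfolding cubic_decay_def by meson
  obtain F where F: "finite F" "0 \<in> F" "\<And>\<tau> k. spread K \<tau> \<Longrightarrow> k \<notin> F \<Longrightarrow> norm (lattice_pt \<tau> k) \<ge> 2 * R'"
    using spread_large[OF K, of "2 * R'"] by blast
  show thesis
  proof
    show "(\<lambda>k. \<bar>C\<bar> * (K ^ 3 * lattice_weight k)) summable_on UNIV"
      by (intro summable_on_cmult_right summable_lattice_weight)
    fix z :: complex and \<tau> k assume z: "norm z \<le> R" and s: "spread K \<tau>" and k: "k \<notin> F"
    have k0: "k \<noteq> 0" using k F by auto
    have "norm (f z (lattice_pt \<tau> k)) \<le> C / norm (lattice_pt \<tau> k) ^ 3"
      using z R' by (intro C F s k spread_nonzero[OF s k0]) auto
    also have "\<dots> \<le> \<bar>C\<bar> * (1 / norm (lattice_pt \<tau> k) ^ 3)" by (simp add: divide_right_mono)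
    also have "\<dots> \<le> \<bar>C\<bar> * (K ^ 3 * lattice_weight k)"
      by (intro mult_left_mono spread_inverse_cube s k0) auto
    finally show "norm (f z (lattice_pt \<tau> k)) \<le> \<bar>C\<bar> * (K ^ 3 * lattice_weight k)" .
  qed (use F in auto)
qed

lemma cubic_decay_summable:
  assumes "cubic_decay f" "Im \<tau> > 0"
  shows "(\<lambda>k. f z (lattice_pt \<tau> k)) summable_on UNIV"
proof -
  have s: "spread (2 * (1 + norm \<tau> / Im \<tau> + 1 / Im \<tau>)) \<tau>" (is "spread ?K \<tau>")
    by (rule spreadI) (use assms in auto)
  then have K: "?K > 0" by (simp add: spread_def)
  obtain F M where F: "finite F" "0 \<in> F" "M summable_on UNIV"
    "\<And>(z'::complex) \<tau> k. norm z' \<le> norm z \<Longrightarrow> spread ?K \<tau> \<Longrightarrow> k \<notin> F \<Longrightarrow> norm (f z' (lattice_pt \<tau> k)) \<le> M k"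
    using cubic_decay_majorant[OF assms(1) K, of "norm z"] by blast
  define M' where "M' k = (if k \<in> F then norm (f z (lattice_pt \<tau> k)) else M k)" for k
  show ?thesis
    by (rule summable_on_comparison_complex[of M'], rule summable_on_alter_finite[OF F(3,1)])
       (use F(4)[OF _ s] in \<open>auto simp: M'_def\<close>)
qed

lemma eventually_spread:
  assumes "(T \<longlongrightarrow> \<tau>0) G" "Im \<tau>0 > 0"
  obtains K where "K > 0" "\<forall>\<^sub>F x in G. spread K (T x)"
proof -
  let ?y = "Im \<tau>0 / 2" and ?R = "norm \<tau>0 + 1"
  let ?K = "2 * (1 + ?R / ?y + 1 / ?y)"
  have "\<forall>\<^sub>F x in G. Im (T x) > ?y"
    by (rule order_tendstoD[OF tendsto_Im[OF assms(1)]]) (use assms in auto)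
  moreover have "\<forall>\<^sub>F x in G. norm (T x) < ?R"
    by (rule order_tendstoD[OF tendsto_norm[OF assms(1)]]) auto
  ultimately have "\<forall>\<^sub>F x in G. spread ?K (T x)"
    by eventually_elim (rule spreadI, use assms in auto)
  moreover have "?K > 0" using assms by (auto intro!: add_pos_nonneg)
  ultimately show thesis using that by blast
qed

text \<open>Indices in the exceptional set have no majorant, but converge and are thus eventually
  bounded by their limit plus 1. The period need not converge, only share a \<open>spread\<close>
  constant, so the lemma also applies at the cusp.\<close>

lemma tendsto_lattice_sum:
  assumes f: "cubic_decay f" and G: "G \<noteq> bot" and Z: "(Z \<longlongrightarrow> z0) G"
    and K: "K > 0" "\<forall>\<^sub>F x in G. spread K (T x)"
    and lim: "\<And>k. ((\<lambda>x. f (Z x) (lattice_pt (T x) k)) \<longlongrightarrow> g k) G"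
  shows "((\<lambda>x. \<Sum>\<^sub>\<infinity>k. f (Z x) (lattice_pt (T x) k)) \<longlongrightarrow> (\<Sum>\<^sub>\<infinity>k. g k)) G"
proof -
  obtain F M where F: "finite F" "0 \<in> F" "M summable_on UNIV"
    "\<And>(z::complex) \<tau> k. norm z \<le> norm z0 + 1 \<Longrightarrow> spread K \<tau> \<Longrightarrow> k \<notin> F \<Longrightarrow> norm (f z (lattice_pt \<tau> k)) \<le> M k"
    using cubic_decay_majorant[OF f K(1), of "norm z0 + 1"] by blast
  define M' where "M' k = (if k \<in> F then norm (g k) + 1 else M k)" for k
  have "\<forall>\<^sub>F x in G. norm (Z x) < norm z0 + 1"
    by (rule order_tendstoD[OF tendsto_norm[OF Z]]) auto
  moreover have "\<forall>\<^sub>F x in G. \<forall>k\<in>F. norm (f (Z x) (lattice_pt (T x) k)) < norm (g k) + 1"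
    using F(1) by (intro eventually_ball_finite ballI order_tendstoD[OF tendsto_norm[OF lim]]) auto
  ultimately have "\<forall>\<^sub>F x in G. \<forall>k. norm (f (Z x) (lattice_pt (T x) k)) \<le> M' k"
    using K(2) by eventually_elim (auto simp: M'_def intro: less_imp_le F(4))
  moreover have "M' summable_on UNIV"
    by (rule summable_on_alter_finite[OF F(3,1)]) (auto simp: M'_def)
  ultimately show ?thesis by (intro tendsto_infsum_dominated[OF _ lim _ G])
qed

text \<open>Openness of the condition when point and lattice both move: all but finitely many
  lattice points stay outside a disc around the point, and avoiding each of the others is an open
  condition.\<close>

lemma eventually_notin_lattice:
  assumes "Z t0 \<notin> lattice (T t0)" "Im (T t0) > 0" "isCont Z t0" "isCont T t0"
  shows "\<forall>\<^sub>F t in nhds t0. Im (T t) > 0 \<and> Z t \<notin> lattice (T t)"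
proof -
  have Z: "(Z \<longlongrightarrow> Z t0) (nhds t0)" and T: "(T \<longlongrightarrow> T t0) (nhds t0)"
    using assms by (auto simp: isCont_def tendsto_at_iff_tendsto_nhds)
  obtain K where K: "K > 0" "\<forall>\<^sub>F x in nhds t0. spread K (T x)"
    using eventually_spread[OF T] assms by blast
  obtain F where F: "finite F" "0 \<in> F"
    "\<And>\<tau> k. spread K \<tau> \<Longrightarrow> k \<notin> F \<Longrightarrow> norm (lattice_pt \<tau> k) \<ge> norm (Z t0) + 1"
    by (rule spread_large[OF K(1), of "norm (Z t0) + 1"]) blast
  have lim: "((\<lambda>t. Z t - lattice_pt (T t) k) \<longlongrightarrow> Z t0 - lattice_pt (T t0) k) (nhds t0)" for k
    unfolding lattice_pt_def by (intro tendsto_intros Z T)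
  have "\<forall>\<^sub>F t in nhds t0. Z t - lattice_pt (T t) k \<noteq> 0" for k
    using assms(1) by (intro tendsto_imp_eventually_ne[OF lim]) (auto simp: lattice_eq_range)
  then have "\<forall>\<^sub>F t in nhds t0. \<forall>k\<in>F. Z t - lattice_pt (T t) k \<noteq> 0"
    using F(1) by (intro eventually_ball_finite ballI)
  moreover have "\<forall>\<^sub>F t in nhds t0. norm (Z t) < norm (Z t0) + 1"
    by (rule order_tendstoD[OF tendsto_norm[OF Z]]) auto
  moreover have "\<forall>\<^sub>F t in nhds t0. Im (T t) > 0"
    by (rule order_tendstoD[OF tendsto_Im[OF T]]) (use assms in auto)
  ultimately show ?thesis using K(2)
  proof eventually_elim
    case (elim t)
    have "Z t \<noteq> lattice_pt (T t) k" for k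
      using elim F(3)[OF elim(4), of k] by (cases "k \<in> F") auto
    then show ?case using elim by (auto simp: lattice_eq_range)
  qed
qed

text \<open>With \<open>T\<close> constant this differentiates in the argument; with
  \<open>T\<close> the identity and \<open>Z\<close> affine it differentiates in the period along
  \<alpha> = r + s \<tau>.\<close>

lemma has_field_derivative_lattice_sum:
  assumes f: "cubic_decay f" and T0: "Im (T t0) > 0" and Z: "isCont Z t0" and T: "isCont T t0"
    and deriv: "\<forall>\<^sub>F t in nhds t0. \<forall>k. ((\<lambda>t. f (Z t) (lattice_pt (T t) k)) has_field_derivative f' k t) (at t)"
  shows "((\<lambda>t. \<Sum>\<^sub>\<infinity>k. f (Z t) (lattice_pt (T t) k)) has_field_derivative (\<Sum>\<^sub>\<infinity>k. f' k t0)) (at t0)"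
proof -
  have Z: "(Z \<longlongrightarrow> Z t0) (nhds t0)" and T: "(T \<longlongrightarrow> T t0) (nhds t0)"
    using assms by (auto simp: isCont_def tendsto_at_iff_tendsto_nhds)
  obtain K where K: "K > 0" "\<forall>\<^sub>F x in nhds t0. spread K (T x)"
    using eventually_spread[OF T] assms by blast
  obtain F M where F: "finite F" "0 \<in> F" "M summable_on UNIV"
    "\<And>(z::complex) \<tau> k. norm z \<le> norm (Z t0) + 1 \<Longrightarrow> spread K \<tau> \<Longrightarrow> k \<notin> F \<Longrightarrow> norm (f z (lattice_pt \<tau> k)) \<le> M k"
    using cubic_decay_majorant[OF f K(1), of "norm (Z t0) + 1"] by blast
  have "\<forall>\<^sub>F t in nhds t0. norm (Z t) < norm (Z t0) + 1"
    by (rule order_tendstoD[OF tendsto_norm[OF Z]]) auto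
  with K(2) deriv have "\<forall>\<^sub>F t in nhds t0. spread K (T t) \<and> norm (Z t) < norm (Z t0) + 1 \<and>
      (\<forall>k. ((\<lambda>t. f (Z t) (lattice_pt (T t) k)) has_field_derivative f' k t) (at t))"
    by eventually_elim auto
  then obtain e where e: "e > 0" "\<And>t. dist t t0 < e \<Longrightarrow> spread K (T t) \<and> norm (Z t) < norm (Z t0) + 1 \<and>
      (\<forall>k. ((\<lambda>t. f (Z t) (lattice_pt (T t) k)) has_field_derivative f' k t) (at t))"
    unfolding eventually_nhds_metric by blast
  show ?thesis
  proof (rule has_field_derivative_infsum[OF e(1) F(1,3)])
    fix k t assume "t \<in> ball t0 e"
    then have t: "dist t t0 < e" by (simp add: dist_commute)
    show "((\<lambda>t. f (Z t) (lattice_pt (T t) k)) has_field_derivative f' k t) (at t)"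
      using e(2)[OF t] by blast
    assume "k \<notin> F"
    then show "norm (f (Z t) (lattice_pt (T t) k)) \<le> M k"
      using e(2)[OF t] by (intro F(4)) auto
  qed
qed

section \<open>The Weierstrass functions\<close>

lemma norm_diff_ge_half:
  fixes z w :: complex
  assumes "norm z \<le> R" "norm w \<ge> 2 * R"
  shows "norm (z - w) \<ge> norm w / 2"
  using norm_triangle_ineq2[of w z] assms by (simp add: norm_minus_commute)

text \<open>Decay of a higher order 3 + j is weakened to order 3 by means of |\<omega>| \<ge> 2 R >
  0.\<close>

lemma cubic_decayI:
  assumes "\<And>R z \<omega>. R > 0 \<Longrightarrow> norm z \<le> R \<Longrightarrow> norm \<omega> \<ge> 2 * R \<Longrightarrow> \<omega> \<noteq> 0 \<Longrightarrow> norm (f z \<omega>) \<le> C R / norm \<omega> ^ (3 + j)"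
    and "\<And>R. R > 0 \<Longrightarrow> C R \<ge> 0"
  shows "cubic_decay f"
  unfolding cubic_decay_def
proof (intro allI impI)
  fix R :: real assume R: "R > 0"
  show "\<exists>C. \<forall>(z::complex) \<omega>. norm z \<le> R \<longrightarrow> norm \<omega> \<ge> 2 * R \<longrightarrow> \<omega> \<noteq> 0 \<longrightarrow> norm (f z \<omega>) \<le> C / norm \<omega> ^ 3"
  proof (intro exI allI impI)
    fix z w :: complex assume a: "norm z \<le> R" "norm w \<ge> 2 * R" "w \<noteq> 0"
    have "norm (f z w) \<le> C R / norm w ^ (3 + j)" by (rule assms(1)[OF R a])
    also have "\<dots> = (C R / norm w ^ j) / norm w ^ 3" by (simp add: power_add)
    also have "\<dots> \<le> (C R / (2 * R) ^ j) / norm w ^ 3"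
      using a R assms(2)[OF R] by (intro divide_right_mono divide_left_mono power_mono mult_pos_pos zero_less_power) auto
    finally show "norm (f z w) \<le> (C R / (2 * R) ^ j) / norm w ^ 3" .
  qed
qed

lemma cubic_decay_zeta: "cubic_decay (\<lambda>z \<omega>. 1 / (z - \<omega>) + 1 / \<omega> + z / \<omega>\<^sup>2)"
proof (rule cubic_decayI[of _ "\<lambda>R. 2 * R\<^sup>2" 0])
  fix R :: real and z w :: complex
  assume R: "R > 0" and a: "norm z \<le> R" "norm w \<ge> 2 * R" "w \<noteq> 0"
  have h: "norm w / 2 \<le> norm (z - w)" by (rule norm_diff_ge_half[OF a(1,2)])
  have w: "norm w > 0" using a by simp
  have "z - w \<noteq> 0" using h w by auto
  then have "1 / (z - w) + 1 / w + z / w\<^sup>2 = z\<^sup>2 / ((z - w) * w\<^sup>2)"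
    using a by (simp add: field_simps power2_eq_square)
  then have "norm (1 / (z - w) + 1 / w + z / w\<^sup>2) = norm z ^ 2 / (norm (z - w) * norm w ^ 2)"
    by (simp add: norm_divide norm_mult norm_power)
  also have "\<dots> \<le> R ^ 2 / ((norm w / 2) * norm w ^ 2)"
    using a h w R by (intro frac_le mult_right_mono power_mono mult_pos_pos) auto
  also have "\<dots> = 2 * R\<^sup>2 / norm w ^ 3" by (simp add: power2_eq_square power3_eq_cube mult_ac)
  finally show "norm (1 / (z - w) + 1 / w + z / w\<^sup>2) \<le> (2 * R\<^sup>2) / norm w ^ (3 + 0)" by simp
qed simp

lemma cubic_decay_wp: "cubic_decay (\<lambda>z \<omega>. 1 / (z - \<omega>)\<^sup>2 - 1 / \<omega>\<^sup>2)"
proof (rule cubic_decayI[of _ "\<lambda>R. 12 * R" 0])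
  fix R :: real and z w :: complex
  assume R: "R > 0" and a: "norm z \<le> R" "norm w \<ge> 2 * R" "w \<noteq> 0"
  have h: "norm w / 2 \<le> norm (z - w)" by (rule norm_diff_ge_half[OF a(1,2)])
  have w: "norm w > 0" using a by simp
  have "z - w \<noteq> 0" using h w by auto
  then have "1 / (z - w)\<^sup>2 - 1 / w\<^sup>2 = z * (2 * w - z) / ((z - w)\<^sup>2 * w\<^sup>2)"
    using a by (simp add: divide_simps) (simp add: algebra_simps power2_eq_square)
  then have "norm (1 / (z - w)\<^sup>2 - 1 / w\<^sup>2) = norm z * norm (2 * w - z) / (norm (z - w) ^ 2 * norm w ^ 2)"
    by (simp add: norm_divide norm_mult norm_power)
  also have "norm (2 * w - z) \<le> 3 * norm w"
    using norm_triangle_ineq4[of "2 * w" z] a R by (simp add: norm_mult)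
  then have "norm z * norm (2 * w - z) / (norm (z - w) ^ 2 * norm w ^ 2)
      \<le> R * (3 * norm w) / ((norm w / 2) ^ 2 * norm w ^ 2)"
    using a h w R by (intro frac_le mult_right_mono power_mono mult_mono mult_pos_pos) auto
  also have "\<dots> = (12 * R) / norm w ^ 3"
    using w by (simp add: power2_eq_square power3_eq_cube)
  finally show "norm (1 / (z - w)\<^sup>2 - 1 / w\<^sup>2) \<le> (12 * R) / norm w ^ (3 + 0)" by simp
qed simp

lemma cubic_decay_wp': "cubic_decay (\<lambda>z \<omega>. 1 / (z - \<omega>) ^ 3)"
proof (rule cubic_decayI[of _ "\<lambda>_. 8" 0])
  fix R :: real and z w :: complex
  assume a: "R > 0" "norm z \<le> R" "norm w \<ge> 2 * R" "w \<noteq> 0"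
  have h: "norm w / 2 \<le> norm (z - w)" by (rule norm_diff_ge_half[OF a(2,3)])
  have "norm (1 / (z - w) ^ 3) = 1 / norm (z - w) ^ 3" by (simp add: norm_divide norm_power)
  also have "\<dots> \<le> 1 / (norm w / 2) ^ 3" using h a by (intro frac_le power_mono) auto
  finally show "norm (1 / (z - w) ^ 3) \<le> 8 / norm w ^ (3 + 0)" by (simp add: power_divide)
qed simp

lemma cubic_decay_g2: "cubic_decay (\<lambda>z \<omega>. 1 / \<omega> ^ 4)"
  by (rule cubic_decayI[of _ "\<lambda>_. 1" 1]) (simp_all add: norm_divide norm_power)

lemma infsum_lattice:
  assumes "Im \<tau> > 0" shows "infsum f (lattice \<tau>) = (\<Sum>\<^sub>\<infinity>k. f (lattice_pt \<tau> k))"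
  unfolding lattice_eq_range using infsum_reindex[OF lattice_pt_inj[OF assms], of f] by (simp add: o_def)

lemma infsum_lattice_diff_0:
  fixes f :: "complex \<Rightarrow> complex"
  assumes "Im \<tau> > 0" and "(\<lambda>k. f (lattice_pt \<tau> k)) summable_on UNIV"
  shows "f 0 + infsum f (lattice \<tau> - {0}) = (\<Sum>\<^sub>\<infinity>k. f (lattice_pt \<tau> k))"
proof -
  have "f summable_on lattice \<tau>"
    unfolding lattice_eq_range using assms summable_on_reindex[OF lattice_pt_inj[OF assms(1)], of f]
    by (simp add: o_def)
  then have "f summable_on (lattice \<tau> - {0})" by (rule summable_on_subset) auto
  then have "infsum f (insert 0 (lattice \<tau> - {0})) = f 0 + infsum f (lattice \<tau> - {0})"
    by (intro infsum_insert) auto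
  moreover have "insert 0 (lattice \<tau> - {0}) = lattice \<tau>" by auto
  ultimately show ?thesis using infsum_lattice[OF assms(1), of f] by simp
qed

text \<open>Since \<open>1 / 0 = 0\<close>, the term at the origin of each of the following full-lattice sums is the
  principal part that the definitions split off.\<close>

lemma wzeta_eq:
  assumes "Im \<tau> > 0"
  shows "wzeta z \<tau> = (\<Sum>\<^sub>\<infinity>k. 1 / (z - lattice_pt \<tau> k) + 1 / lattice_pt \<tau> k + z / (lattice_pt \<tau> k)\<^sup>2)"
  using infsum_lattice_diff_0[OF assms cubic_decay_summable[OF cubic_decay_zeta assms, of z]]
  by (simp add: wzeta_def)

lemma wp_eq:
  assumes "Im \<tau> > 0"
  shows "wp z \<tau> = (\<Sum>\<^sub>\<infinity>k. 1 / (z - lattice_pt \<tau> k)\<^sup>2 - 1 / (lattice_pt \<tau> k)\<^sup>2)"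
  using infsum_lattice_diff_0[OF assms cubic_decay_summable[OF cubic_decay_wp assms, of z]]
  by (simp add: wp_def)

lemma wp'_eq:
  assumes "Im \<tau> > 0"
  shows "wp' z \<tau> = - 2 * (\<Sum>\<^sub>\<infinity>k. 1 / (z - lattice_pt \<tau> k) ^ 3)"
  using infsum_lattice[OF assms] by (simp add: wp'_def)

lemma g2_eq:
  assumes "Im \<tau> > 0"
  shows "g2 \<tau> = 60 * (\<Sum>\<^sub>\<infinity>k. 1 / (lattice_pt \<tau> k) ^ 4)"
  using infsum_lattice_diff_0[OF assms cubic_decay_summable[OF cubic_decay_g2 assms]]
  by (simp add: g2_def)

lemma notin_lattice_pt: "z \<notin> lattice \<tau> \<Longrightarrow> z - lattice_pt \<tau> k \<noteq> 0"
  by (auto simp: lattice_eq_range)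

lemma eventually_notin_lattice_nhds:
  assumes "z \<notin> lattice \<tau>" "Im \<tau> > 0"
  shows "\<forall>\<^sub>F w in nhds z. w \<notin> lattice \<tau>"
  using eventually_notin_lattice[of "\<lambda>w. w" z "\<lambda>_. \<tau>"] assms by (auto elim: eventually_mono)

lemma closed_lattice:
  assumes "Im \<tau> > 0" shows "closed (lattice \<tau>)"
proof -
  have "open (- lattice \<tau>)"
  proof (subst open_subopen, intro ballI)
    fix z assume "z \<in> - lattice \<tau>"
    then have "\<forall>\<^sub>F w in nhds z. w \<notin> lattice \<tau>" by (intro eventually_notin_lattice_nhds assms) auto
    then show "\<exists>T. open T \<and> z \<in> T \<and> T \<subseteq> - lattice \<tau>" unfolding eventually_nhds by blast
  qed
  then show ?thesis by (simp add: closed_def)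
qed

section \<open>Derivatives in the argument\<close>

text \<open>For \<open>b = 0\<close> both \<open>w / b\<close> and \<open>1 / b\<close> are 0, so
  the term at the origin of the lattice obeys the same formula.\<close>

lemma DERIV_zeta_term:
  fixes w c :: complex
  assumes "w \<noteq> c"
  shows "((\<lambda>w. 1 / (w - c) + a + w / b) has_field_derivative - (1 / (w - c)\<^sup>2 - 1 / b)) (at w)"
  using assms by (cases "b = 0") (auto intro!: derivative_eq_intros simp: power2_eq_square)

lemma DERIV_wp_term:
  fixes w c :: complex
  assumes "w \<noteq> c"
  shows "((\<lambda>w. 1 / (w - c)\<^sup>2 - a) has_field_derivative (- 2) * (1 / (w - c) ^ 3)) (at w)"
  using assms
  by (auto intro!: derivative_eq_intros simp: power2_eq_square power3_eq_cube) (simp add: divide_simps)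

lemma wzeta_has_field_derivative:
  assumes "z \<notin> lattice \<tau>" "Im \<tau> > 0"
  shows "((\<lambda>z. wzeta z \<tau>) has_field_derivative - wp z \<tau>) (at z)"
proof -
  have "\<forall>\<^sub>F w in nhds z. \<forall>k. ((\<lambda>w. 1 / (w - lattice_pt \<tau> k) + 1 / lattice_pt \<tau> k + w / (lattice_pt \<tau> k)\<^sup>2)
      has_field_derivative - (1 / (w - lattice_pt \<tau> k)\<^sup>2 - 1 / (lattice_pt \<tau> k)\<^sup>2)) (at w)"
    using eventually_notin_lattice_nhds[OF assms]
  proof eventually_elim
    case (elim w)
    show ?case using notin_lattice_pt[OF elim] by (intro allI DERIV_zeta_term) simp
  qed
  then have "((\<lambda>w. \<Sum>\<^sub>\<infinity>k. 1 / (w - lattice_pt \<tau> k) + 1 / lattice_pt \<tau> k + w / (lattice_pt \<tau> k)\<^sup>2)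
     has_field_derivative (\<Sum>\<^sub>\<infinity>k. - (1 / (z - lattice_pt \<tau> k)\<^sup>2 - 1 / (lattice_pt \<tau> k)\<^sup>2))) (at z)"
    using has_field_derivative_lattice_sum[OF cubic_decay_zeta, of "\<lambda>_. \<tau>" z "\<lambda>w. w"] assms by simp
  then show ?thesis by (simp only: wzeta_eq[OF assms(2)] wp_eq[OF assms(2)] infsum_uminus)
qed

lemma wp_has_field_derivative:
  assumes "z \<notin> lattice \<tau>" "Im \<tau> > 0"
  shows "((\<lambda>z. wp z \<tau>) has_field_derivative wp' z \<tau>) (at z)"
proof -
  have "\<forall>\<^sub>F w in nhds z. \<forall>k. ((\<lambda>w. 1 / (w - lattice_pt \<tau> k)\<^sup>2 - 1 / (lattice_pt \<tau> k)\<^sup>2)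
      has_field_derivative (- 2) * (1 / (w - lattice_pt \<tau> k) ^ 3)) (at w)"
    using eventually_notin_lattice_nhds[OF assms]
  proof eventually_elim
    case (elim w)
    show ?case using notin_lattice_pt[OF elim] by (intro allI DERIV_wp_term) simp
  qed
  then have "((\<lambda>w. \<Sum>\<^sub>\<infinity>k. 1 / (w - lattice_pt \<tau> k)\<^sup>2 - 1 / (lattice_pt \<tau> k)\<^sup>2)
     has_field_derivative (\<Sum>\<^sub>\<infinity>k. (- 2) * (1 / (z - lattice_pt \<tau> k) ^ 3))) (at z)"
    using has_field_derivative_lattice_sum[OF cubic_decay_wp, of "\<lambda>_. \<tau>" z "\<lambda>w. w"] assms by simp
  then show ?thesis by (simp only: wp_eq[OF assms(2)] wp'_eq[OF assms(2)] infsum_cmult_right')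
qed

lemma wp'_field_differentiable:
  assumes "z \<notin> lattice \<tau>" "Im \<tau> > 0"
  shows "(\<lambda>z. wp' z \<tau>) field_differentiable (at z)"
proof -
  have "\<forall>\<^sub>F w in nhds z. \<forall>k. ((\<lambda>w. 1 / (w - lattice_pt \<tau> k) ^ 3)
      has_field_derivative (- 3) * (1 / (w - lattice_pt \<tau> k) ^ 4)) (at w)"
    using eventually_notin_lattice_nhds[OF assms]
  proof eventually_elim
    case (elim w)
    show ?case
      using notin_lattice_pt[OF elim]
      by (auto intro!: derivative_eq_intros simp: divide_simps power2_eq_square power3_eq_cube power4_eq_xxxx)
  qed
  then have "((\<lambda>w. \<Sum>\<^sub>\<infinity>k. 1 / (w - lattice_pt \<tau> k) ^ 3)
     has_field_derivative (\<Sum>\<^sub>\<infinity>k. (- 3) * (1 / (z - lattice_pt \<tau> k) ^ 4))) (at z)"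
    using has_field_derivative_lattice_sum[OF cubic_decay_wp', of "\<lambda>_. \<tau>" z "\<lambda>w. w"] assms by simp
  then show ?thesis
    unfolding wp'_eq[OF assms(2)] by (intro field_differentiable_mult field_differentiable_const)
      (auto simp: field_differentiable_def)
qed

section \<open>Differentiability in the period\<close>

text \<open>The index 0 has its own hypothesis: its lattice point is 0 for every period, so
  quotients by \<omega> are constantly 0 there, whereas elsewhere differentiability requires
  \<omega> to be nonzero.\<close>

lemma lattice_sum_tau_field_differentiable:
  assumes f: "cubic_decay f" and \<tau>: "Im \<tau> > 0" and z: "r + s * \<tau> \<notin> lattice \<tau>"
    and d: "\<And>t k. Im t > 0 \<Longrightarrow> r + s * t - lattice_pt t k \<noteq> 0 \<Longrightarrow> lattice_pt t k \<noteq> 0 \<Longrightarrow>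
        (\<lambda>t. f (r + s * t) (lattice_pt t k)) field_differentiable (at t)"
    and d0: "\<And>t. Im t > 0 \<Longrightarrow> r + s * t \<noteq> 0 \<Longrightarrow>
        (\<lambda>t. f (r + s * t) 0) field_differentiable (at t)"
  shows "(\<lambda>t. \<Sum>\<^sub>\<infinity>k. f (r + s * t) (lattice_pt t k)) field_differentiable (at \<tau>)"
proof -
  have "\<forall>\<^sub>F t in nhds \<tau>. Im t > 0 \<and> r + s * t \<notin> lattice t"
    using eventually_notin_lattice[of "\<lambda>t. r + s * t" \<tau> "\<lambda>t. t"] assms by (auto intro!: continuous_intros)
  then have "\<forall>\<^sub>F t in nhds \<tau>. \<forall>k. ((\<lambda>t. f (r + s * t) (lattice_pt t k)) has_field_derivative
      deriv (\<lambda>t. f (r + s * t) (lattice_pt t k)) t) (at t)"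
  proof eventually_elim
    case (elim t)
    have "(\<lambda>t. f (r + s * t) (lattice_pt t k)) field_differentiable (at t)" for k
      using d[of t k] d0[of t] elim notin_lattice_pt[of _ t 0] notin_lattice_pt[of _ t k]
      by (cases "k = 0") (auto simp: lattice_pt_eq_0_iff)
    then show ?case by (simp add: field_differentiable_derivI)
  qed
  then show ?thesis
    using has_field_derivative_lattice_sum[OF f, of "\<lambda>t. t" \<tau> "\<lambda>t. r + s * t"] \<tau>
    unfolding field_differentiable_def by (force intro!: continuous_intros)
qed

lemma field_differentiable_cong_upper:
  assumes "f field_differentiable (at \<tau>)" "Im \<tau> > 0" "\<And>t. Im t > 0 \<Longrightarrow> f t = g t"
  shows "g field_differentiable (at \<tau>)"
  using has_field_derivative_transform_within_open[of f _ \<tau> "{t. Im t > 0}" g] assms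
  unfolding field_differentiable_def by (auto simp: open_halfspace_Im_gt)

lemma wzeta_tau_field_differentiable:
  assumes "r + s * \<tau> \<notin> lattice \<tau>" "Im \<tau> > 0"
  shows "(\<lambda>t. wzeta (r + s * t) t) field_differentiable (at \<tau>)"
proof (rule field_differentiable_cong_upper[OF _ assms(2) wzeta_eq[symmetric]])
  show "(\<lambda>t. \<Sum>\<^sub>\<infinity>k. 1 / (r + s * t - lattice_pt t k) + 1 / lattice_pt t k + (r + s * t) / (lattice_pt t k)\<^sup>2)
      field_differentiable at \<tau>"
    using assms
    by (intro lattice_sum_tau_field_differentiable[OF cubic_decay_zeta])
       (auto intro!: derivative_intros field_differentiable_power simp: lattice_pt_def)
qed

lemma wp_tau_field_differentiable:
  assumes "r + s * \<tau> \<notin> lattice \<tau>" "Im \<tau> > 0"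
  shows "(\<lambda>t. wp (r + s * t) t) field_differentiable (at \<tau>)"
proof (rule field_differentiable_cong_upper[OF _ assms(2) wp_eq[symmetric]])
  show "(\<lambda>t. \<Sum>\<^sub>\<infinity>k. 1 / (r + s * t - lattice_pt t k)\<^sup>2 - 1 / (lattice_pt t k)\<^sup>2) field_differentiable at \<tau>"
    using assms
    by (intro lattice_sum_tau_field_differentiable[OF cubic_decay_wp])
       (auto intro!: derivative_intros field_differentiable_power simp: lattice_pt_def)
qed

lemma wp'_tau_field_differentiable:
  assumes "r + s * \<tau> \<notin> lattice \<tau>" "Im \<tau> > 0"
  shows "(\<lambda>t. wp' (r + s * t) t) field_differentiable (at \<tau>)"
proof (rule field_differentiable_cong_upper[OF _ assms(2) wp'_eq[symmetric]])
  show "(\<lambda>t. - 2 * (\<Sum>\<^sub>\<infinity>k. 1 / (r + s * t - lattice_pt t k) ^ 3)) field_differentiable at \<tau>"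
    using assms
    by (intro field_differentiable_mult field_differentiable_const lattice_sum_tau_field_differentiable[OF cubic_decay_wp'])
       (auto intro!: derivative_intros field_differentiable_power simp: lattice_pt_def)
qed

lemma real_notin_lattice:
  fixes r s :: real
  assumes "Im \<tau> > 0" "s \<notin> \<int> \<or> r \<notin> \<int>"
  shows "of_real r + of_real s * \<tau> \<notin> lattice \<tau>"
proof
  assume "of_real r + of_real s * \<tau> \<in> lattice \<tau>"
  then obtain m n :: int where e: "of_real r + of_real s * \<tau> = of_int m + of_int n * \<tau>" by (auto simp: lattice_def)
  from arg_cong[OF e, of Im] have "s = of_int n" using assms(1) by simp
  moreover from this arg_cong[OF e, of Re] have "r = of_int m" by simp
  ultimately show False using assms(2) by simp
qed

lemma half_notin_lattice:
  assumes "Im \<tau> > 0"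
  shows "1/2 \<notin> lattice \<tau>" "\<tau>/2 \<notin> lattice \<tau>"
proof -
  have "(1/2 :: real) \<notin> \<int>" using fraction_not_in_Ints[of 2 1, where 'a = real] by simp
  then show "1/2 \<notin> lattice \<tau>" "\<tau>/2 \<notin> lattice \<tau>"
    using real_notin_lattice[OF assms, of 0 "1/2"] real_notin_lattice[OF assms, of "1/2" 0] by simp_all
qed

lemma g2_tau_field_differentiable:
  assumes "Im \<tau> > 0"
  shows "g2 field_differentiable (at \<tau>)"
proof (rule field_differentiable_cong_upper[OF _ assms(1) g2_eq[symmetric]])
  show "(\<lambda>t. 60 * (\<Sum>\<^sub>\<infinity>k. 1 / lattice_pt t k ^ 4)) field_differentiable at \<tau>"
    \<comment> \<open>The terms of this series do not involve z; the argument 1/2 merely supplies a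
      point off every lattice.\<close>
    using assms half_notin_lattice(1)[OF assms]
    by (intro field_differentiable_mult field_differentiable_const
          lattice_sum_tau_field_differentiable[OF cubic_decay_g2, of _ "1/2" 0])
       (auto intro!: derivative_intros field_differentiable_power simp: lattice_pt_def)
qed


section \<open>Cotangent rows and Legendre's relation\<close>

text \<open>The symmetric sum of 1 / (z - \<omega>) + 1 / \<omega> over the row \<omega> = m + n
  \<tau> with n fixed. For n = 0 the second cotangent is \<open>cot 0 = 0\<close>, in agreement with
  \<open>1 / 0 = 0\<close> at the origin.\<close>

definition cot_row :: "complex \<Rightarrow> complex \<Rightarrow> int \<Rightarrow> complex" where
  "cot_row z \<tau> n = of_real pi * cot (of_real pi * (z - of_int n * \<tau>)) + of_real pi * cot (of_real pi * (of_int n * \<tau>))"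

definition cot_sum :: "complex \<Rightarrow> complex \<Rightarrow> complex" where
  "cot_sum z \<tau> = (\<Sum>\<^sub>\<infinity>n. cot_row z \<tau> n)"

lemma summable_on_int_inverse_square: "(\<lambda>n::int. 1 / (real_of_int n)\<^sup>2) summable_on UNIV"
proof -
  have "summable (\<lambda>n. 1 / (real n)\<^sup>2)"
    using inverse_power_summable[of 2, where 'a = real] by (simp add: inverse_eq_divide)
  from summable_on_int_abs[OF this] show ?thesis by simp
qed

lemma summable_on_int_shifted_inverse_square:
  fixes c :: complex
  shows "(\<lambda>m::int. 1 / (of_int m + c)\<^sup>2) summable_on UNIV"
proof -
  define F where "F = {m::int. real_of_int \<bar>m\<bar> \<le> 2 * norm c}"
  have F: "finite F" unfolding F_def by (rule finite_int_box)
  define M where "M m = (if m \<in> F then norm (1 / (of_int m + c)\<^sup>2) else 4 * (1 / (real_of_int m)\<^sup>2))" for m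
  have b: "norm (1 / (of_int m + c)\<^sup>2) \<le> M m" for m
  proof (cases "m \<in> F")
    case False
    then have m: "real_of_int \<bar>m\<bar> > 2 * norm c" by (auto simp: F_def)
    have "norm (of_int m + c) \<ge> real_of_int \<bar>m\<bar> / 2"
      using norm_triangle_ineq2[of "of_int m" "- c"] m by simp
    moreover have "real_of_int \<bar>m\<bar> > 0" using m norm_ge_zero[of c] by linarith
    ultimately have "norm (1 / (of_int m + c)\<^sup>2) \<le> 1 / (real_of_int \<bar>m\<bar> / 2)\<^sup>2"
      by (simp add: norm_divide norm_power del: of_int_abs) (intro frac_le power_mono, auto)
    then show ?thesis using False by (simp add: M_def power_divide)
  qed (simp add: M_def)
  show ?thesis
    by (rule summable_on_comparison_complex[OF summable_on_alter_finite[OF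
          summable_on_cmult_right[OF summable_on_int_inverse_square, of 4] F] b])
       (auto simp: M_def)
qed

lemma sum_int_symmetric_flip:
  fixes f :: "int \<Rightarrow> complex"
  shows "(\<Sum>n\<in>{- int N..int N}. f (- n)) = (\<Sum>n\<in>{- int N..int N}. f n)"
  by (rule sum.reindex_bij_witness[of _ uminus uminus]) auto

text \<open>The value c = 0 is the row through the origin: its terms cancel in pairs, and
  \<open>cot 0\<close> is 0.\<close>

lemma cot_partial_fractions':
  fixes c :: complex
  assumes "c \<notin> \<int> \<or> c = 0"
  shows "(\<lambda>N. \<Sum>n\<in>{- int N..int N}. 1 / (of_int n + c)) \<longlonglongrightarrow> of_real pi * cot (of_real pi * c)"
proof (cases "c = 0")
  case True
  have "(\<Sum>n\<in>{- int N..int N}. 1 / (of_int n + c)) = 0" for N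
  proof -
    have "(\<Sum>n\<in>{- int N..int N}. 1 / complex_of_int (- n)) = (\<Sum>n\<in>{- int N..int N}. 1 / complex_of_int n)"
      by (rule sum_int_symmetric_flip)
    then show ?thesis using True by (simp add: sum_negf)
  qed
  then show ?thesis using True by (simp add: cot_def)
next
  case False
  then have "(\<lambda>N. \<Sum>n\<in>{- int N..int N}. 1 / (c - of_int n)) \<longlonglongrightarrow> of_real pi * cot (of_real pi * c)"
    using assms by (intro cot_partial_fractions) auto
  then show ?thesis
    using sum_int_symmetric_flip[of "\<lambda>n. 1 / (c - of_int n)"] by (simp add: add.commute)
qed

text \<open>The series of 1 / (z - \<omega>) and of 1 / \<omega> are not summable separately. Their
  combination is, being the row minus the summable quadratic part, so it may be evaluated along
  symmetric intervals, where each half converges to a cotangent.\<close>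

lemma infsum_row:
  fixes z c :: complex
  assumes "c \<notin> \<int> \<or> c = 0" "z - c \<notin> \<int>"
    and "(\<lambda>m. 1 / (z - (of_int m + c)) + 1 / (of_int m + c) + z / (of_int m + c)\<^sup>2) summable_on UNIV"
  shows "(\<Sum>\<^sub>\<infinity>m. 1 / (z - (of_int m + c)) + 1 / (of_int m + c) + z / (of_int m + c)\<^sup>2) =
     of_real pi * cot (of_real pi * (z - c)) + of_real pi * cot (of_real pi * c) + z * (\<Sum>\<^sub>\<infinity>m::int. 1 / (of_int m + c)\<^sup>2)"
proof -
  let ?g = "\<lambda>m::int. 1 / (z - c - of_int m) + 1 / (of_int m + c)"
  have sq: "((\<lambda>m::int. z * (1 / (of_int m + c)\<^sup>2)) has_sum z * (\<Sum>\<^sub>\<infinity>m::int. 1 / (of_int m + c)\<^sup>2)) UNIV"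
    by (intro has_sum_cmult_right has_sum_infsum summable_on_int_shifted_inverse_square)
  have "(\<lambda>m. (1 / (z - (of_int m + c)) + 1 / (of_int m + c) + z / (of_int m + c)\<^sup>2)
           + - (z * (1 / (of_int m + c)\<^sup>2))) summable_on UNIV"
    by (intro summable_on_add assms summable_on_uminus[THEN iffD2] has_sum_imp_summable[OF sq])
  then have "?g summable_on UNIV" by (simp add: algebra_simps)
  then have gs: "(?g has_sum infsum ?g UNIV) UNIV" by simp
  have "(\<lambda>N. (\<Sum>n\<in>{- int N..int N}. 1 / (z - c - of_int n)) + (\<Sum>n\<in>{- int N..int N}. 1 / (of_int n + c)))
      \<longlonglongrightarrow> of_real pi * cot (of_real pi * (z - c)) + of_real pi * cot (of_real pi * c)"
    by (intro tendsto_add cot_partial_fractions cot_partial_fractions' assms)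
  then have "infsum ?g UNIV = of_real pi * cot (of_real pi * (z - c)) + of_real pi * cot (of_real pi * c)"
    using LIMSEQ_unique[OF has_sum_int_symmetric_limit[OF gs]] by (simp add: sum.distrib)
  with has_sum_add[OF gs sq] have "((\<lambda>m. ?g m + z * (1 / (of_int m + c)\<^sup>2)) has_sum
     of_real pi * cot (of_real pi * (z - c)) + of_real pi * cot (of_real pi * c)
       + z * (\<Sum>\<^sub>\<infinity>m::int. 1 / (of_int m + c)\<^sup>2)) UNIV" by simp
  then show ?thesis by (intro infsumI) (simp add: algebra_simps)
qed

text \<open>As z stays below the fraction \<open>1 - d\<close> of the height of row n, the two
  cotangents have arguments on opposite sides of the real axis, each at distance at least \<pi> d
  |n| Im \<tau> from it. The outer factor \<pi> is absorbed by the \<pi>^2 in the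
  denominators.\<close>

lemma norm_cot_row_le:
  assumes y: "Im \<tau> > 0" and n: "n \<noteq> 0" and d: "0 < d" "d \<le> 1"
    and z: "\<bar>Im z\<bar> \<le> (1 - d) * (\<bar>real_of_int n\<bar> * Im \<tau>)"
  shows "norm (cot_row z \<tau> n) \<le> 2 / (d * Im \<tau>)\<^sup>2 * (1 / (real_of_int n)\<^sup>2)"
proof -
  let ?v = "of_real pi * (z - of_int n * \<tau>)" and ?w = "of_real pi * (of_int n * \<tau>)"
  define Y where "Y = \<bar>real_of_int n\<bar> * Im \<tau>"
  have Y: "Y > 0" using y n by (simp add: Y_def)
  have dY: "d * Y > 0" "d * Y \<le> Y" using d Y by (auto simp: mult_le_cancel_right1)
  have z': "\<bar>Im z\<bar> \<le> Y - d * Y" using z by (simp add: Y_def algebra_simps)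
  have w: "\<bar>real_of_int n * Im \<tau>\<bar> = Y" using y by (simp add: Y_def abs_mult)
  have v: "\<bar>Im z - real_of_int n * Im \<tau>\<bar> \<ge> d * Y" using w z' by linarith
  have "(Im z - real_of_int n * Im \<tau>) * (real_of_int n * Im \<tau>) < 0"
  proof (cases "n > 0")
    case True
    then have "real_of_int n * Im \<tau> = Y" using y by (simp add: Y_def)
    then show ?thesis using z' dY Y by (auto simp: mult_less_0_iff)
  next
    case False
    then have "real_of_int n * Im \<tau> = - Y" using y by (simp add: Y_def)
    then show ?thesis using z' dY Y by (auto simp: mult_less_0_iff)
  qed
  then have "pi * pi * ((Im z - real_of_int n * Im \<tau>) * (real_of_int n * Im \<tau>)) < 0"
    by (rule mult_pos_neg[rotated]) simp
  moreover have "Im ?v * Im ?w = pi * pi * ((Im z - real_of_int n * Im \<tau>) * (real_of_int n * Im \<tau>))" by simp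
  ultimately have sg: "Im ?v * Im ?w < 0" by presburger
  have pi1: "1 \<le> pi" using pi_gt3 by linarith
  have sq: "pi * (1 / (pi * t)\<^sup>2) \<le> 1 / (d * Y)\<^sup>2" if t: "\<bar>t\<bar> \<ge> d * Y" for t
  proof -
    have t2: "t\<^sup>2 \<ge> (d * Y)\<^sup>2" using power_mono[OF t, of 2] dY by simp
    have dp: "(d * Y)\<^sup>2 > 0" using dY(1) by (rule zero_less_power)
    have "pi * (1 / (pi * t)\<^sup>2) = 1 / (pi * t\<^sup>2)" by (simp add: power2_eq_square)
    also have "\<dots> \<le> 1 / (d * Y)\<^sup>2"
    proof (rule frac_le)
      have "1 * (d * Y)\<^sup>2 \<le> pi * t\<^sup>2" using t2 pi1 by (intro mult_mono) auto
      then show "(d * Y)\<^sup>2 \<le> pi * t\<^sup>2" by simp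
    qed (use dp in auto)
    finally show ?thesis .
  qed
  have "cot_row z \<tau> n = of_real pi * (cot ?v + cot ?w)" by (simp add: cot_row_def ring_distribs)
  then have "norm (cot_row z \<tau> n) = pi * norm (cot ?v + cot ?w)" by (simp add: norm_mult)
  also have "\<dots> \<le> pi * (1 / (Im ?v)\<^sup>2 + 1 / (Im ?w)\<^sup>2)"
    by (intro mult_left_mono norm_cot_add_cot_le sg) auto
  also have "\<dots> = pi * (1 / (pi * (Im z - real_of_int n * Im \<tau>))\<^sup>2) + pi * (1 / (pi * (real_of_int n * Im \<tau>))\<^sup>2)"
    by (simp add: ring_distribs)
  also have "\<dots> \<le> 1 / (d * Y)\<^sup>2 + 1 / (d * Y)\<^sup>2"
    using v w dY by (intro add_mono sq) auto
  also have "\<dots> = 2 / (d * Im \<tau>)\<^sup>2 * (1 / (real_of_int n)\<^sup>2)" by (simp add: Y_def power_mult_distrib)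
  finally show ?thesis .
qed

lemma summable_cot_row:
  assumes y: "Im \<tau> > 0"
  shows "cot_row z \<tau> summable_on UNIV"
proof -
  define B where "B = 2 * \<bar>Im z\<bar> / Im \<tau>"
  define F where "F = insert 0 {n::int. real_of_int \<bar>n\<bar> \<le> B}"
  have F: "finite F" unfolding F_def by (intro finite.insertI finite_int_box)
  let ?c = "2 / ((1/2) * Im \<tau>)\<^sup>2"
  define M where "M n = (if n \<in> F then norm (cot_row z \<tau> n) else ?c * (1 / (real_of_int n)\<^sup>2))" for n
  have b: "norm (cot_row z \<tau> n) \<le> M n" for n
  proof (cases "n \<in> F")
    case False
    then have n: "n \<noteq> 0" "\<bar>real_of_int n\<bar> > B" by (auto simp: F_def)
    then have "\<bar>Im z\<bar> \<le> (1 - 1/2) * (\<bar>real_of_int n\<bar> * Im \<tau>)" using y by (simp add: B_def field_simps)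
    then show ?thesis using norm_cot_row_le[OF y n(1), of "1/2" z] False by (simp add: M_def)
  qed (simp add: M_def)
  show ?thesis
    by (rule summable_on_comparison_complex[OF summable_on_alter_finite[OF
          summable_on_cmult_right[OF summable_on_int_inverse_square, of ?c] F] b])
       (auto simp: M_def)
qed

text \<open>Absolute summability allows summation row by row. The coefficient \<kappa> is the sum of
  1 / \<omega>^2 in Eisenstein's order; what matters at this stage is that it does not depend on
  z.\<close>

lemma wzeta_cot_sum_aux:
  assumes \<tau>: "Im \<tau> > 0"
  obtains \<kappa> where "\<And>z. z \<notin> lattice \<tau> \<Longrightarrow> wzeta z \<tau> = \<kappa> * z + cot_sum z \<tau>"
proof
  let ?K = "\<lambda>n::int. (\<Sum>\<^sub>\<infinity>m::int. 1 / (of_int m + of_int n * \<tau>)\<^sup>2)"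
  fix z assume z: "z \<notin> lattice \<tau>"
  define f where "f n m = 1 / (z - (of_int m + of_int n * \<tau>)) + 1 / (of_int m + of_int n * \<tau>)
      + z / (of_int m + of_int n * \<tau>)\<^sup>2" for n m :: int
  have "(\<lambda>k. 1 / (z - lattice_pt \<tau> k) + 1 / lattice_pt \<tau> k + z / (lattice_pt \<tau> k)\<^sup>2) summable_on (UNIV \<times> UNIV)"
    using cubic_decay_summable[OF cubic_decay_zeta \<tau>, of z] by simp
  then have sw: "(\<lambda>(n, m). f n m) summable_on (UNIV \<times> UNIV)"
    by (subst (asm) summable_on_swap) (simp add: f_def lattice_pt_def)
  have "wzeta z \<tau> = infsum (\<lambda>(m, n). f n m) (UNIV \<times> UNIV)"
    unfolding wzeta_eq[OF \<tau>] by (simp add: f_def lattice_pt_def case_prod_unfold)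
  also have "\<dots> = infsum (\<lambda>(n, m). f n m) (UNIV \<times> UNIV)"
    using has_sum_swap[where f = "\<lambda>(m, n). f n m" and A = UNIV and B = UNIV] sw by (auto intro!: infsumI)
  also have "\<dots> = (\<Sum>\<^sub>\<infinity>n. \<Sum>\<^sub>\<infinity>m. f n m)"
    by (rule infsum_Sigma'_banach[symmetric, OF sw])
  finally have 1: "wzeta z \<tau> = (\<Sum>\<^sub>\<infinity>n. \<Sum>\<^sub>\<infinity>m. f n m)" .
  have row: "(\<Sum>\<^sub>\<infinity>m. f n m) = cot_row z \<tau> n + z * ?K n" for n
  proof -
    have "(\<lambda>m. f n m) summable_on UNIV" using summable_on_SigmaD1[OF sw] by simp
    moreover have "of_int n * \<tau> \<notin> \<int> \<or> of_int n * \<tau> = 0"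
    proof (cases "n = 0")
      case False
      then have "Im (of_int n * \<tau>) \<noteq> 0" using \<tau> by simp
      then show ?thesis using complex_is_Int_iff by blast
    qed simp
    moreover have "z - of_int n * \<tau> \<notin> \<int>"
    proof
      assume "z - of_int n * \<tau> \<in> \<int>"
      then obtain m where "z - of_int n * \<tau> = of_int m" by (auto elim: Ints_cases)
      then have "z = lattice_pt \<tau> (m, n)" by (simp add: lattice_pt_def algebra_simps)
      then show False using z by simp
    qed
    ultimately show ?thesis unfolding f_def cot_row_def by (intro infsum_row)
  qed
  have "(\<lambda>n. \<Sum>\<^sub>\<infinity>m. f n m) summable_on UNIV" by (rule summable_on_Sigma_banach[OF sw])
  then have "(\<lambda>n. (\<Sum>\<^sub>\<infinity>m. f n m) + - cot_row z \<tau> n) summable_on UNIV"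
    by (intro summable_on_add summable_on_uminus[THEN iffD2] summable_cot_row \<tau>)
  \<comment> \<open>The row sums of 1 / \<omega>^2 are summable as the difference of two summable
    families: the whole rows and their cotangent parts.\<close>
  then have s: "(\<lambda>n. z * ?K n) summable_on UNIV" by (simp add: row)
  show "wzeta z \<tau> = (\<Sum>\<^sub>\<infinity>n. ?K n) * z + cot_sum z \<tau>"
    unfolding 1 row cot_sum_def using infsum_add[OF summable_cot_row[OF \<tau>] s, of z]
    by (simp add: infsum_cmult_right' mult.commute)
qed

lemma cot_plus_pi [simp]: "cot (z + of_real pi) = cot (z :: complex)"
  by (simp add: cot_def sin_add cos_add)

lemma cot_sum_plus_1: "cot_sum (z + 1) \<tau> = cot_sum z \<tau>"
proof -
  have "cot_row (z + 1) \<tau> n = cot_row z \<tau> n" for n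
  proof -
    have "of_real pi * (z + 1 - of_int n * \<tau>) = of_real pi * (z - of_int n * \<tau>) + of_real pi"
      by (simp add: algebra_simps)
    then show ?thesis by (simp only: cot_row_def cot_plus_pi)
  qed
  then show ?thesis by (simp add: cot_sum_def)
qed

lemma cot_sum_minus: "cot_sum (- z) \<tau> = - cot_sum z \<tau>"
proof -
  have cm: "cot (- w) = - cot w" for w :: complex by (simp add: cot_def)
  have "cot_row (- z) \<tau> (- n) = - cot_row z \<tau> n" for n
  proof -
    have "of_real pi * (- z - of_int (- n) * \<tau>) = - (of_real pi * (z - of_int n * \<tau>))"
      "of_real pi * (of_int (- n) * \<tau>) = - (of_real pi * (of_int n * \<tau>))" by (simp_all add: algebra_simps)
    then show ?thesis unfolding cot_row_def by (simp only: cm) simp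
  qed
  then have "(\<Sum>\<^sub>\<infinity>n. cot_row (- z) \<tau> (- n)) = - cot_sum z \<tau>" by (simp add: cot_sum_def infsum_uminus)
  moreover have "(\<Sum>\<^sub>\<infinity>n. cot_row (- z) \<tau> (- n)) = (\<Sum>\<^sub>\<infinity>n. cot_row (- z) \<tau> n)"
    by (rule infsum_reindex_bij_witness[of _ uminus uminus]) auto
  ultimately show ?thesis by (simp add: cot_sum_def)
qed

text \<open>Translation by \<tau> moves each row onto its neighbour, so the difference telescopes.
  The cotangent tends to \<i> far down and to - \<i> far up, which leaves - 2 \<pi> \<i>.\<close>

lemma cot_sum_plus_tau:
  assumes \<tau>: "Im \<tau> > 0"
  shows "cot_sum (z + \<tau>) \<tau> = cot_sum z \<tau> - 2 * of_real pi * \<i>"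
proof -
  define a where "a n = of_real pi * cot (of_real pi * (z - of_int n * \<tau>))" for n :: int
  have d: "cot_row (z + \<tau>) \<tau> n + - cot_row z \<tau> n = a (n - 1) - a n" for n
    by (simp add: cot_row_def a_def algebra_simps)
  have s: "(\<lambda>n. cot_row (z + \<tau>) \<tau> n + - cot_row z \<tau> n) summable_on UNIV"
    by (intro summable_on_add summable_on_uminus[THEN iffD2] summable_cot_row \<tau>)
  have "cot_sum (z + \<tau>) \<tau> + - cot_sum z \<tau> = (\<Sum>\<^sub>\<infinity>n. cot_row (z + \<tau>) \<tau> n + - cot_row z \<tau> n)"
    unfolding cot_sum_def infsum_uminus[symmetric]
    by (intro infsum_add[symmetric] summable_on_uminus[THEN iffD2] summable_cot_row \<tau>)
  also have "\<dots> = (- of_real pi * \<i>) - of_real pi * \<i>"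
    unfolding d
  proof (rule infsum_int_telescope)
    show "(\<lambda>n. a (n - 1) - a n) summable_on UNIV" using s by (simp only: d)
    have at_top: "filterlim (\<lambda>n. real n * Im \<tau>) at_top sequentially"
      using filterlim_tendsto_pos_mult_at_top[OF tendsto_const \<tau> filterlim_real_sequentially] by (simp add: mult.commute)
    have lim0: "(\<lambda>n. 1 / (pi * (c + real n * Im \<tau>))\<^sup>2) \<longlonglongrightarrow> 0" for c
      by (intro tendsto_divide_0[OF tendsto_const] filterlim_at_top_imp_at_infinity filterlim_pow_at_top
            filterlim_tendsto_pos_mult_at_top[OF tendsto_const] filterlim_tendsto_add_at_top[OF tendsto_const] at_top) auto
    have "(Im z - real n * Im \<tau>)\<^sup>2 = (- Im z + real n * Im \<tau>)\<^sup>2" for n by (simp add: power2_commute)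
    then have lim1: "(\<lambda>n. 1 / (pi * (Im z - real n * Im \<tau>))\<^sup>2) \<longlonglongrightarrow> 0"
      using lim0[of "- Im z"] by (simp only: power_mult_distrib)
    have ev: "\<forall>\<^sub>F n in sequentially. \<bar>Im z\<bar> < real n * Im \<tau>"
      using at_top by (simp add: filterlim_at_top_dense)
    have "\<forall>\<^sub>F n in sequentially. norm (cot (of_real pi * (z - of_int (int n) * \<tau>)) - \<i>) \<le> 1 / (pi * (Im z - real n * Im \<tau>))\<^sup>2"
      using ev
    proof eventually_elim
      case (elim n)
      then have "Im (of_real pi * (z - of_int (int n) * \<tau>)) < 0" by (auto intro!: mult_pos_neg)
      from norm_cot_minus_i_le[OF this] show ?case by simp
    qed
    then have "(\<lambda>n. cot (of_real pi * (z - of_int (int n) * \<tau>)) - \<i>) \<longlonglongrightarrow> 0" by (rule Lim_null_comparison[OF _ lim1])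
    then have "(\<lambda>n. cot (of_real pi * (z - of_int (int n) * \<tau>))) \<longlonglongrightarrow> \<i>" by (subst LIM_zero_iff[symmetric])
    then show "(\<lambda>n. a (int n)) \<longlonglongrightarrow> of_real pi * \<i>" unfolding a_def by (intro tendsto_intros)
    have "\<forall>\<^sub>F n in sequentially. norm (cot (of_real pi * (z - of_int (- int n) * \<tau>)) + \<i>) \<le> 1 / (pi * (Im z + real n * Im \<tau>))\<^sup>2"
      using ev
    proof eventually_elim
      case (elim n)
      then have "Im (of_real pi * (z - of_int (- int n) * \<tau>)) > 0" by (auto intro!: mult_pos_pos)
      from norm_cot_plus_i_le[OF this] show ?case by simp
    qed
    then have "(\<lambda>n. cot (of_real pi * (z - of_int (- int n) * \<tau>)) + \<i>) \<longlonglongrightarrow> 0" by (rule Lim_null_comparison[OF _ lim0])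
    then have "(\<lambda>n. cot (of_real pi * (z - of_int (- int n) * \<tau>)) - (- \<i>)) \<longlonglongrightarrow> 0" by simp
    then have "(\<lambda>n. cot (of_real pi * (z - of_int (- int n) * \<tau>))) \<longlonglongrightarrow> - \<i>" by (subst LIM_zero_iff[symmetric])
    then have "(\<lambda>n. a (- int n)) \<longlonglongrightarrow> of_real pi * (- \<i>)" unfolding a_def by (intro tendsto_intros)
    then show "(\<lambda>n. a (- int n)) \<longlonglongrightarrow> - of_real pi * \<i>" by simp
  qed
  finally show ?thesis by (simp add: algebra_simps)
qed

text \<open>Evaluation at half periods: \<open>cot_sum\<close> is odd, so its translation laws give
  0 at 1/2 and - \<pi> \<i> at \<tau>/2. The first value identifies \<kappa> with \<eta>1, the
  second yields \<eta>2.\<close>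

lemma wzeta_cot_sum_and_legendre:
  assumes \<tau>: "Im \<tau> > 0"
  shows wzeta_cot_sum: "z \<notin> lattice \<tau> \<Longrightarrow> wzeta z \<tau> = eta1 \<tau> * z + cot_sum z \<tau>"
    and legendre: "eta2 \<tau> = eta1 \<tau> * \<tau> - 2 * of_real pi * \<i>"
proof -
  obtain \<kappa> where k: "\<And>z. z \<notin> lattice \<tau> \<Longrightarrow> wzeta z \<tau> = \<kappa> * z + cot_sum z \<tau>"
    by (rule wzeta_cot_sum_aux[OF \<tau>]) blast
  have "cot_sum (1/2) \<tau> = - cot_sum (1/2) \<tau>"
    using cot_sum_plus_1[of "- (1/2)" \<tau>] cot_sum_minus[of "1/2" \<tau>] by simp
  then have "cot_sum (1/2) \<tau> = 0" by simp
  then have e1: "eta1 \<tau> = \<kappa>" using k[OF half_notin_lattice(1)[OF \<tau>]] by (simp add: eta1_def mult.commute)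
  have "cot_sum (\<tau>/2) \<tau> = - cot_sum (\<tau>/2) \<tau> - 2 * of_real pi * \<i>"
    using cot_sum_plus_tau[OF \<tau>, of "- (\<tau>/2)"] cot_sum_minus[of "\<tau>/2" \<tau>] by simp
  then have "2 * cot_sum (\<tau>/2) \<tau> = - 2 * of_real pi * \<i>" by simp
  then show "eta2 \<tau> = eta1 \<tau> * \<tau> - 2 * of_real pi * \<i>"
    using k[OF half_notin_lattice(2)[OF \<tau>]] e1 by (simp add: eta2_def ring_distribs)
  show "z \<notin> lattice \<tau> \<Longrightarrow> wzeta z \<tau> = eta1 \<tau> * z + cot_sum z \<tau>" using k e1 by simp
qed

lemma wzeta_plus_1:
  assumes "Im \<tau> > 0" "z \<notin> lattice \<tau>" shows "wzeta (z + 1) \<tau> = wzeta z \<tau> + eta1 \<tau>"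
  using wzeta_cot_sum[OF assms(1), of z] wzeta_cot_sum[OF assms(1), of "z + 1"] assms
  by (simp add: cot_sum_plus_1 lattice_add_iff ring_distribs)

lemma wzeta_plus_tau:
  assumes "Im \<tau> > 0" "z \<notin> lattice \<tau>" shows "wzeta (z + \<tau>) \<tau> = wzeta z \<tau> + eta2 \<tau>"
  using wzeta_cot_sum[OF assms(1), of z] wzeta_cot_sum[OF assms(1), of "z + \<tau>"] assms
  by (simp add: cot_sum_plus_tau lattice_add_iff ring_distribs legendre)

text \<open>By Legendre, r \<eta>1 + s \<eta>2 = \<eta>1 \<alpha> - 2 \<pi> \<i> s, and the multiple
  of \<alpha> cancels against that in \<zeta>.\<close>

lemma Zrs_eq_cot_sum:
  assumes "Im \<tau> > 0" "r + s * \<tau> \<notin> lattice \<tau>"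
  shows "Zrs r s \<tau> = cot_sum (r + s * \<tau>) \<tau> + 2 * of_real pi * \<i> * s"
  using wzeta_cot_sum[OF assms] legendre[OF assms(1)] unfolding Zrs_def by (simp only:) (simp add: algebra_simps)

lemma deriv_shift:
  assumes "(f has_field_derivative D) (at (z + w))" "(f has_field_derivative D') (at z)"
    and "\<forall>\<^sub>F x in nhds z. f (x + w) = f x + c"
  shows "D = (D' :: complex)"
proof -
  have "((\<lambda>x. f (x + w)) has_field_derivative D) (at z)" using assms(1) by (subst DERIV_shift[symmetric])
  then have "((\<lambda>x. f x + c) has_field_derivative D) (at z)"
    using DERIV_cong_ev[OF refl assms(3) refl] by simp
  moreover have "((\<lambda>x. f x + c) has_field_derivative D') (at z)"
    using assms(2) by (auto intro!: derivative_eq_intros)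
  ultimately show ?thesis by (rule DERIV_unique)
qed

text \<open>Differentiating the translation laws of \<zeta> removes the additive quasi-periods and
  avoids any rearrangement of the series.\<close>

lemma wp_periodic:
  assumes \<tau>: "Im \<tau> > 0" and z: "z \<notin> lattice \<tau>"
  shows "wp (z + 1) \<tau> = wp z \<tau>" "wp (z + \<tau>) \<tau> = wp z \<tau>"
proof -
  have z': "z + 1 \<notin> lattice \<tau>" "z + \<tau> \<notin> lattice \<tau>" using z by (simp_all add: lattice_add_iff)
  note ev = eventually_notin_lattice_nhds[OF z \<tau>]
  have "- wp (z + 1) \<tau> = - wp z \<tau>"
    by (rule deriv_shift[OF wzeta_has_field_derivative[OF z'(1) \<tau>] wzeta_has_field_derivative[OF z \<tau>], of "eta1 \<tau>"])
       (use ev in \<open>eventually_elim, simp add: wzeta_plus_1 \<tau>\<close>)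
  then show "wp (z + 1) \<tau> = wp z \<tau>" by simp
  have "- wp (z + \<tau>) \<tau> = - wp z \<tau>"
    by (rule deriv_shift[OF wzeta_has_field_derivative[OF z'(2) \<tau>] wzeta_has_field_derivative[OF z \<tau>], of "eta2 \<tau>"])
       (use ev in \<open>eventually_elim, simp add: wzeta_plus_tau \<tau>\<close>)
  then show "wp (z + \<tau>) \<tau> = wp z \<tau>" by simp
qed

lemma wp'_periodic:
  assumes \<tau>: "Im \<tau> > 0" and z: "z \<notin> lattice \<tau>"
  shows "wp' (z + 1) \<tau> = wp' z \<tau>" "wp' (z + \<tau>) \<tau> = wp' z \<tau>"
proof -
  have z': "z + 1 \<notin> lattice \<tau>" "z + \<tau> \<notin> lattice \<tau>" using z by (simp_all add: lattice_add_iff)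
  note ev = eventually_notin_lattice_nhds[OF z \<tau>]
  show "wp' (z + 1) \<tau> = wp' z \<tau>"
    by (rule deriv_shift[OF wp_has_field_derivative[OF z'(1) \<tau>] wp_has_field_derivative[OF z \<tau>], of 0])
       (use ev in \<open>eventually_elim, simp add: wp_periodic \<tau>\<close>)
  show "wp' (z + \<tau>) \<tau> = wp' z \<tau>"
    by (rule deriv_shift[OF wp_has_field_derivative[OF z'(2) \<tau>] wp_has_field_derivative[OF z \<tau>], of 0])
       (use ev in \<open>eventually_elim, simp add: wp_periodic \<tau>\<close>)
qed

lemma infsum_lattice_flip:
  "(\<Sum>\<^sub>\<infinity>k. f (- lattice_pt \<tau> k)) = (\<Sum>\<^sub>\<infinity>k. f (lattice_pt \<tau> k))"
  by (rule infsum_reindex_bij_witness[of _ uminus uminus]) (auto simp: lattice_pt_def)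

lemma wp_minus: "Im \<tau> > 0 \<Longrightarrow> wp (- z) \<tau> = wp z \<tau>"
proof -
  assume \<tau>: "Im \<tau> > 0"
  have "(- z - - w)\<^sup>2 = (z - w)\<^sup>2" for w :: complex by (simp add: power2_commute)
  then show ?thesis
    using infsum_lattice_flip[of "\<lambda>w. 1 / (- z - w)\<^sup>2 - 1 / w\<^sup>2" \<tau>] by (simp add: wp_eq[OF \<tau>])
qed

lemma wp'_minus: "Im \<tau> > 0 \<Longrightarrow> wp' (- z) \<tau> = - wp' z \<tau>"
proof -
  assume \<tau>: "Im \<tau> > 0"
  have "1 / (- z - - w) ^ 3 = - (1 / (z - w) ^ 3)" for w :: complex
  proof -
    have "- z - - w = - (z - w)" "(- u) ^ 3 = - (u ^ 3)" for u :: complex by (simp_all add: power3_eq_cube)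
    then show ?thesis by (simp only: divide_minus_right)
  qed
  then have "(\<Sum>\<^sub>\<infinity>k. 1 / (- z - lattice_pt \<tau> k) ^ 3) = - (\<Sum>\<^sub>\<infinity>k. 1 / (z - lattice_pt \<tau> k) ^ 3)"
    using infsum_lattice_flip[of "\<lambda>w. 1 / (- z - w) ^ 3" \<tau>] by (simp only: infsum_uminus)
  then show ?thesis by (simp only: wp'_eq[OF \<tau>]) simp
qed


section \<open>Expansion at the origin\<close>

text \<open>What remains of the series after the principal part is removed, with the terms at \<open>\<omega>\<close> and \<open>- \<omega>\<close> averaged
  for \<open>\<wp>\<close> and \<open>\<wp>'\<close>. Each remainder vanishes at \<open>\<omega> = 0\<close>. The polynomial in \<open>ode_rest\<close> is the numerator left over when
  the order-four terms of \<open>- 4 wp'_rest - 12 wp_rest + 60 / \<omega> ^ 4\<close> cancel.\<close>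

definition zeta_rest :: "complex \<Rightarrow> complex \<Rightarrow> complex" where
  "zeta_rest z \<omega> = 1 / ((z - \<omega>) * \<omega>\<^sup>2)"

definition wp_rest :: "complex \<Rightarrow> complex \<Rightarrow> complex" where
  "wp_rest z \<omega> = (3 * \<omega>\<^sup>2 - z\<^sup>2) / (\<omega>\<^sup>2 * (z\<^sup>2 - \<omega>\<^sup>2)\<^sup>2)"

definition wp'_rest :: "complex \<Rightarrow> complex \<Rightarrow> complex" where
  "wp'_rest z \<omega> = (if \<omega> = 0 then 0 else - 2 * (z\<^sup>2 + 3 * \<omega>\<^sup>2) / (z\<^sup>2 - \<omega>\<^sup>2) ^ 3)"

definition ode_rest :: "complex \<Rightarrow> complex \<Rightarrow> complex" where
  "ode_rest z \<omega> = (140 * \<omega> ^ 4 - 168 * z\<^sup>2 * \<omega>\<^sup>2 + 60 * z ^ 4) / (\<omega> ^ 4 * (z\<^sup>2 - \<omega>\<^sup>2) ^ 3)"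

abbreviation lattice_sum :: "(complex \<Rightarrow> complex \<Rightarrow> complex) \<Rightarrow> complex \<Rightarrow> complex \<Rightarrow> complex" where
  "lattice_sum f z \<tau> \<equiv> \<Sum>\<^sub>\<infinity>k. f z (lattice_pt \<tau> k)"

lemma norm_sq_diff_ge:
  fixes z w :: complex
  assumes "norm z \<le> R" "norm w \<ge> 2 * R" "R > 0"
  shows "norm (z\<^sup>2 - w\<^sup>2) \<ge> norm w ^ 2 / 2" "norm z \<le> norm w"
proof -
  show zw: "norm z \<le> norm w" using assms by simp
  have "norm z ^ 2 \<le> (norm w / 2) ^ 2" using assms by (intro power_mono) auto
  then have "norm z ^ 2 \<le> norm w ^ 2 / 4" by (simp add: power_divide)
  moreover have "norm (w\<^sup>2) - norm (z\<^sup>2) \<le> norm (w\<^sup>2 - z\<^sup>2)" by (rule norm_triangle_ineq2)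
  moreover have "0 \<le> norm w ^ 2" by simp
  ultimately show "norm (z\<^sup>2 - w\<^sup>2) \<ge> norm w ^ 2 / 2"
    unfolding norm_minus_commute[of "z\<^sup>2"] norm_power by linarith
qed

lemma cubic_decay_zeta_rest: "cubic_decay zeta_rest"
proof (rule cubic_decayI[of _ "\<lambda>_. 2" 0])
  fix R :: real and z w :: complex
  assume a: "R > 0" "norm z \<le> R" "norm w \<ge> 2 * R" "w \<noteq> 0"
  have h: "norm w / 2 \<le> norm (z - w)" by (rule norm_diff_ge_half[OF a(2,3)])
  have w: "norm w > 0" using a by simp
  have "norm (zeta_rest z w) = 1 / (norm (z - w) * norm w ^ 2)"
    by (simp add: zeta_rest_def norm_divide norm_mult norm_power)
  also have "\<dots> \<le> 1 / (norm w / 2 * norm w ^ 2)"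
    using h w by (intro frac_le mult_right_mono mult_pos_pos) auto
  finally show "norm (zeta_rest z w) \<le> 2 / norm w ^ (3 + 0)" by (simp add: power3_eq_cube power2_eq_square mult_ac)
qed simp

lemma cubic_decay_wp_rest: "cubic_decay wp_rest"
proof (rule cubic_decayI[of _ "\<lambda>_. 16" 1])
  fix R :: real and z w :: complex
  assume a: "R > 0" "norm z \<le> R" "norm w \<ge> 2 * R" "w \<noteq> 0"
  note h = norm_sq_diff_ge[OF a(2,3,1)]
  have w: "norm w > 0" using a by simp
  have z2: "norm z ^ 2 \<le> norm w ^ 2" using h by (intro power_mono) auto
  have "norm (3 * w\<^sup>2 - z\<^sup>2) \<le> 4 * norm w ^ 2"
    using norm_triangle_ineq4[of "3 * w\<^sup>2" "z\<^sup>2"] z2 unfolding norm_mult norm_power norm_numeral norm_neg_numeral by linarith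
  then have "norm (wp_rest z w) \<le> 4 * norm w ^ 2 / (norm w ^ 2 * (norm w ^ 2 / 2)\<^sup>2)"
    unfolding wp_rest_def norm_divide norm_mult norm_power
    using h w by (intro frac_le mult_left_mono power_mono mult_pos_pos zero_less_power) auto
  also have "\<dots> = 16 / norm w ^ (3 + 1)" using w by (simp add: divide_simps)
  finally show "norm (wp_rest z w) \<le> 16 / norm w ^ (3 + 1)" .
qed simp

lemma cubic_decay_wp'_rest: "cubic_decay wp'_rest"
proof (rule cubic_decayI[of _ "\<lambda>_. 64" 1])
  fix R :: real and z w :: complex
  assume a: "R > 0" "norm z \<le> R" "norm w \<ge> 2 * R" "w \<noteq> 0"
  note h = norm_sq_diff_ge[OF a(2,3,1)]
  have w: "norm w > 0" using a by simp
  have z2: "norm z ^ 2 \<le> norm w ^ 2" using h by (intro power_mono) auto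
  have "norm (- 2 * (z\<^sup>2 + 3 * w\<^sup>2)) \<le> 8 * norm w ^ 2"
    using norm_triangle_ineq[of "z\<^sup>2" "3 * w\<^sup>2"] z2 unfolding norm_mult norm_power norm_numeral norm_neg_numeral by linarith
  then have "norm (- 2 * (z\<^sup>2 + 3 * w\<^sup>2) / (z\<^sup>2 - w\<^sup>2) ^ 3) \<le> 8 * norm w ^ 2 / (norm w ^ 2 / 2) ^ 3"
    unfolding norm_divide norm_power
    using h w by (intro frac_le power_mono zero_less_power) auto
  also have "\<dots> = 64 / norm w ^ (3 + 1)" using w by (simp add: divide_simps)
  finally show "norm (wp'_rest z w) \<le> 64 / norm w ^ (3 + 1)" using a by (simp add: wp'_rest_def)
qed simp

lemma cubic_decay_ode_rest: "cubic_decay ode_rest"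
proof (rule cubic_decayI[of _ "\<lambda>_. 2944" 3])
  fix R :: real and z w :: complex
  assume a: "R > 0" "norm z \<le> R" "norm w \<ge> 2 * R" "w \<noteq> 0"
  note h = norm_sq_diff_ge[OF a(2,3,1)]
  have w: "norm w > 0" using a by simp
  have z2: "norm z ^ 2 \<le> norm w ^ 2" "norm z ^ 4 \<le> norm w ^ 4" using h by (intro power_mono; auto)+
  have z3: "norm z ^ 2 * norm w ^ 2 \<le> norm w ^ 4"
    using mult_right_mono[OF z2(1), of "norm w ^ 2"] by (simp flip: power_add)
  have "norm (140 * w ^ 4 - 168 * z\<^sup>2 * w\<^sup>2 + 60 * z ^ 4) \<le> norm (140 * w ^ 4) + norm (168 * z\<^sup>2 * w\<^sup>2) + norm (60 * z ^ 4)"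
    by (meson norm_triangle_ineq norm_triangle_ineq4 add_right_mono order_trans)
  \<comment> \<open>Here 368 = 140 + 168 + 60. The cube of the halved denominator then contributes
    the factor 8 in 2944.\<close>
  also have "\<dots> \<le> 368 * norm w ^ 4" using z2 z3 unfolding norm_mult norm_power norm_numeral mult.assoc by linarith
  finally have "norm (ode_rest z w) \<le> 368 * norm w ^ 4 / (norm w ^ 4 * (norm w ^ 2 / 2) ^ 3)"
    unfolding ode_rest_def norm_divide norm_mult norm_power
    using h w by (intro frac_le mult_left_mono power_mono mult_pos_pos zero_less_power) auto
  also have "\<dots> = 2944 / norm w ^ (3 + 3)" using w by (simp add: divide_simps)
  finally show "norm (ode_rest z w) \<le> 2944 / norm w ^ (3 + 3)" .
qed simp

text \<open>\<open>f 0\<close> carries the principal part, and \<open>g 0 = 0\<close> lets the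
  remainder be summed over the full lattice.\<close>

lemma infsum_lattice_split_0:
  fixes f g :: "complex \<Rightarrow> complex"
  assumes "Im \<tau> > 0" "(\<lambda>k. f (lattice_pt \<tau> k)) summable_on UNIV" "g 0 = 0"
    and "\<And>\<omega>. \<omega> \<in> lattice \<tau> \<Longrightarrow> \<omega> \<noteq> 0 \<Longrightarrow> f \<omega> = g \<omega>"
  shows "(\<Sum>\<^sub>\<infinity>k. f (lattice_pt \<tau> k)) = f 0 + (\<Sum>\<^sub>\<infinity>k. g (lattice_pt \<tau> k))"
proof -
  have "infsum f (lattice \<tau> - {0}) = infsum g (lattice \<tau>)"
    using assms(3,4) by (intro infsum_cong_neutral) auto
  then show ?thesis
    using infsum_lattice_diff_0[OF assms(1,2)] infsum_lattice[OF assms(1), of g] by simp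
qed

lemma notin_lattice_sq_ne:
  assumes "w \<notin> lattice \<tau>" "\<omega> \<in> lattice \<tau>"
  shows "w - \<omega> \<noteq> 0" "w + \<omega> \<noteq> 0" "w\<^sup>2 - \<omega>\<^sup>2 \<noteq> 0" "w \<noteq> 0"
proof -
  show a: "w - \<omega> \<noteq> 0" using assms by auto
  show b: "w + \<omega> \<noteq> 0" using assms by (metis add_eq_0_iff lattice_minus_iff)
  have "w\<^sup>2 - \<omega>\<^sup>2 = (w - \<omega>) * (w + \<omega>)" by (simp add: power2_eq_square algebra_simps)
  then show "w\<^sup>2 - \<omega>\<^sup>2 \<noteq> 0" using a b by simp
  show "w \<noteq> 0" using assms by auto
qed

context
  fixes \<tau> w :: complex
  assumes \<tau>: "Im \<tau> > 0" and w: "w \<notin> lattice \<tau>"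
begin

lemma wzeta_expand: "wzeta w \<tau> = 1 / w + w\<^sup>2 * (lattice_sum zeta_rest w \<tau>)"
proof -
  have "1 / (w - \<omega>) + 1 / \<omega> + w / \<omega>\<^sup>2 = w\<^sup>2 * zeta_rest w \<omega>" if "\<omega> \<in> lattice \<tau>" "\<omega> \<noteq> 0" for \<omega>
    using notin_lattice_sq_ne[OF w that(1)] that by (simp add: zeta_rest_def field_simps power2_eq_square)
  from infsum_lattice_split_0[OF \<tau> cubic_decay_summable[OF cubic_decay_zeta \<tau>] _ this]
  show ?thesis unfolding wzeta_eq[OF \<tau>] infsum_cmult_right' by (simp add: zeta_rest_def[of w 0])
qed

lemma wp_expand: "wp w \<tau> = 1 / w\<^sup>2 + w\<^sup>2 * (lattice_sum wp_rest w \<tau>)"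
proof -
  let ?f = "\<lambda>\<omega>. (1 / (w - \<omega>)\<^sup>2 - 1 / \<omega>\<^sup>2) + (1 / (- w - \<omega>)\<^sup>2 - 1 / \<omega>\<^sup>2)"
  have e: "?f \<omega> = 2 * w\<^sup>2 * wp_rest w \<omega>" if "\<omega> \<in> lattice \<tau>" "\<omega> \<noteq> 0" for \<omega>
  proof -
    note n = notin_lattice_sq_ne[OF w that(1)]
    have sq: "(- w - \<omega>)\<^sup>2 = (w + \<omega>)\<^sup>2" by (simp add: power2_eq_square algebra_simps)
    have d: "w\<^sup>2 - \<omega>\<^sup>2 = (w - \<omega>) * (w + \<omega>)" by (simp add: power2_eq_square algebra_simps)
    show ?thesis unfolding wp_rest_def sq d using n that
      by (simp add: divide_simps) (simp add: power2_eq_square algebra_simps)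
  qed
  have s: "(\<lambda>k. 1 / (z - lattice_pt \<tau> k)\<^sup>2 - 1 / (lattice_pt \<tau> k)\<^sup>2) summable_on UNIV" for z
    by (rule cubic_decay_summable[OF cubic_decay_wp \<tau>])
  have "wp w \<tau> + wp (- w) \<tau> = (\<Sum>\<^sub>\<infinity>k. ?f (lattice_pt \<tau> k))"
    unfolding wp_eq[OF \<tau>] by (intro infsum_add[symmetric] s)
  also have "\<dots> = ?f 0 + (\<Sum>\<^sub>\<infinity>k. 2 * w\<^sup>2 * wp_rest w (lattice_pt \<tau> k))"
    by (rule infsum_lattice_split_0[OF \<tau> summable_on_add[OF s s] _ e]) (simp_all add: wp_rest_def)
  finally have "2 * wp w \<tau> = 2 * (1 / w\<^sup>2 + w\<^sup>2 * (lattice_sum wp_rest w \<tau>))"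
    unfolding infsum_cmult_right' by (simp add: wp_minus[OF \<tau>] ring_distribs)
  then show ?thesis by (subst (asm) mult_left_cancel) auto
qed

lemma wp'_expand: "wp' w \<tau> = - 2 / w ^ 3 + w * (lattice_sum wp'_rest w \<tau>)"
proof -
  let ?f = "\<lambda>\<omega>. 1 / (w - \<omega>) ^ 3 + - (1 / (- w - \<omega>) ^ 3)"
  have e: "?f \<omega> = - w * wp'_rest w \<omega>" if "\<omega> \<in> lattice \<tau>" "\<omega> \<noteq> 0" for \<omega>
  proof -
    note n = notin_lattice_sq_ne[OF w that(1)]
    have sq: "(- w - \<omega>) ^ 3 = - ((w + \<omega>) ^ 3)" by (simp add: power3_eq_cube algebra_simps)
    have d: "w\<^sup>2 - \<omega>\<^sup>2 = (w - \<omega>) * (w + \<omega>)" by (simp add: power2_eq_square algebra_simps)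
    show ?thesis unfolding wp'_rest_def sq d using n that
      by (simp add: divide_simps) (simp add: power2_eq_square power3_eq_cube algebra_simps)
  qed
  have s: "(\<lambda>k. 1 / (z - lattice_pt \<tau> k) ^ 3) summable_on UNIV" for z
    by (rule cubic_decay_summable[OF cubic_decay_wp' \<tau>])
  have s2: "(\<lambda>k. ?f (lattice_pt \<tau> k)) summable_on UNIV"
    by (intro summable_on_add summable_on_uminus[THEN iffD2] s)
  have "(\<Sum>\<^sub>\<infinity>k. 1 / (w - lattice_pt \<tau> k) ^ 3) + (\<Sum>\<^sub>\<infinity>k. - (1 / (- w - lattice_pt \<tau> k) ^ 3)) = (\<Sum>\<^sub>\<infinity>k. ?f (lattice_pt \<tau> k))"
    by (intro infsum_add[symmetric] summable_on_uminus[THEN iffD2] s)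
  also have "\<dots> = ?f 0 + (\<Sum>\<^sub>\<infinity>k. - w * wp'_rest w (lattice_pt \<tau> k))"
    by (rule infsum_lattice_split_0[OF \<tau> s2 _ e]) (simp_all add: wp'_rest_def)
  also have "?f 0 = 2 / w ^ 3" by (simp add: power3_eq_cube)
  finally have "wp' w \<tau> - wp' (- w) \<tau> = - 2 * (2 / w ^ 3 - w * (lattice_sum wp'_rest w \<tau>))"
    unfolding wp'_eq[OF \<tau>] infsum_uminus infsum_cmult_right' right_diff_distrib[symmetric]
    by (intro arg_cong[where f = "\<lambda>x. - 2 * x"]) simp
  then have "2 * wp' w \<tau> = 2 * (- 2 / w ^ 3 + w * (lattice_sum wp'_rest w \<tau>))"
    by (simp add: wp'_minus[OF \<tau>])
  then show ?thesis by (subst (asm) mult_left_cancel) auto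
qed

text \<open>The left side is what multiplies 1 / w^2 when the expansions are inserted into \<wp>'^2
  - 4 \<wp>^3 + g2 \<wp>. The extracted factor w^2 shows that this pole is absent, and 60 in the
  definition of g2 is exactly what makes it so.\<close>

lemma ode_rest_eq:
  "- 4 * (lattice_sum wp'_rest w \<tau>) - 12 * (lattice_sum wp_rest w \<tau>) + g2 \<tau> =
     w\<^sup>2 * (lattice_sum ode_rest w \<tau>)"
proof -
  have e: "(- 4 * wp'_rest w \<omega> + - 12 * wp_rest w \<omega>) + 60 * (1 / \<omega> ^ 4) = w\<^sup>2 * ode_rest w \<omega>" if "\<omega> \<in> lattice \<tau>" for \<omega>
  proof (cases "\<omega> = 0")
    case False
    note n = notin_lattice_sq_ne[OF w that(1)]
    define x y where "x = w\<^sup>2" and "y = \<omega>\<^sup>2"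
    have p4: "\<omega> ^ 4 = y ^ 2" "w ^ 4 = x ^ 2" by (simp_all add: x_def y_def flip: power_mult)
    have y: "y \<noteq> 0" "x - y \<noteq> 0" using False n by (auto simp: x_def y_def)
    show ?thesis
      unfolding wp'_rest_def wp_rest_def ode_rest_def p4 x_def[symmetric] y_def[symmetric]
      using y False by (simp add: divide_simps) (simp add: power2_eq_square power3_eq_cube algebra_simps)
  qed (simp add: wp'_rest_def wp_rest_def ode_rest_def)
  have s1: "(\<lambda>k. - 4 * wp'_rest w (lattice_pt \<tau> k)) summable_on UNIV"
    and s2: "(\<lambda>k. - 12 * wp_rest w (lattice_pt \<tau> k)) summable_on UNIV"
    and s3: "(\<lambda>k. 60 * (1 / (lattice_pt \<tau> k) ^ 4)) summable_on UNIV"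
    by (intro summable_on_cmult_right cubic_decay_summable[OF cubic_decay_wp'_rest \<tau>] cubic_decay_summable[OF cubic_decay_wp_rest \<tau>]
         cubic_decay_summable[OF cubic_decay_g2 \<tau>])+
  have "(\<Sum>\<^sub>\<infinity>k. - 4 * wp'_rest w (lattice_pt \<tau> k)) + (\<Sum>\<^sub>\<infinity>k. - 12 * wp_rest w (lattice_pt \<tau> k)) + (\<Sum>\<^sub>\<infinity>k. 60 * (1 / (lattice_pt \<tau> k) ^ 4))
     = (\<Sum>\<^sub>\<infinity>k. (- 4 * wp'_rest w (lattice_pt \<tau> k) + - 12 * wp_rest w (lattice_pt \<tau> k)) + 60 * (1 / (lattice_pt \<tau> k) ^ 4))"
    by (simp only: infsum_add[OF s1 s2] infsum_add[OF summable_on_add[OF s1 s2] s3])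
  also have "\<dots> = (\<Sum>\<^sub>\<infinity>k. w\<^sup>2 * ode_rest w (lattice_pt \<tau> k))" by (simp only: e lattice_pt_in_lattice)
  finally show ?thesis unfolding g2_eq[OF \<tau>] infsum_cmult_right' by simp
qed

end

text \<open>The behaviour at the origin along an arbitrary filter, so that the period \<open>\<tau>\<close> may move too.\<close>

locale origin_limit =
  fixes G :: "'a filter" and W T :: "'a \<Rightarrow> complex" and \<tau>0 :: complex
  assumes G: "G \<noteq> bot" and W: "(W \<longlongrightarrow> 0) G" and W_nz: "\<forall>\<^sub>F x in G. W x \<noteq> 0"
    and T: "(T \<longlongrightarrow> \<tau>0) G" and \<tau>0: "Im \<tau>0 > 0"
begin

lemma eventually_Im_pos: "\<forall>\<^sub>F x in G. Im (T x) > 0"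
  by (rule order_tendstoD[OF tendsto_Im[OF T]]) (use \<tau>0 in auto)

lemma eventually_notin: "\<forall>\<^sub>F x in G. W x \<notin> lattice (T x)"
proof -
  obtain K where K: "K > 0" "\<forall>\<^sub>F x in G. spread K (T x)" by (rule eventually_spread[OF T \<tau>0]) blast
  have "\<forall>\<^sub>F x in G. norm (W x) < 1 / K"
    using order_tendstoD(2)[OF tendsto_norm[OF W], of "1 / K"] K by simp
  with K(2) W_nz show ?thesis
  proof eventually_elim
    case (elim x)
    show ?case
    proof
      assume "W x \<in> lattice (T x)"
      then obtain k where k: "W x = lattice_pt (T x) k" by (auto simp: lattice_eq_range)
      then have "k \<noteq> 0" using elim by auto
      then have "1 + real_of_int \<bar>fst k\<bar> \<le> K * norm (W x)" using elim k unfolding spread_def by metis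
      moreover have "K * norm (W x) < 1" using elim K by (simp add: field_simps)
      ultimately show False by linarith
    qed
  qed
qed

lemma tendsto_rest_sum:
  assumes "cubic_decay f" "\<And>z. f z 0 = 0"
    and "\<And>(V :: 'a \<Rightarrow> complex) v. (V \<longlongrightarrow> v) G \<Longrightarrow> v \<noteq> 0 \<Longrightarrow> ((\<lambda>x. f (W x) (V x)) \<longlongrightarrow> f 0 v) G"
  shows "((\<lambda>x. \<Sum>\<^sub>\<infinity>k. f (W x) (lattice_pt (T x) k)) \<longlongrightarrow> (\<Sum>\<^sub>\<infinity>k. f 0 (lattice_pt \<tau>0 k))) G"
proof -
  obtain K where K: "K > 0" "\<forall>\<^sub>F x in G. spread K (T x)" by (rule eventually_spread[OF T \<tau>0]) blast
  show ?thesis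
  proof (rule tendsto_lattice_sum[OF assms(1) G W K])
    fix k
    show "((\<lambda>x. f (W x) (lattice_pt (T x) k)) \<longlongrightarrow> f 0 (lattice_pt \<tau>0 k)) G"
    proof (cases "k = 0")
      case False
      have "((\<lambda>x. lattice_pt (T x) k) \<longlongrightarrow> lattice_pt \<tau>0 k) G"
        unfolding lattice_pt_def by (intro tendsto_intros T)
      then show ?thesis using False lattice_pt_eq_0_iff[OF \<tau>0] by (intro assms(3)) auto
    qed (simp add: assms(2))
  qed
qed

lemma tendsto_rests:
  shows tendsto_zeta_rest: "((\<lambda>x. lattice_sum zeta_rest (W x) (T x)) \<longlongrightarrow> (lattice_sum zeta_rest 0 \<tau>0)) G" (is ?A)
    and tendsto_wp_rest: "((\<lambda>x. lattice_sum wp_rest (W x) (T x)) \<longlongrightarrow> (lattice_sum wp_rest 0 \<tau>0)) G" (is ?B)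
    and tendsto_wp'_rest: "((\<lambda>x. lattice_sum wp'_rest (W x) (T x)) \<longlongrightarrow> (lattice_sum wp'_rest 0 \<tau>0)) G" (is ?C)
    and tendsto_ode_rest: "((\<lambda>x. lattice_sum ode_rest (W x) (T x)) \<longlongrightarrow> (lattice_sum ode_rest 0 \<tau>0)) G" (is ?D)
proof -
  show ?A
    by (rule tendsto_rest_sum[OF cubic_decay_zeta_rest])
       (auto simp: zeta_rest_def intro!: tendsto_eq_intros W)
  show ?B
    by (rule tendsto_rest_sum[OF cubic_decay_wp_rest])
       (auto simp: wp_rest_def intro!: tendsto_eq_intros W)
  show ?D
    by (rule tendsto_rest_sum[OF cubic_decay_ode_rest])
       (auto simp: ode_rest_def intro!: tendsto_eq_intros W)
  \<comment> \<open>This remainder has no factor \<omega> in its denominator, hence the case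
    distinction in its definition. The limit is taken for the formula and transferred to where
    \<open>V x\<close> is nonzero.\<close>
  show ?C
  proof (rule tendsto_rest_sum[OF cubic_decay_wp'_rest])
    fix V and v :: complex assume V: "(V \<longlongrightarrow> v) G" "v \<noteq> 0"
    have "((\<lambda>x. - 2 * ((W x)\<^sup>2 + 3 * (V x)\<^sup>2) / ((W x)\<^sup>2 - (V x)\<^sup>2) ^ 3) \<longlongrightarrow> wp'_rest 0 v) G"
      using V(2) by (auto simp: wp'_rest_def intro!: tendsto_eq_intros W V)
    moreover have "\<forall>\<^sub>F x in G. - 2 * ((W x)\<^sup>2 + 3 * (V x)\<^sup>2) / ((W x)\<^sup>2 - (V x)\<^sup>2) ^ 3 = wp'_rest (W x) (V x)"
      using tendsto_imp_eventually_ne[OF V] by eventually_elim (simp add: wp'_rest_def)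
    ultimately show "((\<lambda>x. wp'_rest (W x) (V x)) \<longlongrightarrow> wp'_rest 0 v) G" by (rule Lim_transform_eventually)
  qed (simp add: wp'_rest_def)
qed

end


section \<open>Liouville's theorem and the cubic\<close>

lemma int_translate:
  fixes h :: "complex \<Rightarrow> complex"
  assumes "\<And>z. P z \<Longrightarrow> h (z + p) = h z + c" "\<And>z. P (z + p) \<longleftrightarrow> P z" "P z"
  shows "h (z + of_int n * p) = h z + of_int n * c \<and> P (z + of_int n * p)"
proof (induction n rule: int_induct[where k = 0])
  case base
  then show ?case using assms by simp
next
  case (step1 i)
  have e: "z + of_int (i + 1) * p = (z + of_int i * p) + p" by (simp add: algebra_simps)
  have "P (z + of_int i * p + p)" using step1 assms(2) by blast
  then show ?case unfolding e using step1 assms(1)[of "z + of_int i * p"] by (simp add: algebra_simps)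
next
  case (step2 i)
  have e: "z + of_int i * p = (z + of_int (i - 1) * p) + p" by (simp add: algebra_simps)
  have P: "P (z + of_int (i - 1) * p)" using step2 assms(2) unfolding e by blast
  have "h (z + of_int i * p) = h (z + of_int (i - 1) * p) + c"
    unfolding e by (rule assms(1)[OF P])
  then show ?case using step2 P by (simp add: algebra_simps)
qed

lemma lattice_translate:
  fixes h :: "complex \<Rightarrow> complex"
  assumes "\<And>z. P z \<Longrightarrow> h (z + 1) = h z + c1" "\<And>z. P z \<Longrightarrow> h (z + \<tau>) = h z + c2"
    and "\<And>z. P (z + 1) \<longleftrightarrow> P z" "\<And>z. P (z + \<tau>) \<longleftrightarrow> P z" "P z"
  shows "h (z + lattice_pt \<tau> k) = h z + of_int (fst k) * c1 + of_int (snd k) * c2"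
proof -
  have 1: "h (z + of_int (fst k) * 1) = h z + of_int (fst k) * c1 \<and> P (z + of_int (fst k) * 1)"
    by (rule int_translate[of P]) (use assms in auto)
  then have "h (z + of_int (fst k) * 1 + of_int (snd k) * \<tau>) = h (z + of_int (fst k) * 1) + of_int (snd k) * c2 \<and>
      P (z + of_int (fst k) * 1 + of_int (snd k) * \<tau>)"
    by (intro int_translate[of P]) (use assms in auto)
  then show ?thesis using 1 by (simp add: lattice_pt_def add.assoc)
qed

lemma fundamental_domain:
  assumes "Im \<tau> > 0"
  obtains k where "norm (z - lattice_pt \<tau> k) \<le> 1 + norm \<tau>"
proof
  define t where "t = Im z / Im \<tau>"
  define x where "x = Re z - t * Re \<tau>"
  have z: "z = of_real x + of_real t * \<tau>"
    using assms by (simp add: complex_eq_iff x_def t_def)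
  have "z - lattice_pt \<tau> (\<lfloor>x\<rfloor>, \<lfloor>t\<rfloor>) = of_real (x - \<lfloor>x\<rfloor>) + of_real (t - \<lfloor>t\<rfloor>) * \<tau>"
    by (subst z) (simp add: lattice_pt_def algebra_simps)
  also have "norm \<dots> \<le> \<bar>x - \<lfloor>x\<rfloor>\<bar> + \<bar>t - \<lfloor>t\<rfloor>\<bar> * norm \<tau>"
    by (rule order_trans[OF norm_triangle_ineq]) (simp only: norm_mult norm_of_real order_refl)
  also have "\<dots> \<le> 1 + 1 * norm \<tau>"
    by (intro add_mono mult_right_mono) (auto, linarith+)
  finally show "norm (z - lattice_pt \<tau> (\<lfloor>x\<rfloor>, \<lfloor>t\<rfloor>)) \<le> 1 + norm \<tau>" by simp
qed

lemma doubly_periodic_entire_constant: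
  assumes h: "h holomorphic_on UNIV" and \<tau>: "Im \<tau> > 0"
    and per: "\<And>z. h (z + 1) = h z" "\<And>z. h (z + \<tau>) = h z"
  shows "h constant_on UNIV"
proof (rule Liouville_theorem[OF h])
  have "compact (h ` cball 0 (1 + norm \<tau>))"
    by (intro compact_continuous_image compact_cball holomorphic_on_imp_continuous_on
          holomorphic_on_subset[OF h]) auto
  moreover have "range h \<subseteq> h ` cball 0 (1 + norm \<tau>)"
  proof
    fix y assume "y \<in> range h"
    then obtain z where y: "y = h z" by blast
    obtain k where k: "norm (z - lattice_pt \<tau> k) \<le> 1 + norm \<tau>" by (rule fundamental_domain[OF \<tau>])
    have "h (z - lattice_pt \<tau> k + lattice_pt \<tau> k) = h (z - lattice_pt \<tau> k)"
      using lattice_translate[of "\<lambda>_. True" h 0 \<tau> 0 "z - lattice_pt \<tau> k" k] per by simp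
    then have "y = h (z - lattice_pt \<tau> k)" by (simp add: y)
    then show "y \<in> h ` cball 0 (1 + norm \<tau>)" using k by auto
  qed
  ultimately show "bounded (range h)" using compact_imp_bounded bounded_subset by blast
qed

lemma field_differentiable_imp_holomorphic_on:
  "(\<And>z. z \<in> S \<Longrightarrow> f field_differentiable (at z)) \<Longrightarrow> f holomorphic_on S"
  unfolding holomorphic_on_def using field_differentiable_at_within by blast

text \<open>Riemann's theorem at every point at once. Differentiability and boundedness are assumed
  on punctured neighbourhoods only, so the singular points need not be located.\<close>

lemma removable_singularities_entire:
  assumes diff: "\<And>z. \<forall>\<^sub>F w in at z. F field_differentiable (at w)"
    and bd: "\<And>z. \<exists>B. \<forall>\<^sub>F w in at z. norm (F w :: complex) \<le> B"
  obtains g where "g holomorphic_on UNIV" "\<And>z. (F \<longlongrightarrow> g z) (at z)"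
proof -
  \<comment> \<open>A definition by limits makes the local extensions agree without any
    gluing.\<close>
  define g where "g z = Lim (at z) F" for z
  have loc: "\<exists>e>0. g holomorphic_on ball z e \<and> (\<forall>w\<in>ball z e. (F \<longlongrightarrow> g w) (at w))" for z
  proof -
    obtain e where e: "e > 0" "\<And>w. w \<noteq> z \<Longrightarrow> dist w z < e \<Longrightarrow> F field_differentiable (at w)"
      using diff[of z] unfolding eventually_at by auto
    have hol: "F holomorphic_on ball z e - {z}"
      by (rule field_differentiable_imp_holomorphic_on) (use e(2) in \<open>auto simp: dist_commute\<close>)
    obtain G where G: "G holomorphic_on ball z e" "\<And>w. w \<in> ball z e - {z} \<Longrightarrow> G w = F w"
      using holomorphic_on_extend_bounded[OF hol] e(1) bd[of z] by (auto simp: interior_open)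
    have lim: "(F \<longlongrightarrow> G w) (at w)" if w: "w \<in> ball z e" for w
    proof -
      have "isCont G w"
        using holomorphic_on_imp_continuous_on[OF G(1)] w by (simp add: continuous_on_eq_continuous_at)
      then have "(G \<longlongrightarrow> G w) (at w)" by (simp add: isCont_def)
      moreover have "\<forall>\<^sub>F x in at w. x \<in> ball z e - {z}"
      proof (cases "w = z")
        case True
        have "\<forall>\<^sub>F x in at z. x \<in> ball z e" using e(1) by (intro eventually_at_in_open') auto
        moreover have "\<forall>\<^sub>F x in at z. x \<noteq> z" by (simp add: eventually_at_filter)
        ultimately show ?thesis unfolding True by eventually_elim auto
      next
        case False
        then show ?thesis using w by (intro eventually_at_in_open') auto
      qed
      then have "\<forall>\<^sub>F x in at w. G x = F x" by eventually_elim (rule G(2))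
      ultimately show ?thesis by (rule Lim_transform_eventually)
    qed
    then have gG: "g w = G w" if "w \<in> ball z e" for w
      unfolding g_def using that by (intro tendsto_Lim) auto
    have "g holomorphic_on ball z e" by (rule holomorphic_transform[OF G(1)]) (simp add: gG)
    then show ?thesis using e(1) lim gG by (intro exI[of _ e]) auto
  qed
  have lim: "(F \<longlongrightarrow> g z) (at z)" for z using loc[of z] centre_in_ball by blast
  have "g field_differentiable at z" for z
    using loc[of z] by (metis centre_in_ball holomorphic_on_imp_differentiable_at open_ball)
  then have "g holomorphic_on UNIV" by (simp add: holomorphic_on_def)
  then show thesis using lim by (rule that)
qed

text \<open>The derivative of the entire extension is doubly periodic, hence constant, so the
  extension is affine and its additive periods are proportional to 1 and \<tau>. Elliptic functions
  are the case \<open>c1 = c2 = 0\<close>.\<close>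

lemma quasi_periodic_Liouville:
  assumes \<tau>: "Im \<tau> > 0"
    and diff: "\<And>z. \<forall>\<^sub>F w in at z. F field_differentiable (at w)"
    and bd: "\<And>z. \<exists>B. \<forall>\<^sub>F w in at z. norm (F w) \<le> B"
    and per1: "\<And>z. \<forall>\<^sub>F w in at z. F (w + 1) = F w + c1"
    and per2: "\<And>z. \<forall>\<^sub>F w in at z. F (w + \<tau>) = F w + c2"
  obtains b where "c2 = c1 * \<tau>" "\<And>z. (F \<longlongrightarrow> c1 * z + b) (at z)"
proof -
  obtain g where hol: "g holomorphic_on UNIV" and lim: "\<And>z. (F \<longlongrightarrow> g z) (at z)"
    using removable_singularities_entire[OF diff bd] by blast
  have shift: "g (z + p) = g z + c" if "\<forall>\<^sub>F w in at z. F (w + p) = F w + c" for z p c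
  proof -
    have "((\<lambda>w. F (w + p)) \<longlongrightarrow> g (z + p)) (at z)" using LIM_offset[OF lim[of "z + p"], of p] by simp
    then have "((\<lambda>w. F w + c) \<longlongrightarrow> g (z + p)) (at z)" by (rule Lim_transform_eventually) (rule that)
    moreover have "((\<lambda>w. F w + c) \<longlongrightarrow> g z + c) (at z)" by (intro tendsto_intros lim)
    ultimately show ?thesis by (rule tendsto_unique[rotated]) simp
  qed
  note s1 = shift[OF per1] and s2 = shift[OF per2]
  have der: "(g has_field_derivative deriv g z) (at z)" for z
    using hol by (metis UNIV_I holomorphic_derivI open_UNIV)
  have "deriv g constant_on UNIV"
  proof (rule doubly_periodic_entire_constant[OF _ \<tau>])
    show "deriv g holomorphic_on UNIV" by (intro holomorphic_deriv hol) auto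
    show "deriv g (z + 1) = deriv g z" for z by (rule deriv_shift[OF der der]) (simp add: s1)
    show "deriv g (z + \<tau>) = deriv g z" for z by (rule deriv_shift[OF der der]) (simp add: s2)
  qed
  then obtain c where c: "\<And>z. deriv g z = c" by (auto simp: constant_on_def)
  have "((\<lambda>w. g w - c * w) has_field_derivative 0) (at z within UNIV)" for z
    using der[of z] by (auto simp: c intro!: derivative_eq_intros)
  then obtain b where "\<forall>z\<in>UNIV. g z - c * z = b"
    using has_field_derivative_zero_constant[of UNIV "\<lambda>w. g w - c * w"] by auto
  then have g: "g z = c * z + b" for z by (simp add: algebra_simps)
  have "c1 = c" "c2 = c * \<tau>" using s1[of 0] s2[of 0] by (simp_all add: g)
  then show thesis using lim g by (intro that[of b]) auto
qed

context
  fixes \<tau> :: complex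
  assumes \<tau>: "Im \<tau> > 0"
begin

lemma origin_limit_at_0: "origin_limit (at 0) (\<lambda>w. w) (\<lambda>_. \<tau>) \<tau>"
  by unfold_locales (use \<tau> in \<open>auto simp: eventually_at_filter\<close>)

lemma eventually_at_notin_lattice: "\<forall>\<^sub>F w in at z. w \<notin> lattice \<tau>"
proof (cases "z \<in> lattice \<tau>")
  case True
  have "origin_limit (at z) (\<lambda>w. w - z) (\<lambda>_. \<tau>) \<tau>"
    by unfold_locales (use \<tau> in \<open>auto simp: eventually_at_filter intro!: tendsto_eq_intros\<close>)
  from origin_limit.eventually_notin[OF this] show ?thesis
  proof eventually_elim
    case (elim w)
    then show ?case using lattice_add[of "w" \<tau> "- z"] True by auto
  qed
next
  case False
  then show ?thesis using eventually_notin_lattice_nhds[OF False \<tau>] by (simp add: eventually_nhds_conv_at)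
qed

lemma wp_lattice: "z \<notin> lattice \<tau> \<Longrightarrow> wp (z + lattice_pt \<tau> k) \<tau> = wp z \<tau>"
  using lattice_translate[of "\<lambda>z. z \<notin> lattice \<tau>" "\<lambda>z. wp z \<tau>" 0 \<tau> 0 z k] wp_periodic[OF \<tau>]
  by (simp add: lattice_add_iff)

lemma wp'_lattice: "z \<notin> lattice \<tau> \<Longrightarrow> wp' (z + lattice_pt \<tau> k) \<tau> = wp' z \<tau>"
  using lattice_translate[of "\<lambda>z. z \<notin> lattice \<tau>" "\<lambda>z. wp' z \<tau>" 0 \<tau> 0 z k] wp'_periodic[OF \<tau>]
  by (simp add: lattice_add_iff)

lemma wp_field_differentiable: "z \<notin> lattice \<tau> \<Longrightarrow> (\<lambda>z. wp z \<tau>) field_differentiable (at z)"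
  using wp_has_field_derivative[OF _ \<tau>] by (auto simp: field_differentiable_def)

lemma wzeta_field_differentiable: "z \<notin> lattice \<tau> \<Longrightarrow> (\<lambda>z. wzeta z \<tau>) field_differentiable (at z)"
  using wzeta_has_field_derivative[OF _ \<tau>] by (auto simp: field_differentiable_def)

lemma eventually_bounded_if_cont: "isCont F z \<Longrightarrow> \<exists>B. \<forall>\<^sub>F w in at z. norm (F w) \<le> B"
  for F :: "complex \<Rightarrow> complex"
proof -
  assume "isCont F z"
  then have "((\<lambda>w. norm (F w)) \<longlongrightarrow> norm (F z)) (at z)" unfolding isCont_def by (intro tendsto_intros)
  from order_tendstoD(2)[OF this, of "norm (F z) + 1"]
  show ?thesis by (auto elim!: eventually_mono intro: less_imp_le)
qed

lemma eventually_bounded_lattice: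
  assumes per: "\<And>z. z \<notin> lattice \<tau> \<Longrightarrow> F (z + 1) = F z + c1" "\<And>z. z \<notin> lattice \<tau> \<Longrightarrow> F (z + \<tau>) = F z + c2"
    and 0: "(F \<longlongrightarrow> l) (at 0)" and z: "z \<in> lattice \<tau>"
  shows "\<exists>B. \<forall>\<^sub>F w in at z. norm (F w :: complex) \<le> B"
proof -
  obtain k where k: "z = lattice_pt \<tau> k" using z by (auto simp: lattice_eq_range)
  define c where "c = of_int (fst k) * c1 + of_int (snd k) * c2"
  have t: "F (w + z) = F w + c" if "w \<notin> lattice \<tau>" for w
    unfolding k c_def using lattice_translate[of "\<lambda>z. z \<notin> lattice \<tau>" F c1 \<tau> c2 w k] per that
    by (simp add: lattice_add_iff)
  have "\<forall>\<^sub>F w in at 0. norm (F w + c) < norm (l + c) + 1"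
    by (rule order_tendstoD(2)[OF tendsto_norm[OF tendsto_add[OF 0 tendsto_const]]]) simp
  with eventually_at_notin_lattice[of 0] have "\<forall>\<^sub>F w in at 0. norm (F (w + z)) \<le> norm (l + c) + 1"
    by eventually_elim (simp add: t)
  then show ?thesis by (subst at_to_0) (auto simp: eventually_filtermap)
qed

lemma eventually_periodic:
  assumes "\<And>z. z \<notin> lattice \<tau> \<Longrightarrow> F (z + p) = F z + c"
  shows "\<forall>\<^sub>F w in at z. F (w + p) = F w + c"
  using eventually_at_notin_lattice by eventually_elim (rule assms)

text \<open>\<wp>'^2 - 4 \<wp>^3 + g2 \<wp> is elliptic with a finite limit at the origin, hence
  constant. Its value is kept existential: only its constancy matters.\<close>

lemma wp_ode:
  obtains g3 where "\<And>z. z \<notin> lattice \<tau> \<Longrightarrow> (wp' z \<tau>)\<^sup>2 = 4 * wp z \<tau> ^ 3 - g2 \<tau> * wp z \<tau> - g3"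
proof -
  let ?F = "\<lambda>z. (wp' z \<tau>)\<^sup>2 - 4 * wp z \<tau> ^ 3 + g2 \<tau> * wp z \<tau>"
  interpret origin_limit "at 0" "\<lambda>w. w" "\<lambda>_. \<tau>" \<tau> by (rule origin_limit_at_0)
  define a b d where "a w = lattice_sum wp_rest w \<tau>"
    and "b w = lattice_sum wp'_rest w \<tau>" and "d w = lattice_sum ode_rest w \<tau>" for w
  have F: "?F w = d w + w\<^sup>2 * (b w)\<^sup>2 - 12 * w\<^sup>2 * (a w)\<^sup>2 - 4 * w ^ 6 * a w ^ 3 + g2 \<tau> * w\<^sup>2 * a w"
    if w: "w \<notin> lattice \<tau>" for w
  proof -
    have w0: "w \<noteq> 0" using w by auto
    have "w\<^sup>2 * d w = - 4 * b w - 12 * a w + g2 \<tau>"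
      using ode_rest_eq[OF \<tau> w] unfolding a_def b_def d_def by simp
    then have d: "d w = (- 4 * b w - 12 * a w + g2 \<tau>) / w\<^sup>2" using w0 by (simp add: field_simps)
    show ?thesis unfolding wp_expand[OF \<tau> w] wp'_expand[OF \<tau> w] a_def[symmetric] b_def[symmetric] d
      using w0 by (simp add: field_simps power2_eq_square power3_eq_cube eval_nat_numeral)
  qed
  have lim: "((\<lambda>w. d w + w\<^sup>2 * (b w)\<^sup>2 - 12 * w\<^sup>2 * (a w)\<^sup>2 - 4 * w ^ 6 * a w ^ 3 + g2 \<tau> * w\<^sup>2 * a w) \<longlongrightarrow> d 0) (at 0)"
    using tendsto_wp_rest tendsto_wp'_rest tendsto_ode_rest
    by (auto simp: a_def b_def d_def intro!: tendsto_eq_intros)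
  have lim0: "(?F \<longlongrightarrow> d 0) (at 0)"
    by (rule Lim_transform_eventually[OF lim]) (use eventually_at_notin_lattice in \<open>eventually_elim, simp add: F\<close>)
  have per: "?F (z + 1) = ?F z + 0" "?F (z + \<tau>) = ?F z + 0" if "z \<notin> lattice \<tau>" for z
    using that by (simp_all add: wp_periodic[OF \<tau>] wp'_periodic[OF \<tau>])
  have diff: "?F field_differentiable (at z)" if "z \<notin> lattice \<tau>" for z
    using that by (intro derivative_intros field_differentiable_power wp_field_differentiable wp'_field_differentiable \<tau>)
  have bd: "\<exists>B. \<forall>\<^sub>F w in at z. norm (?F w) \<le> B" for z
  proof (cases "z \<in> lattice \<tau>")
    case True
    show ?thesis by (rule eventually_bounded_lattice[OF per lim0 True])
  next
    case False
    show ?thesis by (intro eventually_bounded_if_cont field_differentiable_imp_continuous_at diff False)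
  qed
  have diff': "\<forall>\<^sub>F w in at z. ?F field_differentiable (at w)" for z
    using eventually_at_notin_lattice by eventually_elim (rule diff)
  obtain c where c: "\<And>z. (?F \<longlongrightarrow> 0 * z + c) (at z)"
    by (rule quasi_periodic_Liouville[where F = ?F and ?c1.0 = 0 and ?c2.0 = 0, OF \<tau> diff' bd])
       ((rule eventually_periodic[where F = ?F], erule per)+, blast)
  show thesis
  proof (rule that[of "- c"])
    fix z assume z: "z \<notin> lattice \<tau>"
    have "(?F \<longlongrightarrow> ?F z) (at z)"
      using field_differentiable_imp_continuous_at[OF diff[OF z]] by (simp add: isCont_def)
    then have "?F z = 0 * z + c" using c by (rule tendsto_unique[rotated]) simp
    then show "(wp' z \<tau>)\<^sup>2 = 4 * wp z \<tau> ^ 3 - g2 \<tau> * wp z \<tau> - - c" by (simp add: algebra_simps)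
  qed
qed

lemma wp_sq_tendsto: "((\<lambda>w. w\<^sup>2 * wp w \<tau>) \<longlongrightarrow> 1) (at 0)"
proof -
  interpret origin_limit "at 0" "\<lambda>w. w" "\<lambda>_. \<tau>" \<tau> by (rule origin_limit_at_0)
  have "((\<lambda>w. 1 + w ^ 4 * (lattice_sum wp_rest w \<tau>)) \<longlongrightarrow> 1) (at 0)"
    using tendsto_wp_rest by (auto intro!: tendsto_eq_intros)
  moreover have "\<forall>\<^sub>F w in at 0. 1 + w ^ 4 * (lattice_sum wp_rest w \<tau>) = w\<^sup>2 * wp w \<tau>"
    using eventually_at_notin_lattice
  proof eventually_elim
    case (elim w)
    then have "w \<noteq> 0" by auto
    then show ?case using wp_expand[OF \<tau> elim] by (simp add: field_simps eval_nat_numeral)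
  qed
  ultimately show ?thesis by (rule Lim_transform_eventually)
qed

text \<open>An accumulation of values \<open>c\<close> off the lattice would make \<wp> constant on
  the connected complement of the lattice, against the double pole at 0. At lattice points the pole
  itself excludes it.\<close>

lemma eventually_wp_ne: "\<forall>\<^sub>F w in at z. wp w \<tau> \<noteq> c"
proof -
  have at_0: "\<forall>\<^sub>F w in at 0. wp w \<tau> \<noteq> c"
  proof -
    have "((\<lambda>w. w\<^sup>2 * wp w \<tau> - w\<^sup>2 * c) \<longlongrightarrow> 1 - 0\<^sup>2 * c) (at 0)"
      by (intro tendsto_intros wp_sq_tendsto)
    then have "\<forall>\<^sub>F w in at 0. w\<^sup>2 * wp w \<tau> - w\<^sup>2 * c \<noteq> 0" by (rule tendsto_imp_eventually_ne) simp
    then show ?thesis by eventually_elim auto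
  qed
  show ?thesis
  proof (cases "z \<in> lattice \<tau>")
    case True
    then obtain k where k: "z = lattice_pt \<tau> k" by (auto simp: lattice_eq_range)
    have "\<forall>\<^sub>F w in at 0. wp (w + z) \<tau> \<noteq> c"
      using at_0 eventually_at_notin_lattice unfolding k by eventually_elim (simp add: wp_lattice)
    then show ?thesis by (subst at_to_0) (auto simp: eventually_filtermap)
  next
    case False
    show ?thesis
    proof (rule ccontr)
      assume "\<not> (\<forall>\<^sub>F w in at z. wp w \<tau> \<noteq> c)"
      then have "\<exists>\<^sub>F w in at z. wp w \<tau> - c = 0 \<and> w \<notin> lattice \<tau>"
        using frequently_eventually_frequently[OF _ eventually_at_notin_lattice, of "\<lambda>w. wp w \<tau> - c = 0" z]
        by (simp add: frequently_def)
      then have lp: "z islimpt {w \<in> - lattice \<tau>. wp w \<tau> - c = 0}"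
        unfolding islimpt_conv_frequently_at by (auto elim: frequently_elim1)
      have hol: "(\<lambda>w. wp w \<tau> - c) holomorphic_on - lattice \<tau>"
        by (rule field_differentiable_imp_holomorphic_on) (auto intro!: derivative_intros wp_field_differentiable)
      have "connected (UNIV - lattice \<tau>)"
        by (rule connected_open_diff_countable) (auto simp: countable_lattice)
      then have conn: "connected (- lattice \<tau>)" by (simp add: Compl_eq_Diff_UNIV)
      have const: "wp w \<tau> = c" if "w \<notin> lattice \<tau>" for w
        using analytic_continuation[OF hol _ conn _ _ lp, of w] closed_lattice[OF \<tau>] that False by auto
      have "\<forall>\<^sub>F w in at (0::complex). False"
        using at_0 eventually_at_notin_lattice by eventually_elim (use const in auto)
      then show False by simp
    qed
  qed
qed

text \<open>The hypotheses make the cubic (x + u) (2 x - u)^2, so the square of \<open>f\<close> =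
  \<wp>' / (2 \<wp> - u) is \<wp> + u. This bounds \<open>f\<close> near every point off the
  lattice, including zeros of its denominator. At 0 it behaves like - 1 / z and cancels the pole of
  \<zeta>.\<close>

lemma wp_discriminant_nonzero:
  assumes "g2 \<tau> = 3 * u\<^sup>2"
    and ode: "\<And>z. z \<notin> lattice \<tau> \<Longrightarrow> (wp' z \<tau>)\<^sup>2 = 4 * wp z \<tau> ^ 3 - g2 \<tau> * wp z \<tau> + u ^ 3"
  shows False
proof -
  define f where "f z = wp' z \<tau> / (2 * wp z \<tau> - u)" for z
  let ?F = "\<lambda>z. f z + wzeta z \<tau>"
  interpret origin_limit "at 0" "\<lambda>w. w" "\<lambda>_. \<tau>" \<tau> by (rule origin_limit_at_0)
  have per: "?F (z + 1) = ?F z + eta1 \<tau>" "?F (z + \<tau>) = ?F z + eta2 \<tau>" if "z \<notin> lattice \<tau>" for z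
    using that by (simp_all add: f_def wp_periodic[OF \<tau>] wp'_periodic[OF \<tau>] wzeta_plus_1[OF \<tau>] wzeta_plus_tau[OF \<tau>])
  have f2: "norm (f z) ^ 2 \<le> norm (wp z \<tau> + u)" if "z \<notin> lattice \<tau>" for z
  proof (cases "2 * wp z \<tau> - u = 0")
    case False
    have "(wp' z \<tau>)\<^sup>2 = (wp z \<tau> + u) * (2 * wp z \<tau> - u)\<^sup>2"
      unfolding ode[OF that] assms(1) by (simp add: power2_eq_square power3_eq_cube algebra_simps)
    then have "(f z)\<^sup>2 = wp z \<tau> + u" using False by (simp add: f_def power_divide)
    then show ?thesis by (metis norm_power order_refl)
  qed (simp add: f_def)
  have ne: "\<forall>\<^sub>F w in at z. 2 * wp w \<tau> - u \<noteq> 0" for z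
    using eventually_wp_ne[of "u / 2" z] by eventually_elim auto
  have diff: "\<forall>\<^sub>F w in at z. ?F field_differentiable (at w)" for z
    using eventually_at_notin_lattice ne
  proof eventually_elim
    case (elim w)
    then show ?case unfolding f_def
      by (intro derivative_intros wp_field_differentiable wp'_field_differentiable wzeta_field_differentiable \<tau>)
  qed
  define a b c where "a w = lattice_sum wp_rest w \<tau>"
    and "b w = lattice_sum wp'_rest w \<tau>" and "c w = lattice_sum zeta_rest w \<tau>" for w
  let ?D = "\<lambda>w. 2 + 2 * w ^ 4 * a w - u * w\<^sup>2"
  have "(?D \<longlongrightarrow> 2) (at 0)" using tendsto_wp_rest by (auto simp: a_def intro!: tendsto_eq_intros)
  then have Dne: "\<forall>\<^sub>F w in at 0. ?D w \<noteq> 0" by (rule tendsto_imp_eventually_ne) simp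
  have lim: "((\<lambda>w. w * (w\<^sup>2 * b w + 2 * w\<^sup>2 * a w - u) / ?D w + w\<^sup>2 * c w) \<longlongrightarrow> 0) (at 0)"
    using tendsto_wp_rest tendsto_wp'_rest tendsto_zeta_rest
    by (auto simp: a_def b_def c_def intro!: tendsto_eq_intros)
  have lim0: "(?F \<longlongrightarrow> 0) (at 0)"
  proof (rule Lim_transform_eventually[OF lim])
    show "\<forall>\<^sub>F w in at 0. w * (w\<^sup>2 * b w + 2 * w\<^sup>2 * a w - u) / ?D w + w\<^sup>2 * c w = ?F w"
      using eventually_at_notin_lattice Dne
    proof eventually_elim
      case (elim w)
      have w0: "w \<noteq> 0" using elim by auto
      have e1: "2 * wp w \<tau> - u = ?D w / w\<^sup>2"
        unfolding wp_expand[OF \<tau> elim(1)] a_def[symmetric] using w0 by (simp add: field_simps eval_nat_numeral)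
      have e2: "wp' w \<tau> = (- 2 + w ^ 4 * b w) / w ^ 3"
        unfolding wp'_expand[OF \<tau> elim(1)] b_def[symmetric] using w0 by (simp add: field_simps eval_nat_numeral)
      have "(x / w ^ 3) / (y / w\<^sup>2) = x / (w * y)" for x y
        using w0 by (simp add: power2_eq_square power3_eq_cube)
      then have f: "f w = (- 2 + w ^ 4 * b w) / (w * ?D w)"
        unfolding f_def e1 e2 .
      have z: "wzeta w \<tau> = ?D w / (w * ?D w) + w\<^sup>2 * c w"
        unfolding wzeta_expand[OF \<tau> elim(1)] c_def[symmetric] using elim(2) by simp
      have "f w + ?D w / (w * ?D w) = (w * w * (w\<^sup>2 * b w + 2 * w\<^sup>2 * a w - u)) / (w * ?D w)"
        unfolding f add_divide_distrib[symmetric]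
        by (intro arg_cong2[where f = "(/)"]) (simp_all add: algebra_simps eval_nat_numeral)
      also have "\<dots> = w * (w\<^sup>2 * b w + 2 * w\<^sup>2 * a w - u) / ?D w" using w0 by (simp only: mult.assoc) simp
      finally show ?case unfolding z by (simp only: add.assoc[symmetric])
    qed
  qed
  have bd: "\<exists>B. \<forall>\<^sub>F w in at z. norm (?F w) \<le> B" for z
  proof (cases "z \<in> lattice \<tau>")
    case True
    show ?thesis by (rule eventually_bounded_lattice[OF per lim0 True])
  next
    case False
    have c1: "isCont (\<lambda>z. wp z \<tau> + u) z" "isCont (\<lambda>z. wzeta z \<tau>) z"
      using False by (auto intro!: field_differentiable_imp_continuous_at derivative_intros wp_field_differentiable wzeta_field_differentiable)
    obtain B1 where B1: "\<forall>\<^sub>F w in at z. norm (wp w \<tau> + u) \<le> B1" using eventually_bounded_if_cont[OF c1(1)] by blast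
    obtain B2 where B2: "\<forall>\<^sub>F w in at z. norm (wzeta w \<tau>) \<le> B2" using eventually_bounded_if_cont[OF c1(2)] by blast
    have "\<forall>\<^sub>F w in at z. norm (?F w) \<le> (1 + B1) + B2"
      using B1 B2 eventually_at_notin_lattice
    proof eventually_elim
      case (elim w)
      \<comment> \<open>A bound on |f|^2 gives one on |f| without a square root, via 2 x \<le> 1 +
        x^2.\<close>
      have "2 * norm (f w) \<le> 1 + norm (f w) ^ 2" using sum_squares_bound[of "norm (f w)" 1] by simp
      then have "norm (f w) \<le> 1 + B1" using f2[OF elim(3)] elim(1) norm_ge_zero[of "f w"] by linarith
      then show ?case using norm_triangle_ineq[of "f w" "wzeta w \<tau>"] elim(2) by linarith
    qed
    then show ?thesis by blast
  qed
  have "eta2 \<tau> = eta1 \<tau> * \<tau>"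
    by (rule quasi_periodic_Liouville[where F = ?F and ?c1.0 = "eta1 \<tau>" and ?c2.0 = "eta2 \<tau>", OF \<tau> diff bd])
       (rule eventually_periodic[where F = ?F], erule per)+
  then show False using legendre[OF \<tau>] by simp
qed

lemma wp_second_order:
  assumes a: "a \<notin> lattice \<tau>" and "wp' a \<tau> = 0"
  obtains l where "((\<lambda>v. (wp (a + v) \<tau> - wp a \<tau>) / v\<^sup>2) \<longlongrightarrow> l) (at 0)"
proof -
  define g where "g z = wp z \<tau> - wp a \<tau>" for z
  let ?S = "- lattice \<tau>"
  have op: "open ?S" using closed_lattice[OF \<tau>] by auto
  have hol: "g holomorphic_on ?S" unfolding g_def
    by (rule field_differentiable_imp_holomorphic_on) (auto intro!: derivative_intros wp_field_differentiable)
  have dg: "deriv g a = 0" unfolding g_def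
    using wp_has_field_derivative[OF a \<tau>] assms(2) by (auto intro!: DERIV_imp_deriv derivative_eq_intros)
  \<comment> \<open>The value 0 at \<open>a\<close> is the derivative of \<open>g\<close> there, so
    \<open>f\<close> is the holomorphic extension of the difference quotient; its own derivative at
    \<open>a\<close> is the second-order limit.\<close>
  define f where "f z = (if z = a then 0 else g z / (z - a))" for z
  have "f holomorphic_on ?S"
    by (rule pole_theorem_open_0[OF hol op, of a]) (auto simp: f_def dg g_def)
  then have "f field_differentiable (at a)" using op a by (simp add: holomorphic_on_imp_differentiable_at)
  then obtain l where "(f has_field_derivative l) (at a)" by (auto simp: field_differentiable_def)
  then have "((\<lambda>h. (f (a + h) - f a) / h) \<longlongrightarrow> l) (at 0)" by (simp add: DERIV_def)
  then have "((\<lambda>v. (wp (a + v) \<tau> - wp a \<tau>) / v\<^sup>2) \<longlongrightarrow> l) (at 0)"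
    by (rule Lim_transform_eventually) (auto simp: f_def g_def power2_eq_square eventually_at_filter)
  then show thesis by (rule that)
qed

text \<open>If \<open>2 a\<close> is not a period, the double zeros of \<open>\<wp>(z) - \<wp>(a)\<close> at \<open>\<plusminus> a\<close> cancel the double poles of
  \<open>\<wp>(z - a)\<close>, and vice versa, so that \<open>(\<wp>(z) - \<wp>(a)) (\<wp>(z - a) - \<wp>(a))\<close> is constant.\<close>

lemma wp'_zero_half_period:
  assumes a: "a \<notin> lattice \<tau>" and "wp' a \<tau> = 0"
  shows "2 * a \<in> lattice \<tau>"
proof (rule ccontr)
  assume a2: "2 * a \<notin> lattice \<tau>"
  define e where "e = wp a \<tau>"
  let ?F = "\<lambda>z. (wp z \<tau> - e) * (wp (z - a) \<tau> - e)"
  have na: "\<forall>\<^sub>F w in at z. w - a \<notin> lattice \<tau>" for z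
    using eventually_at_notin_lattice[of "z - a"] unfolding filtermap_at_shift[symmetric] eventually_filtermap .
  have diff0: "?F field_differentiable (at w)" if "w \<notin> lattice \<tau>" "w - a \<notin> lattice \<tau>" for w
  proof -
    have "(\<lambda>z. wp (z - a) \<tau>) field_differentiable at w"
      using field_differentiable_compose[OF field_differentiable_diff[OF field_differentiable_ident field_differentiable_const],
          of "\<lambda>z. wp z \<tau>" w a] wp_field_differentiable[OF that(2)] by (simp add: o_def)
    then show ?thesis using that by (intro derivative_intros wp_field_differentiable)
  qed
  have diff: "\<forall>\<^sub>F w in at z. ?F field_differentiable (at w)" for z
    using eventually_at_notin_lattice na by eventually_elim (rule diff0)
  have per: "\<forall>\<^sub>F w in at z. ?F (w + 1) = ?F w + 0" "\<forall>\<^sub>F w in at z. ?F (w + \<tau>) = ?F w + 0" for z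
  proof -
    show "\<forall>\<^sub>F w in at z. ?F (w + 1) = ?F w + 0"
      using eventually_at_notin_lattice na
    proof eventually_elim
      case (elim w)
      have "w + 1 - a = (w - a) + 1" by simp
      then show ?case by (simp only: wp_periodic[OF \<tau> elim(1)] wp_periodic[OF \<tau> elim(2)]) simp
    qed
    show "\<forall>\<^sub>F w in at z. ?F (w + \<tau>) = ?F w + 0"
      using eventually_at_notin_lattice na
    proof eventually_elim
      case (elim w)
      have "w + \<tau> - a = (w - a) + \<tau>" by simp
      then show ?case by (simp only: wp_periodic[OF \<tau> elim(1)] wp_periodic[OF \<tau> elim(2)]) simp
    qed
  qed
  have near: "\<exists>B. \<forall>\<^sub>F v in at 0. norm ((wp v \<tau> - e) * (wp (a' + v) \<tau> - e)) \<le> B"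
    if a': "a' \<notin> lattice \<tau>" "wp' a' \<tau> = 0" "wp a' \<tau> = e" for a'
  proof -
    obtain l where l: "((\<lambda>v. (wp (a' + v) \<tau> - wp a' \<tau>) / v\<^sup>2) \<longlongrightarrow> l) (at 0)"
      by (rule wp_second_order[OF a'(1,2)])
    have "((\<lambda>v. (v\<^sup>2 * wp v \<tau> - v\<^sup>2 * e) * ((wp (a' + v) \<tau> - wp a' \<tau>) / v\<^sup>2)) \<longlongrightarrow> (1 - 0\<^sup>2 * e) * l) (at 0)"
      by (intro tendsto_intros l wp_sq_tendsto)
    then have "\<forall>\<^sub>F v in at 0. norm ((v\<^sup>2 * wp v \<tau> - v\<^sup>2 * e) * ((wp (a' + v) \<tau> - wp a' \<tau>) / v\<^sup>2)) < norm ((1 - 0\<^sup>2 * e) * l) + 1"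
      by (intro order_tendstoD(2)[OF tendsto_norm]) auto
    moreover have "\<forall>\<^sub>F v in at (0::complex). v \<noteq> 0" by (simp add: eventually_at_filter)
    ultimately have "\<forall>\<^sub>F v in at 0. norm ((wp v \<tau> - e) * (wp (a' + v) \<tau> - e)) \<le> norm ((1 - 0\<^sup>2 * e) * l) + 1"
    proof eventually_elim
      case (elim v)
      have "(v\<^sup>2 * wp v \<tau> - v\<^sup>2 * e) * ((wp (a' + v) \<tau> - wp a' \<tau>) / v\<^sup>2) = (wp v \<tau> - e) * (wp (a' + v) \<tau> - e)"
        using elim(2) a'(3) by (simp add: field_simps)
      then show ?case using elim(1) by simp
    qed
    then show ?thesis by blast
  qed
  have bd: "\<exists>B. \<forall>\<^sub>F w in at z. norm (?F w) \<le> B" for z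
  proof -
    consider "z \<in> lattice \<tau>" | "z - a \<in> lattice \<tau>" | "z \<notin> lattice \<tau>" "z - a \<notin> lattice \<tau>" by blast
    then show ?thesis
    proof cases
      case 1
      then obtain k where k: "z = lattice_pt \<tau> k" by (auto simp: lattice_eq_range)
      obtain B where "\<forall>\<^sub>F v in at 0. norm ((wp v \<tau> - e) * (wp (- a + v) \<tau> - e)) \<le> B"
        using near[of "- a"] a assms(2) by (auto simp: e_def wp_minus[OF \<tau>] wp'_minus[OF \<tau>])
      with na[of 0] eventually_at_notin_lattice[of 0] have "\<forall>\<^sub>F v in at 0. norm (?F (v + z)) \<le> B"
      proof eventually_elim
        case (elim v)
        have "v + z - a = (v - a) + lattice_pt \<tau> k" "v + z = v + lattice_pt \<tau> k" by (simp_all add: k)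
        then show ?case using elim(3) by (simp only: wp_lattice[OF elim(1)] wp_lattice[OF elim(2)]) simp
      qed
      then show ?thesis by (subst at_to_0) (auto simp: eventually_filtermap)
    next
      case 2
      then obtain k where k: "z - a = lattice_pt \<tau> k" by (auto simp: lattice_eq_range)
      obtain B where "\<forall>\<^sub>F v in at 0. norm ((wp v \<tau> - e) * (wp (a + v) \<tau> - e)) \<le> B"
        using near[of a] a assms(2) by (auto simp: e_def)
      moreover have "\<forall>\<^sub>F v in at 0. v + a \<notin> lattice \<tau>"
        using eventually_at_notin_lattice[of a] by (subst (asm) at_to_0) (simp add: eventually_filtermap)
      ultimately have "\<forall>\<^sub>F v in at 0. norm (?F (v + z)) \<le> B"
        using eventually_at_notin_lattice[of 0]
      proof eventually_elim
        case (elim v)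
        have "v + z - a = v + lattice_pt \<tau> k" "v + z = (v + a) + lattice_pt \<tau> k" by (simp_all add: k[symmetric])
        then show ?case using elim(1)
          by (simp only: wp_lattice[OF elim(2)] wp_lattice[OF elim(3)]) (simp add: mult.commute add.commute)
      qed
      then show ?thesis by (subst at_to_0) (auto simp: eventually_filtermap)
    next
      case 3
      then show ?thesis by (intro eventually_bounded_if_cont field_differentiable_imp_continuous_at diff0)
    qed
  qed
  obtain c where c: "\<And>z. (?F \<longlongrightarrow> 0 * z + c) (at z)"
    by (rule quasi_periodic_Liouville[where F = ?F and ?c1.0 = 0 and ?c2.0 = 0, OF \<tau> diff bd per(1) per(2)]) blast
  have Fc: "?F z = c" if "z \<notin> lattice \<tau>" "z - a \<notin> lattice \<tau>" for z
  proof -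
    have "(?F \<longlongrightarrow> ?F z) (at z)"
      using field_differentiable_imp_continuous_at[OF diff0[OF that]] by (simp add: isCont_def)
    then show ?thesis using tendsto_unique[OF _ c[of z]] by simp
  qed
  \<comment> \<open>At z = - a the first factor vanishes because \<wp> is even, while z - a = - 2 a
    is off the lattice by assumption; so the constant is 0.\<close>
  have "- a - a = - (2 * a)" by simp
  then have "- a - a \<notin> lattice \<tau>" using a2 by (simp only: lattice_minus_iff) simp
  then have c0: "c = 0" using Fc[of "- a"] a by (simp add: e_def wp_minus[OF \<tau>])
  have "\<forall>\<^sub>F w in at 0. wp (w - a) \<tau> \<noteq> e"
    using eventually_wp_ne[where z = "0 - a" and c = e] unfolding filtermap_at_shift[symmetric] eventually_filtermap .
  with eventually_wp_ne[where z = 0 and c = e] na[of 0] eventually_at_notin_lattice[of 0]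
  have "\<forall>\<^sub>F w in at (0::complex). False"
    by eventually_elim (use Fc c0 in auto)
  then show False by simp
qed

end


section \<open>The pole at a lattice point\<close>

lemma cot_sum_lattice:
  assumes "Im \<tau> > 0"
  shows "cot_sum (z + lattice_pt \<tau> k) \<tau> = cot_sum z \<tau> - 2 * of_real pi * \<i> * of_int (snd k)"
  using lattice_translate[of "\<lambda>_. True" "\<lambda>z. cot_sum z \<tau>" 0 \<tau> "- 2 * of_real pi * \<i>" z k]
    cot_sum_plus_1 cot_sum_plus_tau[OF assms] by (simp add: mult.commute)

text \<open>\<open>cot_sum\<close> loses 2 \<pi> \<i> n under the translation, and the summand 2
  \<pi> \<i> s of Z gains the same amount.\<close>

lemma shift_rs:
  assumes \<tau>: "Im \<tau> > 0" and a: "r + s * \<tau> \<notin> lattice \<tau>"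
  shows Z2rs_shift: "Z2rs (r + of_int m) (s + of_int n) \<tau> = Z2rs r s \<tau>"
    and wp_p_shift: "wp_p (r + of_int m) (s + of_int n) \<tau> = wp_p r s \<tau>"
proof -
  have e: "r + of_int m + (s + of_int n) * \<tau> = (r + s * \<tau>) + lattice_pt \<tau> (m, n)"
    by (simp add: lattice_pt_def algebra_simps)
  have a': "r + of_int m + (s + of_int n) * \<tau> \<notin> lattice \<tau>"
    unfolding e using a by (simp add: lattice_add_iff)
  have Z: "Zrs (r + of_int m) (s + of_int n) \<tau> = Zrs r s \<tau>"
    unfolding Zrs_eq_cot_sum[OF \<tau> a] Zrs_eq_cot_sum[OF \<tau> a'] e cot_sum_lattice[OF \<tau>]
    by (simp add: ring_distribs)
  show Z2: "Z2rs (r + of_int m) (s + of_int n) \<tau> = Z2rs r s \<tau>"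
    unfolding Z2rs_def Let_def Z e wp_lattice[OF \<tau> a] wp'_lattice[OF \<tau> a] by simp
  show "wp_p (r + of_int m) (s + of_int n) \<tau> = wp_p r s \<tau>"
    unfolding wp_p_def Let_def Z2 Z e wp_lattice[OF \<tau> a] wp'_lattice[OF \<tau> a] by simp
qed

text \<open>Modulo the lattice \<alpha> equals - \<alpha>, so oddness forces \<open>cot_sum\<close>
  \<alpha> = - \<pi> \<i> n with n the \<tau>-coordinate of 2 \<alpha>. Comparison with Z = 0 gives
  2 s = n, and 2 r is then the other coordinate.\<close>

lemma Zrs_zero_half_integral:
  assumes \<tau>: "Im \<tau> > 0" and a: "r + s * \<tau> \<notin> lattice \<tau>"
    and 2: "2 * (r + s * \<tau>) \<in> lattice \<tau>" and Z: "Zrs r s \<tau> = 0"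
  shows "2 * r \<in> \<int> \<and> 2 * s \<in> \<int>"
proof -
  define \<alpha> where "\<alpha> = r + s * \<tau>"
  obtain k where k: "2 * \<alpha> = lattice_pt \<tau> k" using 2 by (auto simp: lattice_eq_range \<alpha>_def)
  have "- \<alpha> + lattice_pt \<tau> k = \<alpha>" by (simp add: k[symmetric])
  then have "cot_sum \<alpha> \<tau> = - cot_sum \<alpha> \<tau> - 2 * of_real pi * \<i> * of_int (snd k)"
    using cot_sum_lattice[OF \<tau>, of "- \<alpha>" k] unfolding cot_sum_minus by metis
  then have "cot_sum \<alpha> \<tau> + cot_sum \<alpha> \<tau> = - 2 * of_real pi * \<i> * of_int (snd k)" by algebra
  moreover have "cot_sum \<alpha> \<tau> = - 2 * of_real pi * \<i> * s"
    using Z Zrs_eq_cot_sum[OF \<tau> a] by (simp add: \<alpha>_def eq_neg_iff_add_eq_0)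
  ultimately have s: "2 * s = of_int (snd k)" by simp
  have "2 * r + 2 * s * \<tau> = of_int (fst k) + of_int (snd k) * \<tau>"
    using k by (simp add: \<alpha>_def lattice_pt_def algebra_simps)
  then have "2 * r = of_int (fst k)" unfolding s by simp
  then show ?thesis using s by (metis Ints_of_int)
qed

lemma wp_p_numerator_nonzero:
  fixes r s \<tau> :: complex
  defines "\<alpha> \<equiv> r + s * \<tau>" and "Z \<equiv> Zrs r s \<tau>"
  assumes \<tau>: "Im \<tau> > 0" and a: "\<alpha> \<notin> lattice \<tau>" and rs: "\<not> (2 * r \<in> \<int> \<and> 2 * s \<in> \<int>)" and Z2: "Z2rs r s \<tau> = 0"
  shows "3 * wp' \<alpha> \<tau> * Z\<^sup>2 + (12 * (wp \<alpha> \<tau>)\<^sup>2 - g2 \<tau>) * Z + 3 * wp \<alpha> \<tau> * wp' \<alpha> \<tau> \<noteq> 0"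
proof
  define p where "p = wp \<alpha> \<tau>"
  have p': "wp' \<alpha> \<tau> = Z ^ 3 - 3 * p * Z"
    using Z2 by (simp add: Z2rs_def Let_def Z_def \<alpha>_def p_def algebra_simps)
  assume "3 * wp' \<alpha> \<tau> * Z\<^sup>2 + (12 * (wp \<alpha> \<tau>)\<^sup>2 - g2 \<tau>) * Z + 3 * wp \<alpha> \<tau> * wp' \<alpha> \<tau> = 0"
  then have N: "Z * (3 * (Z\<^sup>2 - p)\<^sup>2 - g2 \<tau>) = 0"
    unfolding p' p_def[symmetric] by (simp add: power2_eq_square power3_eq_cube algebra_simps)
  show False
  proof (cases "Z = 0")
    case True
    then have "wp' \<alpha> \<tau> = 0" by (simp add: p')
    then have "2 * \<alpha> \<in> lattice \<tau>" by (rule wp'_zero_half_period[OF \<tau> a])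
    then show False using Zrs_zero_half_integral[OF \<tau>, of r s] a rs True by (simp add: \<alpha>_def Z_def)
  next
    case False
    \<comment> \<open>With this u, Z^2 = p + u and Z^2 - 3 p = u - 2 p, so the differential equation
      at the single point \<alpha> already determines g3 = - u^3. Together with g2 = 3 u^2 this is
      the degenerate cubic.\<close>
    define u where "u = Z\<^sup>2 - p"
    have g: "g2 \<tau> = 3 * u\<^sup>2" using N False by (simp add: u_def)
    obtain g3 where ode: "\<And>z. z \<notin> lattice \<tau> \<Longrightarrow> (wp' z \<tau>)\<^sup>2 = 4 * wp z \<tau> ^ 3 - g2 \<tau> * wp z \<tau> - g3"
      by (rule wp_ode[OF \<tau>]) blast
    have "(wp' \<alpha> \<tau>)\<^sup>2 = Z\<^sup>2 * (Z\<^sup>2 - 3 * p)\<^sup>2"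
      unfolding p' by (simp add: power2_eq_square power3_eq_cube algebra_simps)
    also have "\<dots> = (p + u) * (u - 2 * p)\<^sup>2" by (simp add: u_def algebra_simps)
    finally have "(p + u) * (u - 2 * p)\<^sup>2 = 4 * p ^ 3 - 3 * u\<^sup>2 * p - g3"
      using ode[OF a] by (simp add: g p_def)
    then have "g3 = - (u ^ 3)" by (simp add: eq_neg_iff_add_eq_0 power2_eq_square power3_eq_cube algebra_simps)
    then show False using wp_discriminant_nonzero[OF \<tau> g] ode by simp
  qed
qed

lemma eta1_isCont:
  assumes "Im \<tau> > 0" shows "isCont eta1 \<tau>"
proof -
  have "1/2 + 0 * \<tau> \<notin> lattice \<tau>" using half_notin_lattice(1)[OF assms] by simp
  from field_differentiable_imp_continuous_at[OF wzeta_tau_field_differentiable[OF this assms]]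
  have "isCont (\<lambda>t. 2 * wzeta (1/2) t) \<tau>" by (intro continuous_intros) simp
  then show ?thesis unfolding eta1_def[abs_def] .
qed

text \<open>All three conclusions use the expansions in W = r + s t, which is s (t - t0) since it
  vanishes at t0. Because s is nonzero, W is a local parameter and X has a nonzero limit.\<close>

lemma limits_at_lattice_point:
  assumes t0: "Im t0 > 0" and 0: "r + s * t0 = 0" and s: "s \<noteq> 0"
  shows Z2rs_at_lattice_point: "((\<lambda>t. Z2rs r s t * (r + s * t)) \<longlongrightarrow> 3 * (2 * of_real pi * \<i> * s)\<^sup>2) (at t0)"
    and wp_p_at_lattice_point: "filterlim (wp_p r s) at_infinity (at t0)"
    and notin_near_lattice_point: "\<forall>\<^sub>F t in at t0. Im t > 0 \<and> r + s * t \<notin> lattice t"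
proof -
  define W where "W t = r + s * t" for t
  have W: "W t = s * (t - t0)" for t using 0 by (simp add: W_def algebra_simps eq_neg_iff_add_eq_0 add.commute)
  interpret origin_limit "at t0" W "\<lambda>t. t" t0
  proof
    show "(W \<longlongrightarrow> 0) (at t0)" unfolding W by (auto intro!: tendsto_eq_intros)
    show "\<forall>\<^sub>F t in at t0. W t \<noteq> 0" using s by (simp add: W eventually_at_filter)
  qed (use t0 in auto)
  note good = eventually_Im_pos eventually_notin
  show "\<forall>\<^sub>F t in at t0. Im t > 0 \<and> r + s * t \<notin> lattice t"
    using good unfolding W_def by eventually_elim auto
  define a b c where "a t = (lattice_sum wp_rest (W t) t)"
    and "b t = (lattice_sum wp'_rest (W t) t)" and "c t = (lattice_sum zeta_rest (W t) t)" for t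
  note la = tendsto_wp_rest[folded a_def] and lb = tendsto_wp'_rest[folded b_def] and lc = tendsto_zeta_rest[folded c_def]
  define X0 where "X0 = 2 * of_real pi * \<i> * s"
  have X0: "X0 \<noteq> 0" using s by (simp add: X0_def)
  define X where "X t = (W t)\<^sup>2 * c t - eta1 t * W t + X0" for t
  have le: "(eta1 \<longlongrightarrow> eta1 t0) (at t0)" using eta1_isCont[OF t0] by (simp add: isCont_def)
  have lg: "(g2 \<longlongrightarrow> g2 t0) (at t0)"
    using field_differentiable_imp_continuous_at[OF g2_tau_field_differentiable[OF t0]] by (simp add: isCont_def)
  note lW = origin_limit.W[OF origin_limit_axioms]
  have lX: "(X \<longlongrightarrow> X0) (at t0)"
    unfolding X_def by (rule tendsto_eq_intros lW lc le refl)+ simp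
  have p: "wp (W t) t = 1 / (W t)\<^sup>2 + (W t)\<^sup>2 * a t" "wp' (W t) t = - 2 / W t ^ 3 + W t * b t"
    "Zrs r s t = 1 / W t + X t" "W t \<noteq> 0"
    if t: "Im t > 0" and w: "W t \<notin> lattice t" for t
  proof -
    show "wp (W t) t = 1 / (W t)\<^sup>2 + (W t)\<^sup>2 * a t" "wp' (W t) t = - 2 / W t ^ 3 + W t * b t"
      using wp_expand[OF that] wp'_expand[OF that] by (simp_all add: a_def b_def)
    have "Zrs r s t = wzeta (W t) t - eta1 t * W t + X0"
      using Zrs_eq_cot_sum[OF t, of r s] wzeta_cot_sum[OF t w] w by (simp add: W_def X0_def)
    then show "Zrs r s t = 1 / W t + X t"
      using wzeta_expand[OF that] by (simp add: X_def c_def)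
    show "W t \<noteq> 0" using w by auto
  qed
  \<comment> \<open>In Z^3 - 3 \<wp> Z - \<wp>' the poles of order three and two cancel (1 - 3 + 2
    and 3 X - 3 X), leaving 3 X^2 / W.\<close>
  have Z2: "Z2rs r s t * W t = 3 * X t ^ 2 + X t ^ 3 * W t - 3 * ((W t)\<^sup>2 * a t) * (1 + X t * W t) - (W t)\<^sup>2 * b t"
    if "Im t > 0" "W t \<notin> lattice t" for t
    unfolding Z2rs_def Let_def W_def[symmetric] p[OF that] using p(4)[OF that]
    by (simp add: field_simps power2_eq_square power3_eq_cube)
  have "((\<lambda>t. 3 * X t ^ 2 + X t ^ 3 * W t - 3 * ((W t)\<^sup>2 * a t) * (1 + X t * W t) - (W t)\<^sup>2 * b t) \<longlongrightarrow> 3 * X0\<^sup>2) (at t0)"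
    by (rule tendsto_eq_intros lW la lb lX refl)+ simp
  then have lZ2: "((\<lambda>t. Z2rs r s t * W t) \<longlongrightarrow> 3 * X0\<^sup>2) (at t0)"
    by (rule Lim_transform_eventually) (use good in \<open>eventually_elim, simp add: Z2\<close>)
  then show "((\<lambda>t. Z2rs r s t * (r + s * t)) \<longlongrightarrow> 3 * (2 * of_real pi * \<i> * s)\<^sup>2) (at t0)"
    by (simp only: W_def X0_def)
  \<comment> \<open>W^2 times the numerator of \<open>wp_p\<close> over the common denominator
    \<open>2 * Z2rs\<close>. The poles of order five, four and three cancel there, so 2 X^3 is the
    leading term.\<close>
  define N where "N t = 2 * X t ^ 3 + 2 * (W t * a t) * (1 + X t * W t) ^ 3 + 3 * (W t * b t) * (1 + X t * W t)\<^sup>2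
      + 6 * (2 * (W t * a t) + W t ^ 5 * (a t)\<^sup>2) * (1 + X t * W t) + W t * b t - 2 * (W t * a t)
      + W t ^ 5 * a t * b t - g2 t * W t * (1 + X t * W t)" for t
  have lN: "(N \<longlongrightarrow> 2 * X0 ^ 3) (at t0)"
    unfolding N_def by (rule tendsto_eq_intros lW la lb lX lg refl)+ simp
  have key: "2 * p * Z2' + (3 * p' * z\<^sup>2 + (12 * p\<^sup>2 - g) * z + 3 * p * p') = 2 * p * z ^ 3 + 3 * p' * z\<^sup>2 + 6 * p\<^sup>2 * z + p * p' - g * z"
    if "Z2' = z ^ 3 - 3 * p * z - p'" for p p' z g Z2' :: complex
    unfolding that by (simp add: power2_eq_square power3_eq_cube algebra_simps)
  have wpp: "wp_p r s t = (N t / (2 * (Z2rs r s t * W t))) / W t"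
    if t: "Im t > 0" "W t \<notin> lattice t" and ne: "Z2rs r s t * W t \<noteq> 0" for t
  proof -
    let ?p = "wp (W t) t" and ?q = "wp' (W t) t" and ?z = "Zrs r s t" and ?Z2 = "Z2rs r s t"
    have Z2ne: "?Z2 \<noteq> 0" using ne by auto
    have "wp_p r s t = ?p + (3 * ?q * ?z\<^sup>2 + (12 * ?p\<^sup>2 - g2 t) * ?z + 3 * ?p * ?q) / (2 * ?Z2)"
      by (simp add: wp_p_def Let_def W_def)
    also have "\<dots> = (2 * ?p * ?Z2 + (3 * ?q * ?z\<^sup>2 + (12 * ?p\<^sup>2 - g2 t) * ?z + 3 * ?p * ?q)) / (2 * ?Z2)"
      using Z2ne by (simp add: field_simps)
    also have "2 * ?p * ?Z2 + (3 * ?q * ?z\<^sup>2 + (12 * ?p\<^sup>2 - g2 t) * ?z + 3 * ?p * ?q)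
        = 2 * ?p * ?z ^ 3 + 3 * ?q * ?z\<^sup>2 + 6 * ?p\<^sup>2 * ?z + ?p * ?q - g2 t * ?z"
      by (rule key) (simp add: Z2rs_def Let_def W_def)
    also have "\<dots> = N t / (W t)\<^sup>2"
      unfolding p[OF t] N_def using p(4)[OF t]
      by (simp add: field_simps) (simp add: eval_nat_numeral algebra_simps)
    finally show ?thesis using p(4)[OF t] by (simp add: power2_eq_square)
  qed
  have ne: "\<forall>\<^sub>F t in at t0. Z2rs r s t * W t \<noteq> 0" by (rule tendsto_imp_eventually_ne[OF lZ2]) (use X0 in simp)
  have "((\<lambda>t. N t / (2 * (Z2rs r s t * W t))) \<longlongrightarrow> 2 * X0 ^ 3 / (2 * (3 * X0\<^sup>2))) (at t0)"
    by (intro tendsto_intros lN lZ2) (use X0 in simp)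
  moreover have "filterlim W (at 0) (at t0)"
    using lW W_nz by (simp add: filterlim_at)
  ultimately have "filterlim (\<lambda>t. (N t / (2 * (Z2rs r s t * W t))) / W t) at_infinity (at t0)"
    by (rule filterlim_divide_at_infinity) (use X0 in simp)
  moreover have "\<forall>\<^sub>F t in at t0. (N t / (2 * (Z2rs r s t * W t))) / W t = wp_p r s t"
    using good ne by eventually_elim (simp add: wpp)
  ultimately show "filterlim (wp_p r s) at_infinity (at t0)" by (subst (asm) filterlim_cong[OF refl refl]) 
qed

lemma Z2rs_field_differentiable:
  assumes "Im \<tau> > 0" "r + s * \<tau> \<notin> lattice \<tau>"
  shows "Zrs r s field_differentiable (at \<tau>)" "Z2rs r s field_differentiable (at \<tau>)"
proof -
  have h: "1/2 + 0 * \<tau> \<notin> lattice \<tau>" "0 + (1/2) * \<tau> \<notin> lattice \<tau>"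
    using half_notin_lattice[OF assms(1)] by simp_all
  have e1: "eta1 field_differentiable (at \<tau>)"
    using field_differentiable_mult[OF field_differentiable_const wzeta_tau_field_differentiable[OF h(1) assms(1)], of 2]
    unfolding eta1_def[abs_def] by simp
  have e2: "eta2 field_differentiable (at \<tau>)"
    using field_differentiable_mult[OF field_differentiable_const wzeta_tau_field_differentiable[OF h(2) assms(1)], of 2]
    unfolding eta2_def[abs_def] by simp
  show Z: "Zrs r s field_differentiable (at \<tau>)"
    unfolding Zrs_def[abs_def]
    by (intro derivative_intros e1 e2 wzeta_tau_field_differentiable assms)
  show "Z2rs r s field_differentiable (at \<tau>)"
    unfolding Z2rs_def[abs_def] Let_def
    by (intro derivative_intros field_differentiable_power Z wp_tau_field_differentiable wp'_tau_field_differentiable assms)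
qed


section \<open>The function \<open>Z2rs\<close> is not identically zero\<close>

lemma wzeta_minus:
  assumes "Im \<tau> > 0" "z \<notin> lattice \<tau>" shows "wzeta (- z) \<tau> = - wzeta z \<tau>"
  using wzeta_cot_sum[OF assms(1), of z] wzeta_cot_sum[OF assms(1), of "- z"] assms by (simp add: cot_sum_minus)

section \<open>Inversion of the period\<close>

lemma infsum_lattice_inversion:
  assumes "\<tau> \<noteq> 0"
  shows "(\<Sum>\<^sub>\<infinity>k. f (lattice_pt (- 1 / \<tau>) k)) = (\<Sum>\<^sub>\<infinity>k. f (lattice_pt \<tau> k / \<tau>))"
  by (rule infsum_reindex_bij_witness[of _ "\<lambda>k. (snd k, - fst k)" "\<lambda>k. (- snd k, fst k)"])
     (use assms in \<open>auto simp: lattice_pt_def field_simps\<close>)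

lemma Im_inversion: "Im \<tau> > 0 \<Longrightarrow> Im (- 1 / \<tau>) > 0"
  by (simp add: Im_divide sum_power2_gt_zero_iff)

text \<open>The lattice of - 1 / \<tau> is that of \<tau> divided by \<tau>, and the three functions
  are homogeneous of degrees - 1, - 2 and - 3.\<close>

lemma weierstrass_inversion:
  assumes \<tau>: "Im \<tau> > 0"
  shows "wzeta (z / \<tau>) (- 1 / \<tau>) = \<tau> * wzeta z \<tau>" "wp (z / \<tau>) (- 1 / \<tau>) = \<tau>\<^sup>2 * wp z \<tau>"
    "wp' (z / \<tau>) (- 1 / \<tau>) = \<tau> ^ 3 * wp' z \<tau>"
proof -
  have t: "\<tau> \<noteq> 0" using \<tau> by auto
  have d: "1 / (z / \<tau> - w / \<tau>) = \<tau> * (1 / (z - w))" "1 / (w / \<tau>) = \<tau> * (1 / w)"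
    "(z / \<tau>) / (w / \<tau>)\<^sup>2 = \<tau> * (z / w\<^sup>2)" "1 / (z / \<tau> - w / \<tau>)\<^sup>2 = \<tau>\<^sup>2 * (1 / (z - w)\<^sup>2)"
    "1 / (w / \<tau>)\<^sup>2 = \<tau>\<^sup>2 * (1 / w\<^sup>2)" "1 / (z / \<tau> - w / \<tau>) ^ 3 = \<tau> ^ 3 * (1 / (z - w) ^ 3)" for w
    using t by (simp_all add: diff_divide_distrib[symmetric] power_divide power2_eq_square)
  note inv = infsum_lattice_inversion[OF t]
  show "wzeta (z / \<tau>) (- 1 / \<tau>) = \<tau> * wzeta z \<tau>"
    unfolding wzeta_eq[OF \<tau>] wzeta_eq[OF Im_inversion[OF \<tau>]] infsum_cmult_right'[symmetric]
    by (subst inv) (simp only: d ring_distribs)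
  show "wp (z / \<tau>) (- 1 / \<tau>) = \<tau>\<^sup>2 * wp z \<tau>"
    unfolding wp_eq[OF \<tau>] wp_eq[OF Im_inversion[OF \<tau>]] infsum_cmult_right'[symmetric]
    by (subst inv) (simp only: d right_diff_distrib)
  have "(\<Sum>\<^sub>\<infinity>k. 1 / (z / \<tau> - lattice_pt (- 1 / \<tau>) k) ^ 3) = \<tau> ^ 3 * (\<Sum>\<^sub>\<infinity>k. 1 / (z - lattice_pt \<tau> k) ^ 3)"
    unfolding infsum_cmult_right'[symmetric] by (subst inv) (simp only: d)
  then show "wp' (z / \<tau>) (- 1 / \<tau>) = \<tau> ^ 3 * wp' z \<tau>"
    unfolding wp'_eq[OF \<tau>] wp'_eq[OF Im_inversion[OF \<tau>]] by simp
qed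

text \<open>Modular behaviour of weight 3: inversion exchanges the quasi-periods up to factors and
  turns (r, s) into (s, - r), so that either parameter can be brought into the position of
  s.\<close>

lemma Z2rs_inversion:
  assumes \<tau>: "Im \<tau> > 0"
  shows "Z2rs s (- r) (- 1 / \<tau>) = \<tau> ^ 3 * Z2rs r s \<tau>"
proof -
  have t: "\<tau> \<noteq> 0" using \<tau> by auto
  have a: "s + - r * (- 1 / \<tau>) = (r + s * \<tau>) / \<tau>" using t by (simp add: field_simps)
  have h: "(1/2::complex) = (\<tau> / 2) / \<tau>" "(- 1 / \<tau>) / 2 = (- (1/2)) / \<tau>" using t by simp_all
  have e1: "eta1 (- 1 / \<tau>) = \<tau> * eta2 \<tau>"
    unfolding eta1_def by (subst h(1), subst weierstrass_inversion(1)[OF \<tau>]) (simp add: eta2_def)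
  have e2: "eta2 (- 1 / \<tau>) = - \<tau> * eta1 \<tau>"
    unfolding eta2_def
    by (subst h(2), subst weierstrass_inversion(1)[OF \<tau>], subst wzeta_minus[OF \<tau> half_notin_lattice(1)[OF \<tau>]]) (simp add: eta1_def)
  have Z: "Zrs s (- r) (- 1 / \<tau>) = \<tau> * Zrs r s \<tau>"
    unfolding Zrs_def a weierstrass_inversion(1)[OF \<tau>] e1 e2 by (simp add: algebra_simps)
  show ?thesis
    unfolding Z2rs_def Let_def Z a weierstrass_inversion[OF \<tau>]
    by (simp add: algebra_simps power2_eq_square power3_eq_cube)
qed

section \<open>Limits at the cusp\<close>

text \<open>The same constant works for all y \<ge> 1, as domination along the imaginary axis
  requires.\<close>

lemma spread_imaginary:
  assumes "y \<ge> 1" shows "spread 2 (\<i> * of_real y)"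
  unfolding spread_def
proof (intro conjI allI impI)
  fix k :: "int \<times> int" assume k: "k \<noteq> 0"
  let ?w = "lattice_pt (\<i> * of_real y) k"
  have m: "real_of_int \<bar>fst k\<bar> \<le> norm ?w" using abs_Re_le_cmod[of ?w] by (simp add: lattice_pt_def)
  have "real_of_int \<bar>snd k\<bar> * 1 \<le> real_of_int \<bar>snd k\<bar> * y" using assms by (intro mult_left_mono) auto
  also have "\<dots> = \<bar>Im ?w\<bar>" using assms by (simp add: lattice_pt_def abs_mult)
  also have "\<dots> \<le> norm ?w" by (rule abs_Im_le_cmod)
  finally have n: "real_of_int \<bar>snd k\<bar> \<le> norm ?w" by simp
  have "fst k \<noteq> 0 \<or> snd k \<noteq> 0" using k by (auto simp: prod_eq_iff)
  then have "\<bar>fst k\<bar> \<ge> 1 \<or> \<bar>snd k\<bar> \<ge> 1" by linarith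
  then have "real_of_int \<bar>fst k\<bar> \<ge> 1 \<or> real_of_int \<bar>snd k\<bar> \<ge> 1" by linarith
  then have "1 \<le> norm ?w" using m n by linarith
  then show "1 + real_of_int \<bar>fst k\<bar> \<le> 2 * norm ?w" "1 + real_of_int \<bar>snd k\<bar> \<le> 2 * norm ?w"
    using m n by linarith+
qed simp

text \<open>Twice the Basel sum; the index 0 contributes \<open>1 / 0 = 0\<close>.\<close>

lemma infsum_int_inverse_square: "(\<Sum>\<^sub>\<infinity>m::int. 1 / (of_int m)\<^sup>2) = (of_real (pi\<^sup>2 / 3) :: complex)"
proof -
  have s: "((\<lambda>m::int. 1 / (of_int m)\<^sup>2 :: complex) has_sum (\<Sum>\<^sub>\<infinity>m::int. 1 / (of_int m)\<^sup>2)) UNIV"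
    using summable_on_int_shifted_inverse_square[of 0] by simp
  have sq: "(- 1 - x)\<^sup>2 = (1 + x)\<^sup>2" for x :: complex by (simp add: power2_eq_square algebra_simps)
  have e: "(\<Sum>n\<in>{- int N..int N}. 1 / (of_int n)\<^sup>2 :: complex) = of_real (2 * (\<Sum>n<N. 1 / (real n + 1)\<^sup>2))" for N
  proof (induction N)
    case (Suc N)
    have "{- int (Suc N)..int (Suc N)} = insert (- int (Suc N)) (insert (int (Suc N)) {- int N..int N})" by auto
    moreover have "1 / (of_int (- int (Suc N)))\<^sup>2 = (of_real (1 / (real N + 1)\<^sup>2) :: complex)"
      "1 / (of_int (int (Suc N)))\<^sup>2 = (of_real (1 / (real N + 1)\<^sup>2) :: complex)"
      using sq[of "of_nat N"] by (simp_all add: add.commute)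
    ultimately show ?case using Suc by (simp add: algebra_simps del: of_int_minus of_int_of_nat_eq of_nat_Suc)
  qed simp
  have "(\<lambda>N. \<Sum>n<N. 1 / (real n + 1)\<^sup>2) \<longlonglongrightarrow> pi\<^sup>2 / 6"
    using inverse_squares_sums by (simp add: sums_def add.commute)
  then have "(\<lambda>N. of_real (2 * (\<Sum>n<N. 1 / (real n + 1)\<^sup>2)) :: complex) \<longlonglongrightarrow> of_real (2 * (pi\<^sup>2 / 6))"
    by (intro tendsto_intros)
  then show ?thesis using LIMSEQ_unique[OF has_sum_int_symmetric_limit[OF s]] by (simp add: e)
qed

text \<open>Only the row of integers survives in the limit of \<zeta>(1/2). Both of its cotangents,
  at \<pi>/2 and at 0, are 0, so its sum is half of \<pi>^2 / 3, and \<eta>1 is twice this.\<close>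

lemma eta1_imaginary_limit: "((\<lambda>y. eta1 (\<i> * of_real y)) \<longlongrightarrow> of_real (pi\<^sup>2 / 3)) at_top"
proof -
  let ?t = "\<lambda>y. \<i> * complex_of_real y"
  let ?f = "\<lambda>z \<omega> :: complex. 1 / (z - \<omega>) + 1 / \<omega> + z / \<omega>\<^sup>2"
  define g where "g k = (if snd k = 0 then ?f (1/2) (of_int (fst k)) else 0)" for k :: "int \<times> int"
  have "((\<lambda>y. \<Sum>\<^sub>\<infinity>k. ?f (1/2) (lattice_pt (?t y) k)) \<longlongrightarrow> (\<Sum>\<^sub>\<infinity>k. g k)) at_top"
  proof (rule tendsto_lattice_sum[OF cubic_decay_zeta, where Z = "\<lambda>_. 1/2"])
    show "\<forall>\<^sub>F y in at_top. spread 2 (?t y)"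
      using eventually_ge_at_top[of 1] by eventually_elim (rule spread_imaginary)
    fix k :: "int \<times> int"
    show "((\<lambda>y. ?f (1/2) (lattice_pt (?t y) k)) \<longlongrightarrow> g k) at_top"
    proof (cases "snd k = 0")
      case False
      have "filterlim (\<lambda>y. of_int (snd k) * (?t y)) at_infinity at_top"
        by (rule tendsto_mult_filterlim_at_infinity[OF tendsto_const _ tendsto_mult_filterlim_at_infinity[OF tendsto_const _
              filterlim_compose[OF filterlim_of_real_at_infinity filterlim_ident]]]) (use False in auto)
      then have inf: "filterlim (\<lambda>y. lattice_pt (?t y) k) at_infinity at_top"
        unfolding lattice_pt_def by (rule tendsto_add_filterlim_at_infinity[OF tendsto_const])
      have "filterlim (\<lambda>y. - (1/2) + lattice_pt (?t y) k) at_infinity at_top"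
        by (rule tendsto_add_filterlim_at_infinity[OF tendsto_const inf])
      then have "((\<lambda>y. (- 1) / (- (1/2) + lattice_pt (?t y) k)) \<longlongrightarrow> 0) at_top"
        by (rule tendsto_divide_0[OF tendsto_const])
      moreover have "(- 1) / (- (1/2) + w) = 1 / (1/2 - w)" for w :: complex
        by (metis add.commute minus_diff_eq minus_divide_divide diff_conv_add_uminus minus_minus)
      ultimately have l1: "((\<lambda>y. 1 / (1/2 - lattice_pt (?t y) k)) \<longlongrightarrow> 0) at_top" by (simp only:)
      have l2: "((\<lambda>y. 1 / lattice_pt (?t y) k) \<longlongrightarrow> 0) at_top"
        by (rule tendsto_divide_0[OF tendsto_const inf])
      have "((\<lambda>y. 1 / (1/2 - lattice_pt (?t y) k) + 1 / lattice_pt (?t y) k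
          + 1/2 * (1 / lattice_pt (?t y) k)\<^sup>2) \<longlongrightarrow> 0 + 0 + 1/2 * 0\<^sup>2) at_top"
        by (intro tendsto_intros l1 l2)
      then show ?thesis using False by (simp add: g_def power_divide)
    qed (simp add: g_def lattice_pt_def)
  qed auto
  moreover have "(\<Sum>\<^sub>\<infinity>k. g k) = of_real (pi\<^sup>2 / 6)"
  proof -
    have "(\<Sum>\<^sub>\<infinity>k. g k) = infsum g (range (\<lambda>m. (m, 0)))"
      by (rule infsum_cong_neutral) (auto simp: g_def image_iff)
    also have "\<dots> = (\<Sum>\<^sub>\<infinity>m. ?f (1/2) (of_int m + 0))"
      by (subst infsum_reindex) (auto simp: inj_on_def o_def g_def)
    also have "\<dots> = of_real pi * cot (of_real pi * (1/2 - 0)) + of_real pi * cot (of_real pi * 0)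
        + 1/2 * (\<Sum>\<^sub>\<infinity>m::int. 1 / (of_int m + 0)\<^sup>2)"
    proof (rule infsum_row)
      show "1/2 - 0 \<notin> (\<int> :: complex set)"
        using fraction_not_in_Ints[of 2 1, where 'a = complex] by simp
      \<comment> \<open>The choice of \<i> is arbitrary: the row n = 0 consists of the integers for
        every period.\<close>
      have "(\<lambda>k. ?f (1/2) (lattice_pt \<i> k)) summable_on (range (\<lambda>m. (m, 0)))"
        by (rule summable_on_subset[OF cubic_decay_summable[OF cubic_decay_zeta]]) auto
      then show "(\<lambda>m. ?f (1/2) (of_int m + 0)) summable_on UNIV"
        by (subst (asm) summable_on_reindex) (auto simp: inj_on_def o_def lattice_pt_def)
    qed simp
    also have "cot (of_real pi * (1/2 - 0)) = (0 :: complex)"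
      by (simp add: cot_def)
    finally show ?thesis using infsum_int_inverse_square by (simp add: cot_def)
  qed
  ultimately have "((\<lambda>y. 2 * (\<Sum>\<^sub>\<infinity>k. ?f (1/2) (lattice_pt (?t y) k))) \<longlongrightarrow> 2 * of_real (pi\<^sup>2 / 6)) at_top"
    by (intro tendsto_intros) simp
  moreover have "\<forall>\<^sub>F y in at_top. 2 * (\<Sum>\<^sub>\<infinity>k. ?f (1/2) (lattice_pt (?t y) k)) = eta1 (?t y)"
    using eventually_gt_at_top[of 0] by eventually_elim (simp add: eta1_def wzeta_eq)
  ultimately have "((\<lambda>y. eta1 (?t y)) \<longlongrightarrow> 2 * of_real (pi\<^sup>2 / 6)) at_top"
    by (rule Lim_transform_eventually)
  then show ?thesis by simp
qed

text \<open>Row 0 is compared with its limit - \<pi> \<i>, every other row with 0. The lower bound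
  on Im z serves row 0, the upper bound keeps z away from the other rows.\<close>

lemma norm_cot_sum_plus_pi_i_le:
  assumes y: "y > 0" and s: "0 < c" "c \<le> 1" and z: "c * y \<le> Im z" "Im z \<le> (1 - c) * y"
  shows "norm (cot_sum z (\<i> * of_real y) + of_real pi * \<i>)
     \<le> (1 + 2 * (\<Sum>\<^sub>\<infinity>n::int. 1 / (real_of_int n)\<^sup>2)) / (c * y)\<^sup>2"
proof -
  let ?\<tau> = "\<i> * complex_of_real y" and ?S = "\<Sum>\<^sub>\<infinity>n::int. 1 / (real_of_int n)\<^sup>2"
  have \<tau>: "Im ?\<tau> > 0" using y by simp
  have cy: "c * y > 0" using s y by simp
  have single: "((\<lambda>n::int. if n = 0 then x else 0) has_sum x) UNIV" for x :: "'b :: {comm_monoid_add, topological_space}"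
    by (rule has_sum_finite_neutralI[of "{0}"]) auto
  have "((\<lambda>n. cot_row z ?\<tau> n + (if n = 0 then of_real pi * \<i> else 0)) has_sum (cot_sum z ?\<tau> + of_real pi * \<i>)) UNIV"
    unfolding cot_sum_def by (intro has_sum_add has_sum_infsum summable_cot_row \<tau> single)
  moreover have "((\<lambda>n::int. (if n = 0 then 1 / (c * y)\<^sup>2 else 0) + 2 / (c * y)\<^sup>2 * (1 / (real_of_int n)\<^sup>2))
      has_sum (1 / (c * y)\<^sup>2 + 2 / (c * y)\<^sup>2 * ?S)) UNIV"
    by (intro has_sum_add single has_sum_cmult_right has_sum_infsum summable_on_int_inverse_square)
  moreover have "norm (cot_row z ?\<tau> n + (if n = 0 then of_real pi * \<i> else 0))
     \<le> (if n = 0 then 1 / (c * y)\<^sup>2 else 0) + 2 / (c * y)\<^sup>2 * (1 / (real_of_int n)\<^sup>2)" for n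
  proof (cases "n = 0")
    case True
    have zpos: "Im z > 0" using cy z by linarith
    then have "Im (of_real pi * z) > 0" by simp
    from norm_cot_plus_i_le[OF this] have "norm (cot (of_real pi * z) + \<i>) \<le> 1 / (pi * Im z)\<^sup>2" by simp
    then have "pi * norm (cot (of_real pi * z) + \<i>) \<le> pi * (1 / (pi * Im z)\<^sup>2)" by (intro mult_left_mono) auto
    also have "\<dots> = 1 / (pi * (Im z)\<^sup>2)" by (simp add: power2_eq_square)
    also have "\<dots> \<le> 1 / (c * y)\<^sup>2"
    proof (rule frac_le)
      have "(c * y)\<^sup>2 \<le> (Im z)\<^sup>2" using z cy by (intro power_mono) auto
      also have "1 * (Im z)\<^sup>2 \<le> pi * (Im z)\<^sup>2" using pi_gt3 by (intro mult_right_mono) auto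
      finally show "(c * y)\<^sup>2 \<le> pi * (Im z)\<^sup>2" by simp
      show "(c * y)\<^sup>2 > 0" using cy by (rule zero_less_power)
    qed auto
    finally have "norm (of_real pi * (cot (of_real pi * z) + \<i>)) \<le> 1 / (c * y)\<^sup>2" by (simp only: norm_mult norm_of_real) simp
    then show ?thesis using True by (simp add: cot_row_def cot_def ring_distribs)
  next
    case False
    have "1 \<le> \<bar>n\<bar>" using False by linarith
    then have n1: "1 \<le> \<bar>real_of_int n\<bar>" by linarith
    have "\<bar>Im z\<bar> \<le> (1 - c) * (1 * y)" using z cy by simp
    also have "\<dots> \<le> (1 - c) * (\<bar>real_of_int n\<bar> * Im ?\<tau>)" using n1 s y by (intro mult_left_mono) auto
    finally show ?thesis using norm_cot_row_le[OF \<tau> False s, of z] False by simp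
  qed
  ultimately have "norm (cot_sum z ?\<tau> + of_real pi * \<i>) \<le> 1 / (c * y)\<^sup>2 + 2 / (c * y)\<^sup>2 * ?S"
    by (rule norm_infsum_le)
  also have "\<dots> = (1 + 2 * ?S) / (c * y)\<^sup>2" by (simp add: add_divide_distrib)
  finally show ?thesis .
qed

lemma cot_sum_derivatives:
  assumes \<tau>: "Im \<tau> > 0" and z: "z \<notin> lattice \<tau>"
  shows "((\<lambda>z. cot_sum z \<tau> + c) has_field_derivative - wp z \<tau> - eta1 \<tau>) (at z)"
    and "(deriv ^^ 2) (\<lambda>z. cot_sum z \<tau> + c) z = - wp' z \<tau>"
proof -
  have d: "((\<lambda>z. cot_sum z \<tau> + c) has_field_derivative - wp z \<tau> - eta1 \<tau>) (at z)" if z: "z \<notin> lattice \<tau>" for z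
  proof -
    have "((\<lambda>z. wzeta z \<tau> - eta1 \<tau> * z + c) has_field_derivative - wp z \<tau> - eta1 \<tau>) (at z)"
      using wzeta_has_field_derivative[OF z \<tau>] by (auto intro!: derivative_eq_intros)
    then show ?thesis
      by (rule has_field_derivative_transform_within_open[of _ _ _ "- lattice \<tau>"])
         (use closed_lattice[OF \<tau>] z wzeta_cot_sum[OF \<tau>] in auto)
  qed
  show "((\<lambda>z. cot_sum z \<tau> + c) has_field_derivative - wp z \<tau> - eta1 \<tau>) (at z)" by (rule d[OF z])
  have "((\<lambda>z. - wp z \<tau> - eta1 \<tau>) has_field_derivative - wp' z \<tau>) (at z)"
    using wp_has_field_derivative[OF z \<tau>] by (auto intro!: derivative_eq_intros)
  then have "(deriv (\<lambda>z. cot_sum z \<tau> + c) has_field_derivative - wp' z \<tau>) (at z)"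
    by (rule has_field_derivative_transform_within_open[of _ _ _ "- lattice \<tau>"])
       (use closed_lattice[OF \<tau>] z DERIV_imp_deriv[OF d] in auto)
  then show "(deriv ^^ 2) (\<lambda>z. cot_sum z \<tau> + c) z = - wp' z \<tau>"
    by (simp add: numeral_2_eq_2 DERIV_imp_deriv)
qed

text \<open>\<open>cot_sum\<close> is uniformly close to \<open>- \<pi> \<i>\<close> on a unit disc about \<open>\<alpha>\<close>, and \<open>- \<wp> - \<eta>\<^sub>1\<close> and \<open>- \<wp>'\<close> are its first two
  derivatives, so Cauchy's inequalities apply.\<close>

lemma cusp_limits:
  fixes r s :: real
  assumes s: "0 < s" "s < 1"
  defines "\<alpha> \<equiv> \<lambda>y. of_real r + of_real s * (\<i> * complex_of_real y)"
  shows "((\<lambda>y. cot_sum (\<alpha> y) (\<i> * of_real y)) \<longlongrightarrow> - of_real pi * \<i>) at_top"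
    and "((\<lambda>y. wp (\<alpha> y) (\<i> * of_real y) + eta1 (\<i> * of_real y)) \<longlongrightarrow> 0) at_top"
    and "((\<lambda>y. wp' (\<alpha> y) (\<i> * of_real y)) \<longlongrightarrow> 0) at_top"
    and "\<forall>\<^sub>F y in at_top. \<alpha> y \<notin> lattice (\<i> * of_real y)"
proof -
  let ?t = "\<lambda>y. \<i> * complex_of_real y"
  \<comment> \<open>Half the distance of s from 0 and 1: \<alpha> then has margin 2 c y in the
    strip, and a unit disc around it keeps margin c y once c y exceeds 1.\<close>
  define c where "c = min s (1 - s) / 2"
  have c: "0 < c" "c \<le> 1" "2 * c \<le> s" "2 * c \<le> 1 - s" using s by (auto simp: c_def)
  define C where "C = 1 + 2 * (\<Sum>\<^sub>\<infinity>n::int. 1 / (real_of_int n)\<^sup>2)"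
  have strip: "c * y \<le> Im z \<and> Im z \<le> (1 - c) * y" if y: "y > 1 / c" and z: "z \<in> cball (\<alpha> y) 1" for y z
  proof -
    have cy: "c * y > 1" using y c by (simp add: field_simps)
    have y0: "y > 0" using y c by (meson divide_pos_pos less_trans zero_less_one)
    have "\<bar>Im (\<alpha> y - z)\<bar> \<le> 1" using abs_Im_le_cmod[of "\<alpha> y - z"] z by (simp add: dist_norm)
    then have d: "\<bar>s * y - Im z\<bar> \<le> 1" by (simp add: \<alpha>_def)
    have "2 * c * y \<le> s * y" "2 * c * y \<le> (1 - s) * y" using c y0 by (intro mult_right_mono; simp)+
    then show ?thesis using d cy by (simp add: algebra_simps) linarith
  qed
  have bound: "norm (cot_sum z (?t y) + of_real pi * \<i>) \<le> C / (c * y)\<^sup>2 \<and> z \<notin> lattice (?t y)"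
    if y: "y > 1 / c" and z: "z \<in> cball (\<alpha> y) 1" for y z
  proof
    have y0: "y > 0" using y c by (meson divide_pos_pos less_trans zero_less_one)
    note st = strip[OF y z]
    show "norm (cot_sum z (?t y) + of_real pi * \<i>) \<le> C / (c * y)\<^sup>2"
      unfolding C_def using st by (intro norm_cot_sum_plus_pi_i_le y0 c) auto
    show "z \<notin> lattice (?t y)"
    proof
      assume "z \<in> lattice (?t y)"
      then obtain m n :: int where "z = of_int m + of_int n * (?t y)" by (auto simp: lattice_def)
      then have n: "Im z = real_of_int n * y" by simp
      have "c * y > 0" using c y0 by simp
      moreover have "(1 - c) * y = y - c * y" by (simp add: algebra_simps)
      ultimately have "0 < real_of_int n * y" "real_of_int n * y < 1 * y" using st n by linarith+
      then have "0 < n" "real_of_int n < 1" using y0 by (auto simp: zero_less_mult_iff mult_less_cancel_right)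
      then show False by simp
    qed
  qed
  have ev: "\<forall>\<^sub>F y in at_top. y > 1 / c" by (rule eventually_gt_at_top)
  have centre: "\<alpha> y \<in> cball (\<alpha> y) 1" for y by simp
  show "\<forall>\<^sub>F y in at_top. \<alpha> y \<notin> lattice (?t y)"
    using ev by eventually_elim (use bound centre in blast)
  have lim0: "((\<lambda>y. K * (C / (c * y)\<^sup>2)) \<longlongrightarrow> 0) at_top" for K
  proof -
    have "((\<lambda>y. C / (c * y)\<^sup>2) \<longlongrightarrow> 0) at_top"
      by (intro tendsto_divide_0[OF tendsto_const] filterlim_at_top_imp_at_infinity filterlim_pow_at_top
            filterlim_tendsto_pos_mult_at_top[OF tendsto_const c(1)] filterlim_ident) simp
    then show ?thesis by (rule tendsto_mult_right_zero)
  qed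
  have "((\<lambda>y. cot_sum (\<alpha> y) (?t y) + of_real pi * \<i>) \<longlongrightarrow> 0) at_top"
    by (rule Lim_null_comparison[OF _ lim0[of 1]]) (use ev in eventually_elim, use bound centre in auto)
  then have "((\<lambda>y. (cot_sum (\<alpha> y) (?t y) + of_real pi * \<i>) - of_real pi * \<i>) \<longlongrightarrow> 0 - of_real pi * \<i>) at_top"
    by (intro tendsto_intros)
  then show "((\<lambda>y. cot_sum (\<alpha> y) (?t y)) \<longlongrightarrow> - of_real pi * \<i>) at_top" by simp
  have cauchy: "norm ((deriv ^^ n) (\<lambda>z. cot_sum z (?t y) + of_real pi * \<i>) (\<alpha> y)) \<le> fact n * (C / (c * y)\<^sup>2) / 1 ^ n"
    if y: "y > 1 / c" for n y
  proof (rule Cauchy_inequality)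
    let ?h = "\<lambda>z. cot_sum z (?t y) + of_real pi * \<i>"
    have "Im (?t y) > 0" using y c by simp (meson divide_pos_pos less_trans zero_less_one)
    then have fd: "?h field_differentiable (at z)" if "z \<in> cball (\<alpha> y) 1" for z
      using cot_sum_derivatives(1) bound[OF y that] unfolding field_differentiable_def by blast
    show "?h holomorphic_on ball (\<alpha> y) 1"
      by (rule field_differentiable_imp_holomorphic_on) (intro fd, auto)
    show "continuous_on (cball (\<alpha> y) 1) ?h"
      by (intro continuous_at_imp_continuous_on ballI field_differentiable_imp_continuous_at fd)
    show "norm (?h x) \<le> C / (c * y)\<^sup>2" if "norm (\<alpha> y - x) = 1" for x
      using bound[OF y, of x] that by (simp add: dist_norm)
  qed simp
  have pos: "Im (?t y) > 0" if "y > 1 / c" for y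
    using that c by simp (meson divide_pos_pos less_trans zero_less_one)
  have "((\<lambda>y. - (wp (\<alpha> y) (?t y) + eta1 (?t y))) \<longlongrightarrow> - 0) at_top"
    unfolding minus_zero
  proof (rule Lim_null_comparison[OF _ lim0[of 1]])
    show "\<forall>\<^sub>F y in at_top. norm (- (wp (\<alpha> y) (?t y) + eta1 (?t y))) \<le> 1 * (C / (c * y)\<^sup>2)"
      using ev
    proof eventually_elim
      case (elim y)
      have "deriv (\<lambda>z. cot_sum z (?t y) + of_real pi * \<i>) (\<alpha> y) = - wp (\<alpha> y) (?t y) - eta1 (?t y)"
        by (rule DERIV_imp_deriv[OF cot_sum_derivatives(1)[OF pos[OF elim]]]) (use bound[OF elim centre] in auto)
      then show ?case using cauchy[OF elim, of 1] by simp
    qed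
  qed
  then show "((\<lambda>y. wp (\<alpha> y) (?t y) + eta1 (?t y)) \<longlongrightarrow> 0) at_top"
    by (rule tendsto_minus_cancel)
  have "((\<lambda>y. - wp' (\<alpha> y) (?t y)) \<longlongrightarrow> - 0) at_top"
    unfolding minus_zero
  proof (rule Lim_null_comparison[OF _ lim0[of 2]])
    show "\<forall>\<^sub>F y in at_top. norm (- wp' (\<alpha> y) (?t y)) \<le> 2 * (C / (c * y)\<^sup>2)"
      using ev
    proof eventually_elim
      case (elim y)
      have "(deriv ^^ 2) (\<lambda>z. cot_sum z (?t y) + of_real pi * \<i>) (\<alpha> y) = - wp' (\<alpha> y) (?t y)"
        by (rule cot_sum_derivatives(2)[OF pos[OF elim]]) (use bound[OF elim centre] in auto)
      then show ?case using cauchy[OF elim, of 2] by (simp only: fact_2 power_one div_by_1)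
    qed
  qed
  then show "((\<lambda>y. wp' (\<alpha> y) (?t y)) \<longlongrightarrow> 0) at_top" by (rule tendsto_minus_cancel)
qed

text \<open>In the limit \<wp> is - \<pi>^2 / 3, \<wp>' is 0 and Z is \<open>Z0\<close> = \<pi> \<i>
  (2 s - 1). So \<open>Z2rs\<close> tends to Z0 (Z0^2 + \<pi>^2) = 4 \<pi>^2 s (1 - s) Z0, whose
  zeros 0, 1/2 and 1 are the excluded values of s.\<close>

lemma Z2rs_nonzero_real_generic:
  fixes r s :: real
  assumes s: "0 < s" "s < 1" "s \<noteq> 1/2"
  shows "\<exists>\<tau>. Im \<tau> > 0 \<and> of_real r + of_real s * \<tau> \<notin> lattice \<tau> \<and> Z2rs (of_real r) (of_real s) \<tau> \<noteq> 0"
proof -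
  define \<alpha> where "\<alpha> y = of_real r + of_real s * (\<i> * complex_of_real y)" for y
  let ?\<tau> = "\<lambda>y. \<i> * complex_of_real y"
  define Z0 where "Z0 = - of_real pi * \<i> + 2 * of_real pi * \<i> * of_real s"
  note lim = cusp_limits[OF s(1,2), of r, folded \<alpha>_def]
  have "((\<lambda>y. wp (\<alpha> y) (?\<tau> y) + eta1 (?\<tau> y) - eta1 (?\<tau> y)) \<longlongrightarrow> 0 - of_real (pi\<^sup>2 / 3)) at_top"
    by (intro tendsto_diff lim eta1_imaginary_limit)
  then have lp: "((\<lambda>y. wp (\<alpha> y) (?\<tau> y)) \<longlongrightarrow> - of_real (pi\<^sup>2 / 3)) at_top" by simp
  let ?Z = "\<lambda>y. cot_sum (\<alpha> y) (?\<tau> y) + 2 * of_real pi * \<i> * of_real s"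
  have lZ: "(?Z \<longlongrightarrow> Z0) at_top" unfolding Z0_def by (intro tendsto_add lim tendsto_const)
  have "((\<lambda>y. ?Z y ^ 3 - 3 * wp (\<alpha> y) (?\<tau> y) * ?Z y - wp' (\<alpha> y) (?\<tau> y))
      \<longlongrightarrow> Z0 ^ 3 - 3 * (- of_real (pi\<^sup>2 / 3)) * Z0 - 0) at_top"
    by (intro tendsto_intros lp lZ lim)
  moreover have "Z0 ^ 3 - 3 * (- of_real (pi\<^sup>2 / 3)) * Z0 - 0 \<noteq> 0"
  proof -
    have Z0: "Z0 = of_real (pi * (2 * s - 1)) * \<i>" by (simp add: Z0_def algebra_simps)
    have "Z0 ^ 3 - 3 * (- of_real (pi\<^sup>2 / 3)) * Z0 - 0 = Z0 * (Z0\<^sup>2 + of_real (pi\<^sup>2))"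
      by (simp add: power3_eq_cube power2_eq_square algebra_simps)
    also have "Z0\<^sup>2 + of_real (pi\<^sup>2) = of_real (pi\<^sup>2 * (4 * s * (1 - s)))"
      unfolding Z0 by (simp add: power_mult_distrib) (simp add: power2_eq_square algebra_simps)
    finally have eq: "Z0 ^ 3 - 3 * (- of_real (pi\<^sup>2 / 3)) * Z0 - 0 = Z0 * of_real (pi\<^sup>2 * (4 * s * (1 - s)))" .
    have "complex_of_real (pi * (2 * s - 1)) \<noteq> 0" "complex_of_real (pi\<^sup>2 * (4 * s * (1 - s))) \<noteq> 0"
      using s unfolding of_real_eq_0_iff by auto
    then show ?thesis unfolding eq unfolding Z0 mult_eq_0_iff using complex_i_not_zero by blast
  qed
  ultimately have "\<forall>\<^sub>F y in at_top. ?Z y ^ 3 - 3 * wp (\<alpha> y) (?\<tau> y) * ?Z y - wp' (\<alpha> y) (?\<tau> y) \<noteq> 0"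
    by (rule tendsto_imp_eventually_ne)
  with lim(4) eventually_gt_at_top[of 0]
  have "\<forall>\<^sub>F y in at_top. Im (?\<tau> y) > 0 \<and> \<alpha> y \<notin> lattice (?\<tau> y) \<and> Z2rs (of_real r) (of_real s) (?\<tau> y) \<noteq> 0"
  proof eventually_elim
    case (elim y)
    have \<tau>: "Im (?\<tau> y) > 0" using elim by simp
    have "Zrs (of_real r) (of_real s) (?\<tau> y) = ?Z y"
      using Zrs_eq_cot_sum[OF \<tau>, of "of_real r" "of_real s"] elim(1) by (simp add: \<alpha>_def)
    then have "Z2rs (of_real r) (of_real s) (?\<tau> y) = ?Z y ^ 3 - 3 * wp (\<alpha> y) (?\<tau> y) * ?Z y - wp' (\<alpha> y) (?\<tau> y)"
      by (simp add: Z2rs_def Let_def \<alpha>_def)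
    then show ?case using elim \<tau> by simp
  qed
  then obtain y where "Im (?\<tau> y) > 0 \<and> \<alpha> y \<notin> lattice (?\<tau> y) \<and> Z2rs (of_real r) (of_real s) (?\<tau> y) \<noteq> 0"
    using eventually_happens trivial_limit_at_top_linorder by blast
  then show ?thesis unfolding \<alpha>_def by blast
qed

lemma Z2rs_nonzero_real:
  fixes r s :: real
  assumes s: "2 * s \<notin> \<int>"
  shows "\<exists>\<tau>. Im \<tau> > 0 \<and> Z2rs (of_real r) (of_real s) \<tau> \<noteq> 0"
proof -
  define s' where "s' = frac s"
  have sZ: "s \<notin> \<int>" using s by (metis Ints_mult Ints_numeral)
  have 1: "s' \<noteq> 0" using sZ by (simp add: s'_def)
  have 2: "s' \<noteq> 1/2"
  proof
    assume "s' = 1/2"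
    then have "2 * s = 1 + 2 * of_int \<lfloor>s\<rfloor>" by (simp add: s'_def frac_def)
    then have "2 * s = of_int (1 + 2 * \<lfloor>s\<rfloor>)" by simp
    then show False using s by (metis Ints_of_int)
  qed
  have "0 < s'" "s' < 1" using 1 frac_ge_0[of s] frac_lt_1[of s] unfolding s'_def by linarith+
  then obtain \<tau> where t: "Im \<tau> > 0" "of_real r + of_real s' * \<tau> \<notin> lattice \<tau>" "Z2rs (of_real r) (of_real s') \<tau> \<noteq> 0"
    using Z2rs_nonzero_real_generic[of s' r] 2 by blast
  have "complex_of_real s = of_real s' + of_int \<lfloor>s\<rfloor>" by (simp add: s'_def frac_def)
  then have "Z2rs (of_real r) (of_real s) \<tau> = Z2rs (of_real r) (of_real s') \<tau>"
    using Z2rs_shift[OF t(1,2), of 0 "\<lfloor>s\<rfloor>"] by simp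
  then show ?thesis using t by auto
qed

section \<open>Parameters that are not both real, and the general case\<close>

text \<open>The equation \<alpha> = m + n \<tau> has the solution (m - r) / (s - n), and the
  integers have to place it in the upper half plane. If s is not real, n = 0 and a large m of
  suitable sign do; if s is real, m = 0 and an n beyond s on the side given by the sign of Im
  r.\<close>

lemma lattice_zero_exists:
  assumes "r \<notin> \<real> \<or> s \<notin> \<real>"
  obtains \<tau> m n where "Im \<tau> > 0" "r + s * \<tau> = lattice_pt \<tau> (m, n)" "s \<noteq> of_int n"
proof -
  have "\<exists>m n. Im ((of_int m - r) / (s - of_int n)) > 0 \<and> s \<noteq> of_int n"
  proof -
    have pos: "Im (a / b) > 0" if "Im a * Re b - Re a * Im b > 0" for a b :: complex
    proof -
      have "b \<noteq> 0" using that by auto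
      then have "(Re b)\<^sup>2 + (Im b)\<^sup>2 > 0" by (simp add: complex_neq_0)
      then show ?thesis using that by (simp add: Im_divide)
    qed
    show ?thesis
    proof (cases "Im s = 0")
      case False
      \<comment> \<open>The product of Re r - m with Im s must outweigh the fixed term Im r Re s;
        rounding goes in the direction that preserves this.\<close>
      define m where "m = (if Im s > 0 then \<lfloor>Re r - (\<bar>Im r * Re s\<bar> + 1) / Im s\<rfloor> else \<lceil>Re r + (\<bar>Im r * Re s\<bar> + 1) / (- Im s)\<rceil>)"
      have "(Re r - of_int m) * Im s \<ge> \<bar>Im r * Re s\<bar> + 1"
      proof (cases "Im s > 0")
        case True
        have "of_int m \<le> Re r - (\<bar>Im r * Re s\<bar> + 1) / Im s" using True by (simp add: m_def)
        then have "(\<bar>Im r * Re s\<bar> + 1) / Im s \<le> Re r - of_int m" by linarith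
        then show ?thesis using True by (simp add: pos_divide_le_eq)
      next
        case F: False
        have neg: "- Im s > 0" using False F by simp
        have "of_int m \<ge> Re r + (\<bar>Im r * Re s\<bar> + 1) / (- Im s)" using F by (simp add: m_def)
        then have "(\<bar>Im r * Re s\<bar> + 1) / (- Im s) \<le> of_int m - Re r" by linarith
        then have "\<bar>Im r * Re s\<bar> + 1 \<le> (of_int m - Re r) * (- Im s)" using neg by (simp only: pos_divide_le_eq)
        then show ?thesis by (simp add: algebra_simps)
      qed
      then have "Im (of_int m - r) * Re (s - of_int 0) - Re (of_int m - r) * Im (s - of_int 0) > 0"
        by (simp add: algebra_simps)
      from pos[OF this] False show ?thesis by (intro exI[of _ m] exI[of _ 0]) auto
    next
      case True
      then have r: "Im r \<noteq> 0" using assms by (auto simp: complex_is_Real_iff)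
      define n where "n = (if Im r > 0 then \<lfloor>Re s\<rfloor> + 1 else \<lceil>Re s\<rceil> - 1)"
      have n: "(Im r > 0 \<and> of_int n > Re s) \<or> (Im r < 0 \<and> of_int n < Re s)"
        using r by (cases "Im r > 0") (auto simp: n_def, linarith+)
      then have "Im (of_int 0 - r) * Re (s - of_int n) - Re (of_int 0 - r) * Im (s - of_int n) > 0"
        using True by (auto simp: mult_pos_pos mult_neg_neg mult_less_0_iff zero_less_mult_iff)
      moreover have "s \<noteq> of_int n" using n by auto
      ultimately show ?thesis using pos by blast
    qed
  qed
  then obtain m n where mn: "Im ((of_int m - r) / (s - of_int n)) > 0" "s \<noteq> of_int n" by blast
  define \<tau> where "\<tau> = (of_int m - r) / (s - of_int n)"
  have "(s - of_int n) * \<tau> = of_int m - r" using mn(2) by (simp add: \<tau>_def)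
  then have "r + s * \<tau> = lattice_pt \<tau> (m, n)" by (simp add: lattice_pt_def algebra_simps)
  then show thesis using mn by (intro that[of \<tau> m n]) (auto simp: \<tau>_def)
qed

lemma Z2rs_nonzero_exists:
  assumes rs: "\<not> (2 * r \<in> \<int> \<and> 2 * s \<in> \<int>)"
  shows "\<exists>\<tau>. Im \<tau> > 0 \<and> r + s * \<tau> \<notin> lattice \<tau> \<and> Z2rs r s \<tau> \<noteq> 0"
proof (cases "r \<in> \<real> \<and> s \<in> \<real>")
  case False
  then obtain \<tau>1 m n where t: "Im \<tau>1 > 0" "r + s * \<tau>1 = lattice_pt \<tau>1 (m, n)" "s \<noteq> of_int n"
    using lattice_zero_exists[of r s] by blast
  define r' s' where "r' = r - of_int m" and "s' = s - of_int n"
  have 0: "r' + s' * \<tau>1 = 0" using t(2) by (simp add: r'_def s'_def lattice_pt_def algebra_simps)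
  have s': "s' \<noteq> 0" using t(3) by (simp add: s'_def)
  note near = notin_near_lattice_point[OF t(1) 0 s']
  have "\<forall>\<^sub>F \<tau> in at \<tau>1. Z2rs r' s' \<tau> * (r' + s' * \<tau>) \<noteq> 0"
    by (rule tendsto_imp_eventually_ne[OF Z2rs_at_lattice_point[OF t(1) 0 s']]) (use s' in simp)
  with near have "\<forall>\<^sub>F \<tau> in at \<tau>1. Im \<tau> > 0 \<and> r' + s' * \<tau> \<notin> lattice \<tau> \<and> Z2rs r' s' \<tau> \<noteq> 0"
    by eventually_elim auto
  then obtain \<tau> where \<tau>: "Im \<tau> > 0" "r' + s' * \<tau> \<notin> lattice \<tau>" "Z2rs r' s' \<tau> \<noteq> 0"
    using eventually_happens'[OF at_neq_bot] by blast
  have "r + s * \<tau> = (r' + s' * \<tau>) + lattice_pt \<tau> (m, n)"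
    by (simp add: r'_def s'_def lattice_pt_def algebra_simps)
  then have "r + s * \<tau> \<notin> lattice \<tau>" using \<tau>(2) by (simp add: lattice_add_iff)
  moreover have "Z2rs r s \<tau> \<noteq> 0" using Z2rs_shift[OF \<tau>(1,2), of m n] \<tau>(3) by (simp add: r'_def s'_def)
  ultimately show ?thesis using \<tau>(1) by blast
next
  case True
  then obtain x y :: real where xy: "r = of_real x" "s = of_real y" by (auto elim!: Reals_cases)
  have int_iff: "complex_of_real (2 * t) \<in> \<int> \<longleftrightarrow> 2 * t \<in> \<int>" for t
    by (rule of_real_in_Ints_iff)
  have "\<not> (2 * x \<in> \<int> \<and> 2 * y \<in> \<int>)" using rs int_iff[of x] int_iff[of y] by (simp add: xy)
  then have nin: "y \<notin> \<int> \<or> x \<notin> \<int>" using Ints_mult[OF Ints_numeral] by blast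
  have "\<exists>\<tau>. Im \<tau> > 0 \<and> Z2rs r s \<tau> \<noteq> 0"
  proof (cases "2 * y \<in> \<int>")
    case False
    then show ?thesis unfolding xy by (rule Z2rs_nonzero_real)
  next
    case True
    then have "2 * (- x) \<notin> \<int>" using \<open>\<not> (2 * x \<in> \<int> \<and> 2 * y \<in> \<int>)\<close> by simp
    from Z2rs_nonzero_real[OF this, of y] obtain \<tau> where t: "Im \<tau> > 0" "Z2rs s (- r) \<tau> \<noteq> 0" by (auto simp: xy)
    have "Z2rs s (- r) (- 1 / (- 1 / \<tau>)) = (- 1 / \<tau>) ^ 3 * Z2rs r s (- 1 / \<tau>)"
      by (rule Z2rs_inversion[OF Im_inversion[OF t(1)]])
    moreover have "- 1 / (- 1 / \<tau>) = \<tau>" by simp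
    ultimately have "Z2rs r s (- 1 / \<tau>) \<noteq> 0" using t(2) by auto
    then show ?thesis using Im_inversion[OF t(1)] by blast
  qed
  then show ?thesis using real_notin_lattice[OF _ nin] by (auto simp: xy)
qed

section \<open>Isolated zeros and the equivalence\<close>

text \<open>Each pair (m, n) gives a linear equation for \<tau>, which degenerates only for r = m
  and s = n. Removing countably many points leaves the half plane connected, as the identity theorem
  needs.\<close>

lemma countable_lattice_zeros:
  assumes "\<not> (2 * r \<in> \<int> \<and> 2 * s \<in> \<int>)"
  shows "countable {\<tau>. r + s * \<tau> \<in> lattice \<tau>}"
proof (rule countable_subset)
  show "{\<tau>. r + s * \<tau> \<in> lattice \<tau>} \<subseteq> range (\<lambda>k. (of_int (fst k) - r) / (s - of_int (snd k)))"
  proof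
    fix \<tau> assume "\<tau> \<in> {\<tau>. r + s * \<tau> \<in> lattice \<tau>}"
    then obtain k where k: "r + s * \<tau> = lattice_pt \<tau> k" by (auto simp: lattice_eq_range)
    then have e: "(s - of_int (snd k)) * \<tau> = of_int (fst k) - r" by (simp add: lattice_pt_def algebra_simps)
    have "s \<noteq> of_int (snd k)"
    proof
      assume s: "s = of_int (snd k)"
      then have "r = of_int (fst k)" using e by simp
      then have "2 * r \<in> \<int> \<and> 2 * s \<in> \<int>" using s by simp
      then show False using assms by blast
    qed
    then have "\<tau> = (of_int (fst k) - r) / (s - of_int (snd k))" using e by (simp add: field_simps)
    then show "\<tau> \<in> range (\<lambda>k. (of_int (fst k) - r) / (s - of_int (snd k)))" by blast
  qed
qed simp

text \<open>The identity theorem on the half plane without the lattice zeros of \<alpha>. The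
  conclusion makes the denominator of \<open>wp_p\<close> tend to 0 through nonzero values.\<close>

lemma Z2rs_isolated_zero:
  assumes rs: "\<not> (2 * r \<in> \<int> \<and> 2 * s \<in> \<int>)"
    and t0: "Im t0 > 0" "r + s * t0 \<notin> lattice t0"
  shows "\<forall>\<^sub>F t in at t0. Z2rs r s t \<noteq> 0"
proof (rule ccontr)
  assume fr: "\<not> (\<forall>\<^sub>F t in at t0. Z2rs r s t \<noteq> 0)"
  define D where "D = {t. Im t > 0} - {t. r + s * t \<in> lattice t}"
  have nb: "\<forall>\<^sub>F t in nhds t. t \<in> D" if "t \<in> D" for t
    using eventually_notin_lattice[of "\<lambda>t. r + s * t" t "\<lambda>t. t"] that by (auto simp: D_def intro!: continuous_intros)
  have op: "open D"
  proof (subst open_subopen, intro ballI)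
    fix t assume "t \<in> D"
    from nb[OF this] show "\<exists>T. open T \<and> t \<in> T \<and> T \<subseteq> D" unfolding eventually_nhds by blast
  qed
  have conn: "connected D"
    unfolding D_def
    by (rule connected_open_diff_countable)
       (auto simp: open_halfspace_Im_gt countable_lattice_zeros[OF rs] intro!: convex_connected convex_halfspace_Im_gt)
  have hol: "Z2rs r s holomorphic_on D"
    by (rule field_differentiable_imp_holomorphic_on) (auto simp: D_def intro: Z2rs_field_differentiable)
  have in_D: "t0 \<in> D" using t0 by (simp add: D_def)
  have "\<forall>\<^sub>F t in at t0. t \<in> D" using nb[OF in_D] by (simp add: eventually_nhds_conv_at)
  then have "\<exists>\<^sub>F t in at t0. Z2rs r s t = 0 \<and> t \<in> D"
    using fr by (intro frequently_eventually_frequently) (auto simp: frequently_def)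
  then have "t0 islimpt {t \<in> D. Z2rs r s t = 0}"
    unfolding islimpt_conv_frequently_at by (auto elim: frequently_elim1)
  then have zero: "Z2rs r s t = 0" if "t \<in> D" for t
    by (rule analytic_continuation[OF hol op conn _ in_D _ _ that, rotated]) auto
  from Z2rs_nonzero_exists[OF rs] obtain t where "t \<in> D" "Z2rs r s t \<noteq> 0" by (auto simp: D_def)
  then show False using zero by blast
qed

theorem theorem2p1:
  fixes r s \<tau>0 :: complex
  assumes "\<not> (2 * r \<in> \<int> \<and> 2 * s \<in> \<int>)"
    and "Im \<tau>0 > 0"
  shows "filterlim (wp_p r s) at_infinity (at \<tau>0) \<longleftrightarrow>
           (r + s * \<tau>0 \<in> lattice \<tau>0 \<or>
            (r + s * \<tau>0 \<notin> lattice \<tau>0 \<and> Z2rs r s \<tau>0 = 0))"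
proof (cases "r + s * \<tau>0 \<in> lattice \<tau>0")
  case True
  then obtain k where k: "r + s * \<tau>0 = lattice_pt \<tau>0 k" by (auto simp: lattice_eq_range)
  define r' s' where "r' = r - of_int (fst k)" and "s' = s - of_int (snd k)"
  have 0: "r' + s' * \<tau>0 = 0" using k by (simp add: r'_def s'_def lattice_pt_def algebra_simps)
  have s': "s' \<noteq> 0"
  proof
    assume "s' = 0"
    then have "r = of_int (fst k)" "s = of_int (snd k)" using 0 by (auto simp: r'_def s'_def)
    then show False using assms(1) by simp
  qed
  have "\<forall>\<^sub>F \<tau> in at \<tau>0. wp_p r' s' \<tau> = wp_p r s \<tau>"
    \<comment> \<open>The shift law holds off the lattice only, but a punctured neighbourhood is all
      that the limit sees.\<close>
    using notin_near_lattice_point[OF assms(2) 0 s']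
  proof eventually_elim
    case (elim \<tau>)
    then show ?case using wp_p_shift[of \<tau> r' s' "fst k" "snd k"] by (simp add: r'_def s'_def)
  qed
  then have "filterlim (wp_p r s) at_infinity (at \<tau>0)"
    using filterlim_cong[OF refl refl] wp_p_at_lattice_point[OF assms(2) 0 s'] by blast
  then show ?thesis using True by simp
next
  case False
  let ?\<alpha> = "\<lambda>\<tau>. r + s * \<tau>"
  define N where "N \<tau> = 3 * wp' (?\<alpha> \<tau>) \<tau> * (Zrs r s \<tau>)\<^sup>2 + (12 * (wp (?\<alpha> \<tau>) \<tau>)\<^sup>2 - g2 \<tau>) * Zrs r s \<tau>
      + 3 * wp (?\<alpha> \<tau>) \<tau> * wp' (?\<alpha> \<tau>) \<tau>" for \<tau>
  have wpp: "wp_p r s \<tau> = wp (?\<alpha> \<tau>) \<tau> + N \<tau> / (2 * Z2rs r s \<tau>)" for \<tau>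
    by (simp add: wp_p_def Let_def N_def)
  have lim: "((\<lambda>\<tau>. wp (?\<alpha> \<tau>) \<tau>) \<longlongrightarrow> wp (?\<alpha> \<tau>0) \<tau>0) (at \<tau>0)" "((\<lambda>\<tau>. wp' (?\<alpha> \<tau>) \<tau>) \<longlongrightarrow> wp' (?\<alpha> \<tau>0) \<tau>0) (at \<tau>0)"
    "(g2 \<longlongrightarrow> g2 \<tau>0) (at \<tau>0)" "(Zrs r s \<longlongrightarrow> Zrs r s \<tau>0) (at \<tau>0)" "(Z2rs r s \<longlongrightarrow> Z2rs r s \<tau>0) (at \<tau>0)"
    using wp_tau_field_differentiable[OF False assms(2)] wp'_tau_field_differentiable[OF False assms(2)]
      g2_tau_field_differentiable[OF assms(2)] Z2rs_field_differentiable[OF assms(2) False]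
    by (auto dest!: field_differentiable_imp_continuous_at simp: isCont_def)
  have lN: "(N \<longlongrightarrow> N \<tau>0) (at \<tau>0)" unfolding N_def by (intro tendsto_intros lim)
  have l2: "((\<lambda>\<tau>. 2 * Z2rs r s \<tau>) \<longlongrightarrow> 2 * Z2rs r s \<tau>0) (at \<tau>0)" by (intro tendsto_intros lim)
  show ?thesis
  proof (cases "Z2rs r s \<tau>0 = 0")
    case True
    have "N \<tau>0 \<noteq> 0" unfolding N_def by (rule wp_p_numerator_nonzero[OF assms(2) False assms(1) True])
    moreover have "filterlim (\<lambda>\<tau>. 2 * Z2rs r s \<tau>) (at 0) (at \<tau>0)"
      using l2 True Z2rs_isolated_zero[OF assms False] by (simp add: filterlim_at)
    ultimately have "filterlim (\<lambda>\<tau>. N \<tau> / (2 * Z2rs r s \<tau>)) at_infinity (at \<tau>0)"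
      using filterlim_divide_at_infinity[OF lN] by blast
    then have "filterlim (\<lambda>\<tau>. wp (?\<alpha> \<tau>) \<tau> + N \<tau> / (2 * Z2rs r s \<tau>)) at_infinity (at \<tau>0)"
      by (rule tendsto_add_filterlim_at_infinity[OF lim(1)])
    then have "filterlim (wp_p r s) at_infinity (at \<tau>0)" by (simp only: wpp[symmetric])
    then show ?thesis using True False by simp
  next
    case nz: False
    have "((\<lambda>\<tau>. wp (?\<alpha> \<tau>) \<tau> + N \<tau> / (2 * Z2rs r s \<tau>)) \<longlongrightarrow> wp (?\<alpha> \<tau>0) \<tau>0 + N \<tau>0 / (2 * Z2rs r s \<tau>0)) (at \<tau>0)"
      by (intro tendsto_add tendsto_divide lim lN l2) (use nz in simp)
    then have "(wp_p r s \<longlongrightarrow> wp_p r s \<tau>0) (at \<tau>0)" by (simp only: wpp[symmetric])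
    then have "\<not> filterlim (wp_p r s) at_infinity (at \<tau>0)"
      using not_tendsto_and_filterlim_at_infinity[of "at \<tau>0"] by auto
    then show ?thesis using False nz by simp
  qed
qed

end
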